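(* Let $L:\mathbb{R}\times\mathbb{R}^n\times\mathbb{R}^n\times\mathbb{R}\to\mathbb{R}$ be of class $C^1$ and satisfy conditions (L1), (L2), (L3), (L4) listed in the context. Let $a<b$, $x,y\in\mathbb{R}^n$, $u\in\mathbb{R}$, and let $\xi\in\Gamma^{a,b}_{x,y}$ be a minimizer of $J$ over $\mathcal{A}$, with $u_\xi$ the corresponding solution of $\dot u_\xi(s)=L(s,\xi(s),\dot\xi(s),u_\xi(s))$ a.e. on $[a,b]$, $u_\xi(a)=u$. Set $$\int_a^sL_u\,dr=\int_a^sL_u(r,\xi(r),\dot\xi(r),u_\xi(r))\,dr$$ and define, for almost all $s\in[a,b]$, $$E(s):=e^{-\int_a^sL_u\,dr}\cdot\Big\{L_v(s,\xi(s),\dot\xi(s),u_\xi(s))\cdot\dot\xi(s)-L(s,\xi(s),\dot\xi(s),u_\xi(s))\Big\}.$$ Then $E$ has a continuous representative $\bar E$ such that $\bar E$ is absolutely continuous on $[a,b]$ and $$\frac{d}{ds}\bar E(s)=-e^{-\int_a^sL_u\,dr}\,L_t(s,\xi(s),\dot\xi(s),u_\xi(s))$$ for almost all $s\in[a,b]$.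
   Context: Write $L=L(t,x,v,r)$; $L_t,L_x,L_v$ are the partial derivatives in $t,x,v$, and $L_r=L_u$ denotes the partial derivative in the last (real) variable. A function $\theta:[0,+\infty)\to[0,+\infty)$ is superlinear if $\theta(r)/r\to+\infty$ as $r\to+\infty$. Conditions: (L1) $L(t,x,\cdot,r)$ is strictly convex for all $(t,x,r)$. (L2) There exist two superlinear functions $\overline\theta_0,\theta_0:[0,+\infty)\to[0,+\infty)$ and two $L^\infty_{\rm loc}$ functions $c_0,c_1:\mathbb{R}\to[0,+\infty)$ such that $\overline\theta_0(|v|)+c_1(t)\geqslant L(t,x,v,0)\geqslant\theta_0(|v|)-c_0(t)$ for all $(t,x,v)\in\mathbb{R}\times\mathbb{R}^n\times\mathbb{R}^n$. (L3) There exists an $L^\infty_{\rm loc}$ function $K:\mathbb{R}\to[0,+\infty)$ such that $|L_r(t,x,v,r)|\leqslant K(t)$ for all $(t,x,v,r)$. (L4) There exist two $L^\infty_{\rm loc}$ functions $C_1,C_2:\mathbb{R}\to[0,+\infty)$ such that $|L_t(t,x,v,r)|\leqslant C_1(t)+C_2(t)L(t,x,v,r)$ for all $(t,x,v,r)$. $\Gamma^{a,b}_{x,y}=\{\xi\in W^{1,1}([a,b],\mathbb{R}^n):\xi(a)=x,\ \xi(b)=y\}$; $\mathcal{A}=\mathcal{A}^{a,b,u}_{x,y}$ is the set of $\xi\in\Gamma^{a,b}_{x,y}$ for which the problem $\dot u_\xi(s)=L(s,\xi(s),\dot\xi(s),u_\xi(s))$ a.e. on $[a,b]$, $u_\xi(a)=u$,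 admits an absolutely continuous solution $u_\xi$ (which is then unique); and $J(\xi)=\int_a^bL(s,\xi(s),\dot\xi(s),u_\xi(s))\,ds$ for $\xi\in\mathcal{A}$. *)

theory Defs
  imports "HOL-Analysis.Analysis"
begin

text \<open>The sets \<open>D\<close> below are the finite families of nonoverlapping compact subintervals
  of \<open>[a,b]\<close>; an interval \<open>I = [\<alpha>,\<beta>]\<close> in \<open>D\<close> has \<open>Inf I = \<alpha>\<close> and \<open>Sup I = \<beta>\<close>.
  (The library's \<open>absolutely_continuous\<close> is about measures.)\<close>

definition abs_continuous_on :: "real \<Rightarrow> real \<Rightarrow> (real \<Rightarrow> real) \<Rightarrow> bool" where
  "abs_continuous_on a b f \<longleftrightarrow>
     (\<forall>\<epsilon>>0. \<exists>\<delta>>0. \<forall>D S. D division_of S \<and> S \<subseteq> {a..b} \<and> (\<Sum>I\<in>D. Sup I - Inf I) < \<delta>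
        \<longrightarrow> (\<Sum>I\<in>D. \<bar>f (Sup I) - f (Inf I)\<bar>) < \<epsilon>)"

definition test_function :: "real \<Rightarrow> real \<Rightarrow> (real \<Rightarrow> real) \<Rightarrow> bool" where
  "test_function a b \<phi> \<longleftrightarrow> \<phi> C1_differentiable_on UNIV \<and> closure {s. \<phi> s \<noteq> 0} \<subseteq> {a<..<b}"

definition weak_derivative_on ::
  "real \<Rightarrow> real \<Rightarrow> (real \<Rightarrow> real ^ 'n) \<Rightarrow> (real \<Rightarrow> real ^ 'n) \<Rightarrow> bool" where
  "weak_derivative_on a b \<xi> g \<longleftrightarrow>
     (\<forall>\<phi>. test_function a b \<phi> \<longrightarrow>
        (LINT s:{a..b}|lebesgue. deriv \<phi> s *\<^sub>R \<xi> s) = - (LINT s:{a..b}|lebesgue. \<phi> s *\<^sub>R g s))"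

text \<open>Elements of \<open>W11\<close> are represented by their continuous representatives on \<open>[a,b]\<close>, so
  that boundary values make sense. Values outside \<open>[a,b]\<close> are irrelevant throughout.\<close>

definition W11 :: "real \<Rightarrow> real \<Rightarrow> (real \<Rightarrow> real ^ 'n) set" where
  "W11 a b = {\<xi>. continuous_on {a..b} \<xi> \<and>
     (\<exists>g. g absolutely_integrable_on {a..b} \<and> weak_derivative_on a b \<xi> g)}"

definition Gamma :: "real \<Rightarrow> real \<Rightarrow> real ^ 'n \<Rightarrow> real ^ 'n \<Rightarrow> (real \<Rightarrow> real ^ 'n) set" where
  "Gamma a b x y = {\<xi> \<in> W11 a b. \<xi> a = x \<and> \<xi> b = y}"

type_synonym 'n lagrangian = "real \<times> (real ^ 'n) \<times> (real ^ 'n) \<times> real \<Rightarrow> real"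

definition C1_function :: "('a::real_normed_vector \<Rightarrow> 'b::real_normed_vector) \<Rightarrow> bool" where
  "C1_function f \<longleftrightarrow>
     (\<exists>f' :: 'a \<Rightarrow> 'a \<Rightarrow>\<^sub>L 'b. (\<forall>p. (f has_derivative blinfun_apply (f' p)) (at p)) \<and> continuous_on UNIV f')"

definition L_t :: "'n::finite lagrangian \<Rightarrow> 'n lagrangian" where
  "L_t L = (\<lambda>(t, x, v, r). deriv (\<lambda>\<tau>. L (\<tau>, x, v, r)) t)"

definition L_v :: "'n::finite lagrangian \<Rightarrow> real \<times> (real ^ 'n) \<times> (real ^ 'n) \<times> real \<Rightarrow> real ^ 'n" where
  "L_v L = (\<lambda>(t, x, v, r). THE D. GDERIV (\<lambda>w. L (t, x, w, r)) v :> D)"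

definition L_r :: "'n::finite lagrangian \<Rightarrow> 'n lagrangian" where
  "L_r L = (\<lambda>(t, x, v, r). deriv (\<lambda>\<rho>. L (t, x, v, \<rho>)) r)"

definition strictly_convex :: "('a::real_vector \<Rightarrow> real) \<Rightarrow> bool" where
  "strictly_convex f \<longleftrightarrow>
     (\<forall>v w c. v \<noteq> w \<longrightarrow> 0 < c \<longrightarrow> c < 1 \<longrightarrow>
        f ((1 - c) *\<^sub>R v + c *\<^sub>R w) < (1 - c) * f v + c * f w)"

text \<open>Functions on \<open>[0,\<infinity>)\<close> are total functions whose values on negative arguments are ignored.\<close>

definition superlinear :: "(real \<Rightarrow> real) \<Rightarrow> bool" where
  "superlinear \<theta> \<longleftrightarrow> (\<forall>r\<ge>0. \<theta> r \<ge> 0) \<and> filterlim (\<lambda>r. \<theta> r / r) at_top at_top"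

definition nonneg_Linf_loc :: "(real \<Rightarrow> real) \<Rightarrow> bool" where
  "nonneg_Linf_loc c \<longleftrightarrow>
     c \<in> borel_measurable lebesgue \<and> (\<forall>t. c t \<ge> 0) \<and>
     (\<forall>K. compact K \<longrightarrow> (\<exists>M. AE t in lebesgue_on K. c t \<le> M))"

definition cond_L1 :: "'n::finite lagrangian \<Rightarrow> bool" where
  "cond_L1 L \<longleftrightarrow> (\<forall>t x r. strictly_convex (\<lambda>v. L (t, x, v, r)))"

definition cond_L2 :: "'n::finite lagrangian \<Rightarrow> bool" where
  "cond_L2 L \<longleftrightarrow>
     (\<exists>\<Theta> \<theta> c\<^sub>0 c\<^sub>1. superlinear \<Theta> \<and> superlinear \<theta> \<and> nonneg_Linf_loc c\<^sub>0 \<and> nonneg_Linf_loc c\<^sub>1 \<and>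
        (\<forall>t x v. \<Theta> (norm v) + c\<^sub>1 t \<ge> L (t, x, v, 0) \<and> L (t, x, v, 0) \<ge> \<theta> (norm v) - c\<^sub>0 t))"

definition cond_L3 :: "'n::finite lagrangian \<Rightarrow> bool" where
  "cond_L3 L \<longleftrightarrow>
     (\<exists>K. nonneg_Linf_loc K \<and> (\<forall>t x v r. \<bar>L_r L (t, x, v, r)\<bar> \<le> K t))"

definition cond_L4 :: "'n::finite lagrangian \<Rightarrow> bool" where
  "cond_L4 L \<longleftrightarrow>
     (\<exists>C\<^sub>1 C\<^sub>2. nonneg_Linf_loc C\<^sub>1 \<and> nonneg_Linf_loc C\<^sub>2 \<and>
        (\<forall>t x v r. \<bar>L_t L (t, x, v, r)\<bar> \<le> C\<^sub>1 t + C\<^sub>2 t * L (t, x, v, r)))"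

text \<open>A continuous representative of a \<open>W11\<close> curve is differentiable almost everywhere and
  its classical derivative is its weak derivative, so \<open>\<xi>'\<close> may be taken pointwise.\<close>

definition lift :: "(real \<Rightarrow> real ^ 'n) \<Rightarrow> (real \<Rightarrow> real) \<Rightarrow> real \<Rightarrow> real \<times> (real ^ 'n) \<times> (real ^ 'n) \<times> real"
  where "lift \<xi> w s = (s, \<xi> s, vector_derivative \<xi> (at s), w s)"

definition herglotz_solution ::
  "'n::finite lagrangian \<Rightarrow> real \<Rightarrow> real \<Rightarrow> real \<Rightarrow> (real \<Rightarrow> real ^ 'n) \<Rightarrow> (real \<Rightarrow> real) \<Rightarrow> bool" where
  "herglotz_solution L a b u \<xi> w \<longleftrightarrow>
     abs_continuous_on a b w \<and> w a = u \<and>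
     (AE s in lebesgue_on {a..b}. (w has_real_derivative L (lift \<xi> w s)) (at s))"

definition admissible ::
  "'n::finite lagrangian \<Rightarrow> real \<Rightarrow> real \<Rightarrow> real \<Rightarrow> real ^ 'n \<Rightarrow> real ^ 'n \<Rightarrow> (real \<Rightarrow> real ^ 'n) set" where
  "admissible L a b u x y = {\<xi> \<in> Gamma a b x y. \<exists>w. herglotz_solution L a b u \<xi> w}"

text \<open>Under the hypotheses considered, two solutions for the same \<open>\<xi>\<close> agree on \<open>[a,b]\<close>, so the
  choice below only affects irrelevant values.\<close>

definition u_sol ::
  "'n::finite lagrangian \<Rightarrow> real \<Rightarrow> real \<Rightarrow> real \<Rightarrow> (real \<Rightarrow> real ^ 'n) \<Rightarrow> real \<Rightarrow> real" where
  "u_sol L a b u \<xi> = (SOME w. herglotz_solution L a b u \<xi> w)"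

definition J ::
  "'n::finite lagrangian \<Rightarrow> real \<Rightarrow> real \<Rightarrow> real \<Rightarrow> (real \<Rightarrow> real ^ 'n) \<Rightarrow> real" where
  "J L a b u \<xi> = (LINT s:{a..b}|lebesgue. L (lift \<xi> (u_sol L a b u \<xi>) s))"

definition discount ::
  "'n::finite lagrangian \<Rightarrow> real \<Rightarrow> (real \<Rightarrow> real ^ 'n) \<Rightarrow> (real \<Rightarrow> real) \<Rightarrow> real \<Rightarrow> real" where
  "discount L a \<xi> w s = exp (- (LINT r:{a..s}|lebesgue. L_r L (lift \<xi> w r)))"

definition energy ::
  "'n::finite lagrangian \<Rightarrow> real \<Rightarrow> (real \<Rightarrow> real ^ 'n) \<Rightarrow> (real \<Rightarrow> real) \<Rightarrow> real \<Rightarrow> real" where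
  "energy L a \<xi> w s =
     discount L a \<xi> w s *
       (L_v L (lift \<xi> w s) \<bullet> vector_derivative \<xi> (at s) - L (lift \<xi> w s))"

end

theory Submission
  imports Defs
begin

text \<open>
  The curve is compared with its reparametrizations. For bounded measurable \<open>h\<close> supported in
  \<open>{\<bar>\<xi>'\<bar> \<le> R}\<close> with \<open>\<integral>h = 0\<close>, let \<open>\<alpha> = 1 + \<epsilon>h\<close>, \<open>\<tau>(s) = a + \<integral>\<^sub>a\<^sup>s \<alpha>\<close> and
  \<open>\<eta> = \<xi> \<circ> \<tau>\<^sup>-\<^sup>1\<close>. If \<open>W' = \<alpha> L(\<tau>, \<xi>, \<xi>'/\<alpha>, W)\<close> with \<open>W(a) = u\<close>, then \<open>W \<circ> \<tau>\<^sup>-\<^sup>1\<close> solves the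
  equation along \<open>\<eta>\<close>, so minimality gives \<open>W(b) \<ge> u\<^sub>\<xi>(b)\<close>. The difference \<open>W - u\<^sub>\<xi>\<close> satisfies a
  linear equation whose coefficient is a difference quotient of \<open>L\<close> in its last variable; solving
  it, dividing by \<open>\<epsilon>\<close> and letting \<open>\<epsilon> \<rightarrow> 0\<close> yields, with \<open>H(s) = \<integral>\<^sub>a\<^sup>s h\<close> and
  \<open>m = exp(- \<integral>\<^sub>a L\<^sub>u)\<close>,
  \<open>\<integral> m (h (L - L\<^sub>v \<cdot> \<xi>') + H L\<^sub>t) \<ge> 0\<close>, and equality after replacing \<open>h\<close> by \<open>-h\<close>. Integrating by
  parts, \<open>\<integral> h (E + \<integral>\<^sub>a m L\<^sub>t) = 0\<close> for all such \<open>h\<close>, so \<open>E + \<integral>\<^sub>a m L\<^sub>t\<close> is a.e. equal to a constant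
  on every set \<open>{\<bar>\<xi>'\<bar> \<le> R}\<close>, hence on \<open>[a,b]\<close>.
\<close>

section \<open>Absolutely continuous functions\<close>

text \<open>Why reparametrizations: they leave the image of \<xi> in place, so the variation
  involves \<open>L_t\<close>, \<open>L_v\<close> and \<open>L_r\<close> but never the derivative of
  L in x, for which no bound is assumed. The one new effect is a shift in time, which is what
  \<open>cond_L4\<close> controls. The condition \<integral> h = 0 keeps the endpoint b fixed.
  Minimality turns into a comparison of endpoint values because J(\<eta>) is the increment of the
  solution along \<eta>.

  The obstacle is that L_v \<cdot> \<xi>' is not known to be integrable, so the fundamental lemma of
  the calculus of variations cannot be applied to E directly. Cutting h off outside {|\<xi>'| \<le>
  R} makes E bounded wherever h is nonzero; the constants obtained for different R are matched
  afterwards. The price is that h is merely measurable: \<tau> is then only bi-Lipschitz, and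
  absolute continuity, null sets and the chain rule have to be carried through its inverse by
  hand.\<close>

lemma AE_lebesgue_on_iff_negligible:
  fixes a b :: real
  shows "(AE s in lebesgue_on {a..b}. P s) \<longleftrightarrow> negligible {s \<in> {a..b}. \<not> P s}"
proof -
  have "(AE s in lebesgue_on {a..b}. P s) \<longleftrightarrow> (AE s in lebesgue. s \<in> {a..b} \<longrightarrow> P s)"
    by (subst AE_restrict_space_iff) auto
  also have "\<dots> \<longleftrightarrow> negligible {s \<in> {a..b}. \<not> P s}"
    unfolding eventually_ae_filter_negligible
    by (auto intro: negligible_subset exI[of _ "{s \<in> {a..b}. \<not> P s}"])
  finally show ?thesis .
qed

lemma division_of_intervals:
  fixes S :: "real set"
  assumes D: "D division_of S" and S: "S \<subseteq> {a..b}" and I: "I \<in> D"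
  obtains u v where "I = {u..v}" "u \<le> v" "{u..v} \<subseteq> {a..b}"
proof -
  obtain u v where "I = cbox u v" "I \<noteq> {}" "I \<subseteq> S"
    using division_ofD(2-4)[OF D] I by meson
  then show ?thesis using order_trans[OF \<open>I \<subseteq> S\<close> S] that[of u v] by auto
qed

text \<open>Links the total length in \<open>abs_continuous_on\<close> with Lebesgue measure, so
  that smallness of a division can be read off from a containing set of small measure.\<close>

lemma sum_length_division:
  fixes S :: "real set"
  assumes "D division_of S"
  shows "(\<Sum>I\<in>D. Sup I - Inf I) = measure lebesgue S" and "S \<in> lmeasurable"
proof -
  show S: "S \<in> lmeasurable"
  proof -
    have "S = \<Union>D" "finite D" using assms by auto
    moreover have "I \<in> lmeasurable" if "I \<in> D" for I
      using assms that by blast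
    ultimately show ?thesis by (simp add: fmeasurable.finite_Union subset_iff)
  qed
  have "(\<Sum>I\<in>D. Sup I - Inf I) = (\<Sum>I\<in>D. integral I (\<lambda>x. 1))"
  proof (rule sum.cong[OF refl])
    fix I assume "I \<in> D"
    then obtain u v where "I = cbox u v" "I \<noteq> {}"
      using division_ofD(3,4)[OF assms] by blast
    then show "Sup I - Inf I = integral I (\<lambda>x. 1)"
      by (auto simp: content_real)
  qed
  also have "\<dots> = integral S (\<lambda>x. 1)"
    using integral_combine_division_topdown[OF integrable_on_const[OF S, of "1::real"] assms] by simp
  also have "\<dots> = measure lebesgue S"
    using S by (simp add: lmeasure_integral)
  finally show "(\<Sum>I\<in>D. Sup I - Inf I) = measure lebesgue S" .
qed

text \<open>The gauge forces intervals tagged in the exceptional null set into an open set of small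
  measure, where absolute continuity controls the increments directly.\<close>

lemma abs_continuous_has_integral:
  fixes F f :: "real \<Rightarrow> real"
  assumes "a \<le> b" and ac: "abs_continuous_on a b F" and N: "negligible N"
    and der: "\<And>s. s \<in> {a..b} - N \<Longrightarrow> (F has_real_derivative f s) (at s)"
  shows "(f has_integral (F b - F a)) {a..b}"
proof -
  \<comment> \<open>On \<open>N\<close> the values of f are arbitrary; zero there makes an interval
    tagged in \<open>N\<close> contribute only the increment of F to the error.\<close>
  define g where "g s = (if s \<in> N then 0 else f s)" for s
  have "(g has_integral (F b - F a)) {a..b}"
    unfolding has_integral_real
  proof (intro allI impI)
    fix e :: real assume "e > 0"
    then obtain \<delta> where "\<delta> > 0" and \<delta>:
      "\<And>D S. D division_of S \<Longrightarrow> S \<subseteq> {a..b} \<Longrightarrow> (\<Sum>I\<in>D. Sup I - Inf I) < \<delta>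
        \<Longrightarrow> (\<Sum>I\<in>D. \<bar>F (Sup I) - F (Inf I)\<bar>) < e/2"
      using ac unfolding abs_continuous_on_def by (metis half_gt_zero)
    obtain U where U: "open U" "N \<subseteq> U" "U \<in> lmeasurable" "measure lebesgue U < \<delta>"
    proof -
      obtain T where T: "open T" "N \<subseteq> T" "T - N \<in> lmeasurable" "emeasure lebesgue (T - N) < ennreal \<delta>"
        using sets_lebesgue_outer_open[OF negligible_imp_sets[OF N] \<open>\<delta> > 0\<close>] by metis
      have "T = (T - N) \<union> N" using T by auto
      have "T \<in> lmeasurable"
        using \<open>T = (T - N) \<union> N\<close> fmeasurable.Un[OF T(3) negligible_imp_measurable[OF N]] by simp
      moreover have "measure lebesgue T = measure lebesgue (T - N)"
        using \<open>T = (T - N) \<union> N\<close> measure_Un_null_set[OF fmeasurableD[OF T(3)], of N] N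
        by (simp add: negligible_iff_null_sets)
      moreover have "measure lebesgue (T - N) < \<delta>"
        using T(4) \<open>\<delta> > 0\<close> by (simp add: emeasure_eq_measure2[OF T(3)] ennreal_less_iff)
      ultimately show ?thesis using T that by auto
    qed
    \<comment> \<open>The summand 1 in the denominator covers \<open>a = b\<close>; the other half
      of e is reserved for the intervals tagged in \<open>N\<close>.\<close>
    define e' where "e' = e / (2 * (b - a + 1))"
    have e': "e' > 0" "e' * (b - a) < e / 2"
      using \<open>e > 0\<close> \<open>a \<le> b\<close> by (auto simp: e'_def field_simps)
    have "\<exists>d>0. (x \<in> N \<longrightarrow> ball x d \<subseteq> U) \<and> (x \<in> {a..b} - N \<longrightarrow>
         (\<forall>y. \<bar>y - x\<bar> < d \<longrightarrow> \<bar>F y - F x - (y-x) * f x\<bar> \<le> e' * \<bar>y-x\<bar>))" for x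
    proof (cases "x \<in> N")
      case True
      then show ?thesis using U(1,2) open_contains_ball by (metis DiffD2 subsetD)
    next
      case False
      show ?thesis
      proof (cases "x \<in> {a..b}")
        case True
        then have "(F has_derivative (\<lambda>h. h * f x)) (at x)"
          using der[of x] False by (simp add: has_field_derivative_def mult_commute_abs)
        then show ?thesis
          using e'(1) False unfolding has_derivative_at_alt real_norm_def by blast
      qed (use False in \<open>auto intro: zero_less_one\<close>)
    qed
    then obtain d where d0: "\<And>x. d x > 0" and dN: "\<And>x. x \<in> N \<Longrightarrow> ball x (d x) \<subseteq> U"
      and dF: "\<And>x y. x \<in> {a..b} - N \<Longrightarrow> \<bar>y - x\<bar> < d x \<Longrightarrow> \<bar>F y - F x - (y-x) * f x\<bar> \<le> e' * \<bar>y-x\<bar>"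
      by metis
    show "\<exists>\<gamma>. gauge \<gamma> \<and> (\<forall>p. p tagged_division_of {a..b} \<and> \<gamma> fine p \<longrightarrow>
        norm (sum (\<lambda>(x,k). measure lborel k *\<^sub>R g x) p - (F b - F a)) < e)"
    proof (rule exI, safe)
      show "gauge (\<lambda>x. ball x (d x))" using d0 gauge_ball_dependent by blast
    next
      fix p assume p: "p tagged_division_of {a..b}" and fine: "(\<lambda>x. ball x (d x)) fine p"
      have fin: "finite p" using p by blast
      define pN where "pN = {(x,K) \<in> p. x \<in> N}"
      have K: "\<exists>u v. K = {u..v} \<and> u \<le> v \<and> x \<in> {u..v} \<and> {u..v} \<subseteq> {a..b} \<and> {u..v} \<subseteq> ball x (d x)"
        if "(x,K) \<in> p" for x K
      proof -
        have "x \<in> K" "K \<subseteq> {a..b}" "\<exists>u v. K = cbox u v" using p that by blast+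
        moreover have "K \<subseteq> ball x (d x)" using fine that by blast
        ultimately show ?thesis by force
      qed
      have part: "pN tagged_division_of \<Union>(snd ` pN)"
        using p by (intro tagged_partial_division_of_Union_self[of _ "{a..b}"])
          (auto simp: pN_def tagged_division_of_def intro: tagged_partial_division_subset)
      have ne: "K \<noteq> {}" if "(x,K) \<in> pN" for x K
        using K[of x K] that by (auto simp: pN_def)
      \<comment> \<open>\<open>sum.over_tagged_division_lemma\<close> wants a function of sets that
        vanishes on degenerate intervals, while \<open>Sup\<close> and \<open>Inf\<close> of the
        empty set are unspecified; hence the value 0 there.\<close>
      define G where "G K = (if K = {} then 0 else \<bar>F (Sup K) - F (Inf K)\<bar>)" for K
      have "(\<Sum>(x,K)\<in>pN. \<bar>F (Sup K) - F (Inf K)\<bar>) = (\<Sum>(x,K)\<in>pN. G K)"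
        using ne by (intro sum.cong) (auto simp: G_def)
      also have "\<dots> = (\<Sum>K\<in>snd ` pN. G K)"
      proof (rule sum.over_tagged_division_lemma[OF part])
        fix u v :: real assume "box u v = {}"
        then have "cbox u v = {} \<or> u = v" by auto
        then show "G (cbox u v) = 0" by (auto simp: G_def)
      qed
      also have "\<dots> = (\<Sum>K\<in>snd ` pN. \<bar>F (Sup K) - F (Inf K)\<bar>)"
        using ne by (intro sum.cong) (auto simp: G_def)
      also have "\<dots> < e/2"
      proof (rule \<delta>)
        have *: "snd ` pN division_of \<Union>(snd ` pN)" using part by (rule division_of_tagged_division)
        then show "snd ` pN division_of \<Union>(snd ` pN)" .
        show "\<Union>(snd ` pN) \<subseteq> {a..b}" using K by (fastforce simp: pN_def)
        have "\<Union>(snd ` pN) \<subseteq> U"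
        proof clarsimp
          fix x y K assume "(y,K) \<in> pN" "x \<in> K"
          then have "(y,K) \<in> p" "y \<in> N" by (auto simp: pN_def)
          then show "x \<in> U" using K[of y K] dN[of y] \<open>x \<in> K\<close> by blast
        qed
        then have "measure lebesgue (\<Union>(snd ` pN)) \<le> measure lebesgue U"
          using sum_length_division(2)[OF *] U(3) by (intro measure_mono_fmeasurable) auto
        then show "(\<Sum>I\<in>snd ` pN. Sup I - Inf I) < \<delta>"
          using sum_length_division(1)[OF *] U(4) by simp
      qed
      finally have sN: "(\<Sum>(x,K)\<in>pN. \<bar>F (Sup K) - F (Inf K)\<bar>) < e/2" .
      have ba: "b - a = (\<Sum>(x,K)\<in>p. Sup K - Inf K)" "F b - F a = (\<Sum>(x,K)\<in>p. F(Sup K) - F(Inf K))"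
        using additive_tagged_division_1[where f= "\<lambda>x. x"] additive_tagged_division_1[where f= F]
            \<open>a \<le> b\<close> p by auto
      have "\<bar>(\<Sum>(x, K) \<in> p. (measure lborel K *\<^sub>R g x) - (F (Sup K) - F (Inf K)))\<bar>
          \<le> (\<Sum>(x,K)\<in>p. e' * (Sup K - Inf K) + (if x \<in> N then \<bar>F (Sup K) - F (Inf K)\<bar> else 0))"
      proof (rule order_trans[OF sum_abs], rule sum_mono, clarify)
        fix x K assume xK: "(x,K) \<in> p"
        then obtain u v where uv: "K = {u..v}" "u \<le> v" "x \<in> {u..v}" "{u..v} \<subseteq> {a..b}" "{u..v} \<subseteq> ball x (d x)"
          using K by blast
        show "\<bar>measure lborel K *\<^sub>R g x - (F (Sup K) - F (Inf K))\<bar>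
          \<le> e' * (Sup K - Inf K) + (if x \<in> N then \<bar>F (Sup K) - F (Inf K)\<bar> else 0)"
        proof (cases "x \<in> N")
          case True
          moreover have "0 \<le> e' * (v - u)" using uv(2) e'(1) by simp
          ultimately show ?thesis using uv(1,2) by (simp add: g_def abs_minus_commute)
        next
          case False
          have "u \<in> {u..v}" "v \<in> {u..v}" using uv by auto
          then have "\<bar>u - x\<bar> < d x" "\<bar>v - x\<bar> < d x"
            using uv(5) by (auto simp: dist_real_def subset_iff)
          then have "\<bar>F u - F x - (u-x) * f x\<bar> \<le> e' * \<bar>u-x\<bar>" "\<bar>F v - F x - (v-x) * f x\<bar> \<le> e' * \<bar>v-x\<bar>"
            using dF[of x] False uv(3,4) by blast+
          \<comment> \<open>The tag lies between u and v, so the two errors add up to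
            \<open>e' * (v - u)\<close>.\<close>
          moreover have "e' * \<bar>u-x\<bar> = e' * (x - u)" "e' * \<bar>v-x\<bar> = e' * (v - x)" using uv(3) by auto
          ultimately show ?thesis
            using uv(1,2) False by (simp add: g_def algebra_simps abs_le_iff)
        qed
      qed
      also have "\<dots> = e' * (b - a) + (\<Sum>(x,K)\<in>p. (if x \<in> N then \<bar>F (Sup K) - F (Inf K)\<bar> else 0))"
        by (simp add: ba(1) split_def sum.distrib sum_distrib_left)
      also have "(\<Sum>(x,K)\<in>p. (if x \<in> N then \<bar>F (Sup K) - F (Inf K)\<bar> else 0)) = (\<Sum>(x,K)\<in>pN. \<bar>F (Sup K) - F (Inf K)\<bar>)"
        unfolding pN_def split_def sum.If_cases[OF fin]
        by (auto intro!: sum.cong)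
      also have "e' * (b - a) + \<dots> < e" using sN e' by linarith
      finally show "norm ((\<Sum>(x, K)\<in>p. measure lborel K *\<^sub>R g x) - (F b - F a)) < e"
        by (simp add: ba split_def sum_subtractf)
    qed
  qed
  then show ?thesis
    by (rule has_integral_spike[OF N, rotated]) (auto simp: g_def)
qed

text \<open>The working form of absolute continuity: it also makes sense for vector-valued functions
  and carries the density as data. For real functions \<open>primitive_on_iff_abs_continuous\<close>
  identifies it with the epsilon-delta form.\<close>

definition primitive_on :: "real \<Rightarrow> real \<Rightarrow> (real \<Rightarrow> 'a::euclidean_space) \<Rightarrow> (real \<Rightarrow> 'a) \<Rightarrow> bool" where
  "primitive_on a b F f \<longleftrightarrow>
     f absolutely_integrable_on {a..b} \<and> (\<forall>t\<in>{a..b}. F t = F a + integral {a..t} f)"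

lemma abs_continuous_on_subinterval:
  assumes "abs_continuous_on a b F" "a \<le> c" "d \<le> b"
  shows "abs_continuous_on c d F"
proof -
  have "{c..d} \<subseteq> {a..b}" using assms by auto
  then show ?thesis using assms(1) unfolding abs_continuous_on_def by (meson order_trans)
qed

text \<open>\<open>abs_continuous_has_integral\<close> yields only gauge integrability of f.
  Absolute integrability comes from bounded variation: absolute continuity with \<epsilon> = 1
  bounds the variation of F by 1 on intervals shorter than \<delta>, and finitely many of these
  cover [a,b].\<close>

lemma abs_continuous_imp_primitive:
  fixes F f :: "real \<Rightarrow> real"
  assumes "a \<le> b" and ac: "abs_continuous_on a b F"
    and "AE s in lebesgue_on {a..b}. (F has_real_derivative f s) (at s)"
  shows "primitive_on a b F f"
proof -
  define N where "N = {s \<in> {a..b}. \<not> (F has_real_derivative f s) (at s)}"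
  have N: "negligible N" using assms(3) unfolding AE_lebesgue_on_iff_negligible N_def .
  have int: "(f has_integral (F d - F c)) {c..d}" if "a \<le> c" "c \<le> d" "d \<le> b" for c d
    using abs_continuous_on_subinterval[OF ac] that
    by (intro abs_continuous_has_integral[OF _ _ N]) (auto simp: N_def)
  obtain \<delta> where "\<delta> > 0" and \<delta>:
      "\<And>D S. D division_of S \<Longrightarrow> S \<subseteq> {a..b} \<Longrightarrow> (\<Sum>I\<in>D. Sup I - Inf I) < \<delta>
        \<Longrightarrow> (\<Sum>I\<in>D. \<bar>F (Sup I) - F (Inf I)\<bar>) < 1"
    using ac unfolding abs_continuous_on_def by (metis zero_less_one)
  have small: "f absolutely_integrable_on {c..d}" if "a \<le> c" "c \<le> d" "d \<le> b" "d - c < \<delta>" for c d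
    unfolding cbox_interval[symmetric]
  proof (rule bounded_variation_absolutely_integrable_interval)
    show "f integrable_on cbox c d" using int[OF that(1-3)] by auto
    fix D assume D: "D division_of cbox c d"
    have "(\<Sum>K\<in>D. norm (integral K f)) = (\<Sum>K\<in>D. \<bar>F (Sup K) - F (Inf K)\<bar>)"
    proof (rule sum.cong[OF refl])
      fix K assume "K \<in> D"
      then obtain u v where "K = {u..v}" "K \<noteq> {}" "K \<subseteq> cbox c d"
        using division_ofD(2-4)[OF D] by (metis cbox_interval)
      then show "norm (integral K f) = \<bar>F (Sup K) - F (Inf K)\<bar>"
        using integral_unique[OF int[of u v]] that by auto
    qed
    also have "\<dots> < 1"
    proof (rule \<delta>[OF D])
      show "(\<Sum>I\<in>D. Sup I - Inf I) < \<delta>"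
        using sum_length_division(1)[OF D] that by simp
    qed (use that in auto)
    finally show "(\<Sum>K\<in>D. norm (integral K f)) \<le> 1" by simp
  qed
  \<comment> \<open>Induction over pieces of length at most \<delta>/2, half of the threshold, so
    that the strict bound required by \<open>small\<close> holds.\<close>
  have "f absolutely_integrable_on {a..d}" if "a \<le> d" "d \<le> b" "d - a < real n * \<delta> / 2" for n d
    using that
  proof (induction n arbitrary: d)
    case 0
    then show ?case by auto
  next
    case (Suc n)
    define c where "c = max a (d - \<delta>/2)"
    show ?case
    proof (cases "c = a")
      case True
      then show ?thesis using small[of a d] Suc.prems \<open>\<delta> > 0\<close> by (auto simp: c_def max_def split: if_splits)
    next
      case False
      then have c: "c = d - \<delta>/2" "a < c" by (auto simp: c_def max_def split: if_splits)
      have "f absolutely_integrable_on {a..c}"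
        by (rule Suc.IH) (use c Suc.prems \<open>\<delta> > 0\<close> in \<open>auto simp: field_simps\<close>)
      moreover have "f absolutely_integrable_on {c..d}"
        by (rule small) (use c Suc.prems \<open>\<delta> > 0\<close> in auto)
      ultimately show ?thesis
        by (rule absolutely_integrable_on_combine) (use c Suc.prems \<open>\<delta> > 0\<close> in auto)
    qed
  qed
  moreover obtain n where "b - a < real n * (\<delta> / 2)"
    using reals_Archimedean3[of "\<delta>/2"] \<open>\<delta> > 0\<close> by (meson half_gt_zero)
  ultimately have "f absolutely_integrable_on {a..b}" using \<open>a \<le> b\<close> by auto
  moreover have "F t = F a + integral {a..t} f" if "t \<in> {a..b}" for t
    using integral_unique[OF int[of a t]] that by auto
  ultimately show ?thesis unfolding primitive_on_def by blast
qed

lemma primitive_on_diff: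
  assumes "primitive_on a b F f" "a \<le> s" "s \<le> t" "t \<le> b"
  shows "F t - F s = integral {s..t} f"
proof -
  have "f integrable_on {a..t}"
    using assms by (meson absolutely_integrable_on_def atLeastatMost_subset_iff integrable_on_subinterval order_refl primitive_on_def)
  then have "integral {a..s} f + integral {s..t} f = integral {a..t} f"
    using assms by (intro Henstock_Kurzweil_Integration.integral_combine) auto
  moreover have "s \<in> {a..b}" "t \<in> {a..b}" using assms by auto
  then have "F s = F a + integral {a..s} f" "F t = F a + integral {a..t} f"
    using assms(1) unfolding primitive_on_def by blast+
  ultimately show ?thesis by (simp add: algebra_simps)
qed

lemma primitive_on_continuous:
  assumes "primitive_on a b F f"
  shows "continuous_on {a..b} F"
proof -
  have "continuous_on {a..b} (\<lambda>t. F a + integral {a..t} f)"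
    using assms unfolding primitive_on_def absolutely_integrable_on_def
    by (intro continuous_intros indefinite_integral_continuous_1) auto
  then show ?thesis
    using assms unfolding primitive_on_def by (metis (no_types, lifting) continuous_on_cong)
qed

lemma primitive_on_integral:
  assumes "f absolutely_integrable_on {a..b}"
  shows "primitive_on a b (\<lambda>t. c + integral {a..t} f) f"
  using assms unfolding primitive_on_def by auto

text \<open>Truncation at height n leaves a remainder that tends to 0 pointwise and is dominated by
  g. The bounded part can then be controlled by length alone.\<close>

lemma abs_integrable_small_tail:
  fixes g :: "real \<Rightarrow> real"
  assumes g: "g integrable_on {a..b}" and pos: "\<And>x. x \<in> {a..b} \<Longrightarrow> 0 \<le> g x" and "\<epsilon> > 0"
  shows "\<exists>n::nat. (\<lambda>x. min (g x) n) integrable_on {a..b} \<and> integral {a..b} (\<lambda>x. g x - min (g x) n) < \<epsilon>"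
proof -
  have min: "(\<lambda>x. min (g x) (real n)) integrable_on {a..b}" for n
  proof -
    have "g absolutely_integrable_on {a..b}" using g pos by (intro nonnegative_absolutely_integrable_1)
    then have "(\<lambda>x. min (g x) (real n)) absolutely_integrable_on {a..b}"
      by (intro absolutely_integrable_min_1) auto
    then show ?thesis by (simp add: absolutely_integrable_on_def)
  qed
  have "(\<lambda>n. integral {a..b} (\<lambda>x. g x - min (g x) (real n))) \<longlonglongrightarrow> integral {a..b} (\<lambda>x. 0)"
  proof (rule dominated_convergence[OF _ g])
    fix x assume "x \<in> {a..b}"
    obtain m :: nat where "g x \<le> m" using real_arch_simple by blast
    then have "eventually (\<lambda>n. g x - min (g x) (real n) = 0) sequentially"
      unfolding eventually_sequentially by (intro exI[of _ m]) auto
    then show "(\<lambda>n. g x - min (g x) (real n)) \<longlonglongrightarrow> 0" by (rule tendsto_eventually)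
  qed (use g min pos in \<open>auto intro!: integrable_diff\<close>)
  then have "eventually (\<lambda>n. integral {a..b} (\<lambda>x. g x - min (g x) (real n)) < \<epsilon>) sequentially"
    using \<open>\<epsilon> > 0\<close> by (intro order_tendstoD) auto
  then obtain n where "integral {a..b} (\<lambda>x. g x - min (g x) (real n)) < \<epsilon>"
    unfolding eventually_sequentially by blast
  then show ?thesis using min by blast
qed

text \<open>The function |f| splits into a part bounded by n and a part with integral below
  \<epsilon>/2. On total length below \<epsilon>/(2 (n + 1)) the bounded part contributes at most
  \<epsilon>/2.\<close>

lemma primitive_on_imp_abs_continuous:
  fixes F f :: "real \<Rightarrow> real"
  assumes "primitive_on a b F f"
  shows "abs_continuous_on a b F"
  unfolding abs_continuous_on_def
proof (intro allI impI)
  fix \<epsilon> :: real assume "\<epsilon> > 0"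
  have f: "f absolutely_integrable_on {a..b}" using assms by (simp add: primitive_on_def)
  define g where "g x = \<bar>f x\<bar>" for x
  have g: "g integrable_on {a..b}" using f by (auto simp: g_def[abs_def] absolutely_integrable_on_def)
  obtain n :: nat where n: "(\<lambda>x. min (g x) n) integrable_on {a..b}"
      "integral {a..b} (\<lambda>x. g x - min (g x) n) < \<epsilon>/2"
    using abs_integrable_small_tail[OF g, of "\<epsilon>/2"] \<open>\<epsilon> > 0\<close> by (auto simp: g_def)
  have "(\<Sum>I\<in>D. \<bar>F (Sup I) - F (Inf I)\<bar>) < \<epsilon>"
    if D: "D division_of S" "S \<subseteq> {a..b}" "(\<Sum>I\<in>D. Sup I - Inf I) < \<epsilon> / (2 * (real n + 1))" for D S
  proof -
    define h where "h x = g x - min (g x) n" for x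
    have h: "h integrable_on {a..b}" unfolding h_def using g n by (intro integrable_diff)
    have le: "\<bar>F (Sup I) - F (Inf I)\<bar> \<le> real n * (Sup I - Inf I) + integral I h" if ID: "I \<in> D" for I
    proof -
      obtain u v where I: "I = {u..v}" "u \<le> v" "{u..v} \<subseteq> {a..b}"
        using division_of_intervals[OF D(1,2) ID] .
      have f': "f integrable_on {u..v}" and g': "g integrable_on {u..v}" and h': "h integrable_on {u..v}"
        using f g h I(3) by (auto simp: absolutely_integrable_on_def intro: integrable_on_subinterval)
      have "\<bar>F (Sup I) - F (Inf I)\<bar> = \<bar>integral {u..v} f\<bar>"
        using primitive_on_diff[OF assms, of u v] I by auto
      also have "\<dots> \<le> integral {u..v} (\<lambda>x. real n + h x)"
        unfolding real_norm_def[symmetric]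
      proof (rule Henstock_Kurzweil_Integration.integral_norm_bound_integral)
        show "(\<lambda>x. real n + h x) integrable_on {u..v}" using h' by (intro integrable_add) auto
      qed (use f' in \<open>auto simp: h_def g_def\<close>)
      also have "\<dots> = real n * (Sup I - Inf I) + integral I h"
        using h' I(1,2) Henstock_Kurzweil_Integration.integral_add[OF integrable_const_ivl[of "real n" u v] h'] by simp
      finally show ?thesis .
    qed
    have hS: "h integrable_on S" using D h by (meson integrable_on_subdivision)
    have "(\<Sum>I\<in>D. \<bar>F (Sup I) - F (Inf I)\<bar>) \<le> (\<Sum>I\<in>D. real n * (Sup I - Inf I) + integral I h)"
      by (rule sum_mono) (rule le)
    also have "\<dots> = real n * (\<Sum>I\<in>D. Sup I - Inf I) + integral S h"
      using integral_combine_division_topdown[OF hS D(1)] by (simp add: sum.distrib sum_distrib_left)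
    also have "integral S h \<le> integral {a..b} h"
      using hS h D(2) by (intro integral_subset_le) (auto simp: h_def)
    also have "integral {a..b} h < \<epsilon>/2" using n(2) by (simp add: h_def[abs_def])
    also have "real n * (\<Sum>I\<in>D. Sup I - Inf I) \<le> real n * (\<epsilon> / (2 * (real n + 1)))"
      using D(3) by (intro mult_left_mono) auto
    also have "\<dots> \<le> \<epsilon> / 2" using \<open>\<epsilon> > 0\<close> by (simp add: field_simps)
    finally show ?thesis by simp
  qed
  then show "\<exists>\<delta>>0. \<forall>D S. D division_of S \<and> S \<subseteq> {a..b} \<and> (\<Sum>I\<in>D. Sup I - Inf I) < \<delta>
        \<longrightarrow> (\<Sum>I\<in>D. \<bar>F (Sup I) - F (Inf I)\<bar>) < \<epsilon>"
    using \<open>\<epsilon> > 0\<close> by (intro exI[of _ "\<epsilon> / (2 * (real n + 1))"]) auto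
qed

text \<open>The library's differentiation theorem is one-sided; reflection supplies the left derivative.\<close>

lemma primitive_on_AE_vector_derivative:
  fixes F f :: "real \<Rightarrow> 'a::euclidean_space"
  assumes "primitive_on a b F f"
  shows "AE s in lebesgue_on {a..b}. (F has_vector_derivative f s) (at s)"
proof -
  \<comment> \<open>Extension by zero gives integrability on every interval, as needed to
    differentiate both g and its reflection.\<close>
  define g where "g s = (if s \<in> {a..b} then f s else 0)" for s
  have "f integrable_on {a..b}" using assms by (auto simp: primitive_on_def absolutely_integrable_on_def)
  then have g: "g integrable_on UNIV" unfolding g_def integrable_restrict_UNIV .
  then have g1: "g integrable_on cbox c d" for c d by (rule integrable_on_subcbox) auto
  have g2: "(\<lambda>x. g (- x)) integrable_on cbox c d" for c d
    using g1[of "-d" "-c"] Henstock_Kurzweil_Integration.integrable_reflect_real[of g "-c" "-d"] by simp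
  obtain N1 where N1: "negligible N1" "\<And>x e. \<lbrakk>x \<notin> N1; 0 < e\<rbrakk> \<Longrightarrow>
      \<exists>d>0. \<forall>h. 0 < h \<and> h < d \<longrightarrow> norm (integral (cbox x (x + h *\<^sub>R One)) g /\<^sub>R h ^ DIM(real) - g x) < e"
    using integrable_ccontinuous_explicit[OF g1] by blast
  obtain N2 where N2: "negligible N2" "\<And>x e. \<lbrakk>x \<notin> N2; 0 < e\<rbrakk> \<Longrightarrow>
      \<exists>d>0. \<forall>h. 0 < h \<and> h < d \<longrightarrow> norm (integral (cbox x (x + h *\<^sub>R One)) (\<lambda>x. g (-x)) /\<^sub>R h ^ DIM(real) - g (-x)) < e"
    using integrable_ccontinuous_explicit[OF g2] by blast
  have "negligible (uminus ` N2)"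
    using N2(1) by (intro negligible_differentiable_image_negligible) (auto intro!: derivative_intros)
  \<comment> \<open>The endpoints join the null set because the derivative in the conclusion is
    two-sided.\<close>
  then have N: "negligible (N1 \<union> uminus ` N2 \<union> {a, b})" (is "negligible ?N") using N1(1) by auto
  have "(F has_vector_derivative f x) (at x)" if "x \<in> {a..b} - ?N" for x
  proof -
    have x: "a < x" "x < b" using that by auto
    have gx: "g x = f x" using that by (simp add: g_def)
    have gint: "integral {c..d} g = integral {c..d} f" if "a \<le> c" "d \<le> b" for c d
      using that by (intro Henstock_Kurzweil_Integration.integral_cong) (auto simp: g_def)
    show ?thesis
      unfolding has_vector_derivative_def has_derivative_at_alt
    proof (intro conjI allI impI)
      show "bounded_linear (\<lambda>h. h *\<^sub>R f x)" by (rule bounded_linear_scaleR_left)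
      fix e :: real assume "e > 0"
      have "x \<notin> N1" using that by blast
      then obtain d1 where d1: "d1 > 0" "\<And>h. 0 < h \<Longrightarrow> h < d1 \<Longrightarrow> norm (integral {x..x+h} g /\<^sub>R h - f x) < e"
        using N1(2)[of x e] \<open>e > 0\<close> gx by auto
      have "- x \<notin> N2" using that by (metis DiffD2 UnCI imageI minus_minus)
      then obtain d2 where d2: "d2 > 0" "\<And>h. 0 < h \<Longrightarrow> h < d2 \<Longrightarrow> norm (integral {-x..-x+h} (\<lambda>x. g (-x)) /\<^sub>R h - f x) < e"
        using N2(2)[of "-x" e] \<open>e > 0\<close> gx by auto
      have "norm (F y - F x - (y - x) *\<^sub>R f x) \<le> e * norm (y - x)"
        if y: "norm (y - x) < min (min d1 d2) (min (x - a) (b - x))" for y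
      proof -
        consider "y = x" | "y > x" | "y < x" by linarith
        then show ?thesis
        proof cases
          case 2
          define h where "h = y - x"
          have h: "0 < h" "h < d1" "y = x + h" "x + h \<le> b" using 2 y by (auto simp: h_def)
          have "F y - F x = integral {x..x+h} g"
            using primitive_on_diff[OF assms, of x y] h x gint[of x "x+h"] by auto
          then have "F y - F x - (y - x) *\<^sub>R f x = h *\<^sub>R (integral {x..x+h} g /\<^sub>R h - f x)"
            using h by (simp add: scaleR_diff_right)
          then have "norm (F y - F x - (y - x) *\<^sub>R f x) = h * norm (integral {x..x+h} g /\<^sub>R h - f x)"
            using h by simp
          also have "\<dots> \<le> h * e" using d1(2)[of h] h by (intro mult_left_mono) auto
          finally show ?thesis using h by (simp add: mult.commute)
        next
          case 3
          define h where "h = x - y"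
          have h: "0 < h" "h < d2" "y = x - h" "a \<le> x - h" using 3 y by (auto simp: h_def)
          have "integral {-x..-x+h} (\<lambda>x. g (-x)) = integral {x-h..x} g"
            using Henstock_Kurzweil_Integration.integral_reflect_real[of x "x - h" g] by simp
          then have "F x - F y = integral {-x..-x+h} (\<lambda>x. g (-x))"
            using primitive_on_diff[OF assms, of y x] h x gint[of "x-h" x] by auto
          moreover have "F y - F x - (y - x) *\<^sub>R f x = - (F x - F y) + h *\<^sub>R f x"
            by (simp add: h_def algebra_simps)
          ultimately have "F y - F x - (y - x) *\<^sub>R f x = - h *\<^sub>R (integral {-x..-x+h} (\<lambda>x. g (-x)) /\<^sub>R h - f x)"
            using h(1) by (simp add: scaleR_diff_right)
          then have "norm (F y - F x - (y - x) *\<^sub>R f x) = h * norm (integral {-x..-x+h} (\<lambda>x. g (-x)) /\<^sub>R h - f x)"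
            using h by simp
          also have "\<dots> \<le> h * e" using d2(2)[of h] h by (intro mult_left_mono) auto
          finally show ?thesis using h by (simp add: mult.commute)
        qed auto
      qed
      then show "\<exists>d>0. \<forall>y. norm (y - x) < d \<longrightarrow> norm (F y - F x - (y - x) *\<^sub>R f x) \<le> e * norm (y - x)"
        using d1(1) d2(1) x by (intro exI[of _ "min (min d1 d2) (min (x - a) (b - x))"]) auto
    qed
  qed
  then have "{s \<in> {a..b}. \<not> (F has_vector_derivative f s) (at s)} \<subseteq> ?N" by blast
  then show ?thesis unfolding AE_lebesgue_on_iff_negligible using N by (rule negligible_subset[rotated])
qed

lemma primitive_on_iff_abs_continuous:
  fixes F f :: "real \<Rightarrow> real"
  assumes "a \<le> b"
  shows "primitive_on a b F f \<longleftrightarrow>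
    abs_continuous_on a b F \<and> (AE s in lebesgue_on {a..b}. (F has_real_derivative f s) (at s))"
  using abs_continuous_imp_primitive[OF assms] primitive_on_imp_abs_continuous
    primitive_on_AE_vector_derivative[of a b F f]
  by (auto simp: has_real_derivative_iff_has_vector_derivative)

lemma primitive_on_cong:
  assumes "primitive_on a b F f" "\<And>s. s \<in> {a..b} \<Longrightarrow> f s = g s"
  shows "primitive_on a b F g"
proof -
  have "g absolutely_integrable_on {a..b}"
    by (rule absolutely_integrable_spike[where f=f and S="{}"]) (use assms in \<open>auto simp: primitive_on_def\<close>)
  moreover have "F t = F a + integral {a..t} g" if "t \<in> {a..b}" for t
  proof -
    have "integral {a..t} f = integral {a..t} g"
      using assms(2) that by (intro Henstock_Kurzweil_Integration.integral_cong) auto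
    moreover have "F t = F a + integral {a..t} f" using assms(1) that unfolding primitive_on_def by blast
    ultimately show ?thesis by simp
  qed
  ultimately show ?thesis unfolding primitive_on_def by blast
qed

lemma primitive_on_AE_cong:
  assumes F: "primitive_on a b F f" and ae: "AE s in lebesgue_on {a..b}. g s = f s"
  shows "primitive_on a b F g"
proof -
  define N where "N = {s \<in> {a..b}. \<not> g s = f s}"
  have N: "negligible N" using ae unfolding AE_lebesgue_on_iff_negligible N_def .
  have "g absolutely_integrable_on {a..b}"
    by (rule absolutely_integrable_spike[OF _ N]) (use F in \<open>auto simp: primitive_on_def N_def\<close>)
  moreover have "F t = F a + integral {a..t} g" if t: "t \<in> {a..b}" for t
  proof -
    have "integral {a..t} g = integral {a..t} f"
      by (rule integral_spike[OF N]) (use t in \<open>auto simp: N_def\<close>)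
    moreover have "F t = F a + integral {a..t} f" using F t unfolding primitive_on_def by blast
    ultimately show ?thesis by simp
  qed
  ultimately show ?thesis unfolding primitive_on_def by blast
qed

text \<open>Serves products and exponentials, whose increments are controlled by those of functions
  already known to be absolutely continuous.\<close>

lemma abs_continuous_on_dominated:
  assumes G: "abs_continuous_on a b G" and H: "abs_continuous_on a b H" and "C \<ge> 0"
    and le: "\<And>s t. a \<le> s \<Longrightarrow> s \<le> t \<Longrightarrow> t \<le> b \<Longrightarrow> \<bar>F t - F s\<bar> \<le> C * (\<bar>G t - G s\<bar> + \<bar>H t - H s\<bar>)"
  shows "abs_continuous_on a b F"
  unfolding abs_continuous_on_def
proof (intro allI impI)
  fix \<epsilon> :: real assume "\<epsilon> > 0"
  \<comment> \<open>With this e the final bound is C \<epsilon> / (C + 1), which is below \<epsilon>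
    also for C = 0.\<close>
  define e where "e = \<epsilon> / (C + 1) / 2"
  have "e + e = \<epsilon> / (C + 1)" unfolding e_def by (rule field_sum_of_halves)
  moreover have "C * (\<epsilon> / (C + 1)) < \<epsilon>" using \<open>\<epsilon> > 0\<close> \<open>C \<ge> 0\<close> by (simp add: pos_divide_less_eq algebra_simps)
  ultimately have e: "e > 0" "C * (e + e) < \<epsilon>" using \<open>\<epsilon> > 0\<close> \<open>C \<ge> 0\<close> by (auto simp: e_def)
  obtain d1 where d1: "d1 > 0" "\<And>D S. D division_of S \<Longrightarrow> S \<subseteq> {a..b} \<Longrightarrow> (\<Sum>I\<in>D. Sup I - Inf I) < d1
        \<Longrightarrow> (\<Sum>I\<in>D. \<bar>G (Sup I) - G (Inf I)\<bar>) < e"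
    using G[unfolded abs_continuous_on_def, rule_format, OF e(1)] by blast
  obtain d2 where d2: "d2 > 0" "\<And>D S. D division_of S \<Longrightarrow> S \<subseteq> {a..b} \<Longrightarrow> (\<Sum>I\<in>D. Sup I - Inf I) < d2
        \<Longrightarrow> (\<Sum>I\<in>D. \<bar>H (Sup I) - H (Inf I)\<bar>) < e"
    using H[unfolded abs_continuous_on_def, rule_format, OF e(1)] by blast
  have "(\<Sum>I\<in>D. \<bar>F (Sup I) - F (Inf I)\<bar>) < \<epsilon>"
    if D: "D division_of S" "S \<subseteq> {a..b}" "(\<Sum>I\<in>D. Sup I - Inf I) < min d1 d2" for D S
  proof -
    have "(\<Sum>I\<in>D. \<bar>F (Sup I) - F (Inf I)\<bar>) \<le>
        (\<Sum>I\<in>D. C * (\<bar>G (Sup I) - G (Inf I)\<bar> + \<bar>H (Sup I) - H (Inf I)\<bar>))"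
    proof (rule sum_mono)
      fix I assume I: "I \<in> D"
      obtain u v where uv: "I = {u..v}" "u \<le> v" "{u..v} \<subseteq> {a..b}"
        using division_of_intervals[OF D(1,2) I] .
      then show "\<bar>F (Sup I) - F (Inf I)\<bar> \<le> C * (\<bar>G (Sup I) - G (Inf I)\<bar> + \<bar>H (Sup I) - H (Inf I)\<bar>)"
        using le[of u v] by auto
    qed
    also have "\<dots> = C * ((\<Sum>I\<in>D. \<bar>G (Sup I) - G (Inf I)\<bar>) + (\<Sum>I\<in>D. \<bar>H (Sup I) - H (Inf I)\<bar>))"
      by (simp only: sum.distrib[symmetric] sum_distrib_left)
    also have "\<dots> \<le> C * (e + e)"
      using d1(2)[OF D(1,2)] d2(2)[OF D(1,2)] D(3) \<open>C \<ge> 0\<close> by (intro mult_left_mono add_mono) auto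
    finally show ?thesis using e(2) by simp
  qed
  then show "\<exists>\<delta>>0. \<forall>D S. D division_of S \<and> S \<subseteq> {a..b} \<and> (\<Sum>I\<in>D. Sup I - Inf I) < \<delta>
        \<longrightarrow> (\<Sum>I\<in>D. \<bar>F (Sup I) - F (Inf I)\<bar>) < \<epsilon>"
    using d1(1) d2(1) by (intro exI[of _ "min d1 d2"]) auto
qed

lemma primitive_on_bounded:
  fixes F :: "real \<Rightarrow> real"
  assumes "primitive_on a b F f"
  obtains B where "B \<ge> 0" "\<And>t. t \<in> {a..b} \<Longrightarrow> \<bar>F t\<bar> \<le> B"
proof -
  have "bounded (F ` {a..b})"
    using primitive_on_continuous[OF assms] by (intro compact_imp_bounded compact_continuous_image) auto
  then obtain B where "\<forall>t\<in>{a..b}. \<bar>F t\<bar> \<le> B" unfolding bounded_iff by auto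
  then show ?thesis using that[of "max B 0"] by fastforce
qed

text \<open>Proved through the epsilon-delta form: an increment bound gives absolute continuity, and
  the pointwise product rule identifies the density almost everywhere. Evaluated at endpoints it is
  integration by parts.\<close>

lemma primitive_on_mult:
  fixes F G :: "real \<Rightarrow> real"
  assumes "a \<le> b" and F: "primitive_on a b F f" and G: "primitive_on a b G g"
  shows "primitive_on a b (\<lambda>t. F t * G t) (\<lambda>t. f t * G t + F t * g t)"
  unfolding primitive_on_iff_abs_continuous[OF \<open>a \<le> b\<close>]
proof
  obtain B where B: "B \<ge> 0" "\<And>t. t \<in> {a..b} \<Longrightarrow> \<bar>F t\<bar> \<le> B" using primitive_on_bounded[OF F] by metis
  obtain C where C: "C \<ge> 0" "\<And>t. t \<in> {a..b} \<Longrightarrow> \<bar>G t\<bar> \<le> C" using primitive_on_bounded[OF G] by metis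
  show "abs_continuous_on a b (\<lambda>t. F t * G t)"
  proof (rule abs_continuous_on_dominated[where C="B + C"])
    fix s t assume st: "a \<le> s" "s \<le> t" "t \<le> b"
    have "F t * G t - F s * G s = (F t - F s) * G t + F s * (G t - G s)" by (simp add: algebra_simps)
    then have "\<bar>F t * G t - F s * G s\<bar> \<le> \<bar>F t - F s\<bar> * \<bar>G t\<bar> + \<bar>F s\<bar> * \<bar>G t - G s\<bar>"
      using abs_triangle_ineq[of "(F t - F s) * G t" "F s * (G t - G s)"] by (simp add: abs_mult)
    also have "\<dots> \<le> \<bar>F t - F s\<bar> * (B + C) + (B + C) * \<bar>G t - G s\<bar>"
      using B(2)[of s] C(2)[of t] B(1) C(1) st by (intro add_mono mult_mono) auto
    finally show "\<bar>F t * G t - F s * G s\<bar> \<le> (B + C) * (\<bar>F t - F s\<bar> + \<bar>G t - G s\<bar>)"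
      by (simp add: algebra_simps)
  qed (use B(1) C(1) F G in \<open>auto intro: primitive_on_imp_abs_continuous\<close>)
  have "AE s in lebesgue_on {a..b}. (F has_real_derivative f s) (at s)"
    "AE s in lebesgue_on {a..b}. (G has_real_derivative g s) (at s)"
    using F G unfolding primitive_on_iff_abs_continuous[OF \<open>a \<le> b\<close>] by auto
  then show "AE s in lebesgue_on {a..b}. ((\<lambda>t. F t * G t) has_real_derivative f s * G s + F s * g s) (at s)"
    by eventually_elim (auto intro!: derivative_eq_intros)
qed

lemma primitive_on_exp:
  fixes F :: "real \<Rightarrow> real"
  assumes "a \<le> b" and F: "primitive_on a b F f"
  shows "primitive_on a b (\<lambda>t. exp (F t)) (\<lambda>t. f t * exp (F t))"
  unfolding primitive_on_iff_abs_continuous[OF \<open>a \<le> b\<close>]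
proof
  obtain B where B: "B \<ge> 0" "\<And>t. t \<in> {a..b} \<Longrightarrow> \<bar>F t\<bar> \<le> B" using primitive_on_bounded[OF F] by metis
  show "abs_continuous_on a b (\<lambda>t. exp (F t))"
  proof (rule abs_continuous_on_dominated[where C="exp B" and G=F and H=F])
    fix s t assume st: "a \<le> s" "s \<le> t" "t \<le> b"
    \<comment> \<open>On [-B,B], which contains the range of F, the derivative of exp is at most exp
      B.\<close>
    have "norm (exp (F t) - exp (F s)) \<le> exp B * norm (F t - F s)"
    proof (rule field_differentiable_bound[of "{-B..B}"])
      show "(exp has_field_derivative exp z) (at z within {-B..B})" for z :: real
        by (rule DERIV_subset[OF DERIV_exp]) auto
    qed (use B(2)[of s] B(2)[of t] st in auto)
    also have "\<dots> \<le> exp B * (\<bar>F t - F s\<bar> + \<bar>F t - F s\<bar>)" by (intro mult_left_mono) auto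
    finally show "\<bar>exp (F t) - exp (F s)\<bar> \<le> exp B * (\<bar>F t - F s\<bar> + \<bar>F t - F s\<bar>)" by simp
  qed (use F in \<open>auto intro: primitive_on_imp_abs_continuous\<close>)
  have "AE s in lebesgue_on {a..b}. (F has_real_derivative f s) (at s)"
    using F unfolding primitive_on_iff_abs_continuous[OF \<open>a \<le> b\<close>] by auto
  then show "AE s in lebesgue_on {a..b}. ((\<lambda>t. exp (F t)) has_real_derivative f s * exp (F s)) (at s)"
    by eventually_elim (auto intro!: derivative_eq_intros)
qed

lemma primitive_on_linear:
  fixes h :: "'a::euclidean_space \<Rightarrow> 'b::euclidean_space"
  assumes "primitive_on a b F f" and h: "bounded_linear h"
  shows "primitive_on a b (\<lambda>t. h (F t)) (\<lambda>t. h (f t))"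
  unfolding primitive_on_def
proof (intro conjI ballI)
  have f: "f absolutely_integrable_on {a..b}" using assms by (simp add: primitive_on_def)
  show "(\<lambda>t. h (f t)) absolutely_integrable_on {a..b}"
    using absolutely_integrable_linear[OF f h] by (simp add: o_def)
  fix t assume t: "t \<in> {a..b}"
  have "f integrable_on {a..t}"
    using f t unfolding absolutely_integrable_on_def by (auto intro: integrable_on_subinterval)
  then have "integral {a..t} (\<lambda>t. h (f t)) = h (integral {a..t} f)"
    using integral_linear[OF _ h, of f "{a..t}"] by (simp add: o_def)
  moreover have "F t = F a + integral {a..t} f" using assms(1) t unfolding primitive_on_def by blast
  ultimately show "h (F t) = h (F a) + integral {a..t} (\<lambda>t. h (f t))"
    using h by (simp add: linear_simps)
qed

lemma primitive_on_diff_fun: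
  assumes "primitive_on a b F f" "primitive_on a b G g"
  shows "primitive_on a b (\<lambda>t. F t - G t) (\<lambda>t. f t - g t)"
  unfolding primitive_on_def
proof (intro conjI ballI)
  show "(\<lambda>t. f t - g t) absolutely_integrable_on {a..b}"
    using assms unfolding primitive_on_def by (intro set_integral_diff) auto
  fix t assume t: "t \<in> {a..b}"
  have "f integrable_on {a..t}" "g integrable_on {a..t}"
    using assms t unfolding primitive_on_def absolutely_integrable_on_def
    by (auto intro: integrable_on_subinterval)
  moreover have "F t = F a + integral {a..t} f" "G t = G a + integral {a..t} g"
    using assms t unfolding primitive_on_def by blast+
  ultimately show "F t - G t = F a - G a + integral {a..t} (\<lambda>t. f t - g t)"
    by (simp add: Henstock_Kurzweil_Integration.integral_diff)
qed

lemma primitive_on_componentwise: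
  fixes F f :: "real \<Rightarrow> 'a::euclidean_space"
  assumes "\<And>k. k \<in> Basis \<Longrightarrow> primitive_on a b (\<lambda>t. F t \<bullet> k) (\<lambda>t. f t \<bullet> k)"
  shows "primitive_on a b F f"
  unfolding primitive_on_def
proof (intro conjI ballI)
  show f: "f absolutely_integrable_on {a..b}"
    by (rule absolutely_integrable_componentwise) (use assms in \<open>simp only: primitive_on_def\<close>)
  fix t assume t: "t \<in> {a..b}"
  have "f integrable_on {a..t}"
    using f t unfolding absolutely_integrable_on_def by (auto intro: integrable_on_subinterval)
  show "F t = F a + integral {a..t} f"
  proof (rule euclidean_eqI)
    fix k :: 'a assume "k \<in> Basis"
    then have "F t \<bullet> k = F a \<bullet> k + integral {a..t} (\<lambda>t. f t \<bullet> k)"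
      using assms t unfolding primitive_on_def by blast
    then show "F t \<bullet> k = (F a + integral {a..t} f) \<bullet> k"
      using \<open>f integrable_on {a..t}\<close> integral_component_eq[of f "{a..t}" k] by (simp add: inner_add_left)
  qed
qed

text \<open>Integrating factor: the derivative of exp(- \<integral> q) cancels the term q d and
  leaves only the forcing r.\<close>

lemma primitive_on_linear_ode:
  fixes d q r :: "real \<Rightarrow> real"
  assumes "a \<le> b" and d: "primitive_on a b d (\<lambda>s. q s * d s + r s)"
    and q: "q absolutely_integrable_on {a..b}"
  shows "primitive_on a b (\<lambda>t. d t * exp (- integral {a..t} q)) (\<lambda>s. exp (- integral {a..s} q) * r s)"
proof -
  have "primitive_on a b (\<lambda>t. 0 + integral {a..t} q) q" by (rule primitive_on_integral[OF q])
  from primitive_on_linear[OF this bounded_linear_minus[OF bounded_linear_ident]]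
  have "primitive_on a b (\<lambda>t. - integral {a..t} q) (\<lambda>t. - q t)" by simp
  from primitive_on_mult[OF \<open>a \<le> b\<close> d primitive_on_exp[OF \<open>a \<le> b\<close> this]]
  show ?thesis by (simp add: algebra_simps)
qed

section \<open>Sobolev curves\<close>

lemma absolutely_integrable_scaleR_bounded:
  fixes g :: "real \<Rightarrow> 'a::euclidean_space" and f :: "real \<Rightarrow> real"
  assumes "f \<in> borel_measurable (lebesgue_on {a..b})" "\<And>s. s \<in> {a..b} \<Longrightarrow> \<bar>f s\<bar> \<le> B"
    and "g absolutely_integrable_on {a..b}"
  shows "(\<lambda>s. f s *\<^sub>R g s) absolutely_integrable_on {a..b}"
proof (rule absolutely_integrable_bounded_measurable_product[where h="(*\<^sub>R)"])
  show "bilinear ((*\<^sub>R) :: real \<Rightarrow> 'a \<Rightarrow> 'a)"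
    by (simp add: bilinear_conv_bounded_bilinear bounded_bilinear_scaleR)
  show "bounded (f ` {a..b})" using assms(2) unfolding bounded_iff by (auto intro!: exI[of _ B])
qed (use assms in auto)

section \<open>C1 test functions built from hat functions\<close>

lemma DERIV_half_square_pos_part:
  "((\<lambda>x::real. (max 0 x)\<^sup>2 / 2) has_real_derivative max 0 x) (at x)"
proof -
  consider "x > 0" | "x < 0" | "x = 0" by linarith
  then show ?thesis
  proof cases
    case 1
    have "((\<lambda>x::real. x\<^sup>2 / 2) has_real_derivative x) (at x)" by (auto intro!: derivative_eq_intros)
    then have "((\<lambda>x::real. (max 0 x)\<^sup>2 / 2) has_real_derivative x) (at x)"
      by (rule has_field_derivative_transform_within_open[of _ _ _ "{0<..}"]) (use 1 in auto)
    then show ?thesis using 1 by simp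
  next
    case 2
    have "((\<lambda>x::real. 0) has_real_derivative 0) (at x)" by simp
    then have "((\<lambda>x::real. (max 0 x)\<^sup>2 / 2) has_real_derivative 0) (at x)"
      by (rule has_field_derivative_transform_within_open[of _ _ _ "{..<0}"]) (use 2 in auto)
    then show ?thesis using 2 by simp
  next
    case 3
    have "((\<lambda>h::real. ((max 0 (0 + h))\<^sup>2 / 2 - (max 0 0)\<^sup>2 / 2) / h) \<longlongrightarrow> 0) (at 0)"
    proof (rule Lim_null_comparison)
      show "((\<lambda>h::real. \<bar>h\<bar>) \<longlongrightarrow> 0) (at 0)" by (rule tendsto_eq_intros | simp)+
      show "\<forall>\<^sub>F h::real in at 0. norm (((max 0 (0 + h))\<^sup>2 / 2 - (max 0 0)\<^sup>2 / 2) / h) \<le> \<bar>h\<bar>"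
        by (rule always_eventually) (auto simp: max_def power2_eq_square)
    qed
    then show ?thesis using 3 unfolding DERIV_def by simp
  qed
qed

text \<open>The hat function of height \<delta> supported in [-\<delta>, \<delta>], written as a
  second difference of the positive part; its integral is \<delta>^2.\<close>

definition bump :: "real \<Rightarrow> real \<Rightarrow> real" where
  "bump \<delta> x = max 0 (x + \<delta>) - 2 * max 0 x + max 0 (x - \<delta>)"

text \<open>The same second difference applied to the primitive of the positive part: a C1
  transition from 0 to \<delta>^2 with derivative \<open>bump\<close>.\<close>

definition ramp :: "real \<Rightarrow> real \<Rightarrow> real" where
  "ramp \<delta> x = (max 0 (x + \<delta>))\<^sup>2 / 2 - 2 * ((max 0 x)\<^sup>2 / 2) + (max 0 (x - \<delta>))\<^sup>2 / 2"

lemma DERIV_ramp: "((\<lambda>s. ramp \<delta> (s - p)) has_real_derivative bump \<delta> (s - p)) (at s)"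
proof -
  have "((\<lambda>x. ramp \<delta> x) has_real_derivative bump \<delta> y) (at y)" for y
  proof -
    have "((\<lambda>x. (max 0 (x + c))\<^sup>2 / 2) has_real_derivative max 0 (y + c)) (at y)" for c
      using DERIV_shift[of "\<lambda>x. (max 0 x)\<^sup>2 / 2" "max 0 (y + c)" y c] DERIV_half_square_pos_part[of "y + c"] by simp
    from DERIV_add[OF DERIV_diff[OF this[of \<delta>] DERIV_cmult[OF this[of 0], of 2]] this[of "-\<delta>"]]
    show ?thesis unfolding ramp_def bump_def by simp
  qed
  from this[of "s - p"] show ?thesis
    using DERIV_shift[of "ramp \<delta>" "bump \<delta> (s - p)" s "- p"] by simp
qed

lemma continuous_on_bump: "continuous_on S (\<lambda>s. bump \<delta> (s - p))"
  unfolding bump_def by (intro continuous_intros)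

lemma bump_nonneg: "\<delta> > 0 \<Longrightarrow> bump \<delta> x \<ge> 0"
  by (auto simp: bump_def max_def)

lemma bump_eq_0: "\<delta> > 0 \<Longrightarrow> \<delta> \<le> \<bar>x\<bar> \<Longrightarrow> bump \<delta> x = 0"
  by (auto simp: bump_def max_def abs_if split: if_splits)

lemma ramp_eq_0: "\<delta> > 0 \<Longrightarrow> x \<le> -\<delta> \<Longrightarrow> ramp \<delta> x = 0"
  by (auto simp: ramp_def max_def)

lemma ramp_eq: "\<delta> > 0 \<Longrightarrow> \<delta> \<le> x \<Longrightarrow> ramp \<delta> x = \<delta>\<^sup>2"
  by (auto simp: ramp_def max_def power2_eq_square field_simps)

lemma ramp_at_0: "\<delta> > 0 \<Longrightarrow> ramp \<delta> 0 = \<delta>\<^sup>2 / 2"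
  by (auto simp: ramp_def max_def power2_eq_square field_simps)

lemma ramp_bounds:
  assumes "\<delta> > 0"
  shows "0 \<le> ramp \<delta> x" "ramp \<delta> x \<le> \<delta>\<^sup>2"
proof -
  consider "x \<le> -\<delta>" | "-\<delta> \<le> x" "x \<le> 0" | "0 \<le> x" "x \<le> \<delta>" | "\<delta> \<le> x" by linarith
  then have "0 \<le> ramp \<delta> x \<and> ramp \<delta> x \<le> \<delta>\<^sup>2"
  proof cases
    case 2
    have "ramp \<delta> x = (x + \<delta>)\<^sup>2 / 2" using 2 assms by (auto simp: ramp_def max_def)
    moreover have "(x + \<delta>)\<^sup>2 \<le> \<delta>\<^sup>2" using 2 assms by (intro power_mono) auto
    ultimately show ?thesis using zero_le_power2[of "x + \<delta>"] by linarith
  next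
    case 3
    have "ramp \<delta> x = \<delta>\<^sup>2 - (\<delta> - x)\<^sup>2 / 2"
      using 3 assms by (auto simp: ramp_def max_def power2_eq_square field_simps)
    moreover have "(\<delta> - x)\<^sup>2 \<le> \<delta>\<^sup>2" using 3 assms by (intro power_mono) auto
    ultimately show ?thesis using zero_le_power2[of "\<delta> - x"] by linarith
  qed (use assms ramp_eq_0 ramp_eq in auto)
  then show "0 \<le> ramp \<delta> x" "ramp \<delta> x \<le> \<delta>\<^sup>2" by auto
qed

text \<open>The normalized hats form an approximate identity: nonnegative, of unit mass, with
  support shrinking to p, so continuity of \<xi> at p suffices.\<close>

lemma bump_average_tendsto:
  fixes \<xi> :: "real \<Rightarrow> 'a::euclidean_space"
  assumes cont: "continuous_on {a..b} \<xi>" and p: "a < p" "p < b"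
    and \<delta>: "\<And>n::nat. \<delta> n > 0" "\<delta> \<longlonglongrightarrow> 0"
  shows "(\<lambda>n. integral {a..b} (\<lambda>s. (bump (\<delta> n) (s - p) / (\<delta> n)\<^sup>2) *\<^sub>R \<xi> s)) \<longlonglongrightarrow> \<xi> p"
proof (rule LIMSEQ_I)
  fix e :: real assume "e > 0"
  obtain r where r: "r > 0" "\<And>s. s \<in> {a..b} \<Longrightarrow> \<bar>s - p\<bar> < r \<Longrightarrow> norm (\<xi> s - \<xi> p) < e/2"
    using cont[unfolded continuous_on_iff, rule_format, of p "e/2"] p \<open>e > 0\<close>
    by (auto simp: dist_norm)
  have "eventually (\<lambda>n. \<delta> n < min r (min (p - a) (b - p))) sequentially"
    using \<delta>(2) r(1) p by (intro order_tendstoD) auto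
  then obtain N where N: "\<And>n. n \<ge> N \<Longrightarrow> \<delta> n < min r (min (p - a) (b - p))"
    unfolding eventually_sequentially by blast
  have "norm (integral {a..b} (\<lambda>s. (bump (\<delta> n) (s - p) / (\<delta> n)\<^sup>2) *\<^sub>R \<xi> s) - \<xi> p) < e" if "n \<ge> N" for n
  proof -
    define d where "d = \<delta> n"
    define B where "B s = bump d (s - p) / d\<^sup>2" for s
    have d: "d > 0" "d < r" "d < p - a" "d < b - p" using N[OF that] \<delta>(1)[of n] by (auto simp: d_def)
    have Bc: "continuous_on {a..b} B"
      using d unfolding B_def by (intro continuous_intros continuous_on_bump) auto
    have "((\<lambda>s. ramp d (s - p) / d\<^sup>2) has_real_derivative B s) (at s)" for s
      unfolding B_def using DERIV_ramp DERIV_cdivide by blast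
    then have "(B has_integral (ramp d (b - p) / d\<^sup>2 - ramp d (a - p) / d\<^sup>2)) {a..b}"
      using p by (intro fundamental_theorem_of_calculus)
        (auto simp: has_real_derivative_iff_has_vector_derivative[symmetric] intro: has_field_derivative_at_within)
    then have B1: "(B has_integral 1) {a..b}" using d by (simp add: ramp_eq ramp_eq_0)
    have i1: "(\<lambda>s. B s *\<^sub>R \<xi> s) integrable_on {a..b}"
      using Bc cont by (intro integrable_continuous_real continuous_intros)
    have i2: "((\<lambda>s. B s *\<^sub>R \<xi> p) has_integral \<xi> p) {a..b}"
      using has_integral_scaleR_left[OF B1, of "\<xi> p"] by simp
    have "integral {a..b} (\<lambda>s. B s *\<^sub>R \<xi> s) - \<xi> p = integral {a..b} (\<lambda>s. B s *\<^sub>R \<xi> s - B s *\<^sub>R \<xi> p)"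
      using i1 i2 by (subst Henstock_Kurzweil_Integration.integral_diff) (auto simp: integral_unique)
    also have "norm \<dots> \<le> integral {a..b} (\<lambda>s. B s * (e/2))"
    proof (rule Henstock_Kurzweil_Integration.integral_norm_bound_integral)
      show "(\<lambda>s. B s *\<^sub>R \<xi> s - B s *\<^sub>R \<xi> p) integrable_on {a..b}"
        using i1 i2 by (intro integrable_diff) auto
      show "(\<lambda>s. B s * (e/2)) integrable_on {a..b}"
        using B1 by (intro integrable_on_mult_left) auto
      fix s assume s: "s \<in> {a..b}"
      have B0: "B s \<ge> 0" using bump_nonneg[OF d(1)] by (simp add: B_def)
      show "norm (B s *\<^sub>R \<xi> s - B s *\<^sub>R \<xi> p) \<le> B s * (e/2)"
      proof (cases "\<bar>s - p\<bar> < d")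
        case True
        then have "norm (\<xi> s - \<xi> p) \<le> e/2" using r(2)[OF s] d by auto
        then show ?thesis
          using B0 by (metis abs_of_nonneg mult_left_mono norm_scaleR scaleR_diff_right)
      next
        case False
        then show ?thesis using bump_eq_0[OF d(1), of "s - p"] by (simp add: B_def)
      qed
    qed
    also have "\<dots> = e/2" using B1 by (simp add: integral_unique)
    finally show ?thesis using \<open>e > 0\<close> unfolding B_def d_def by linarith
  qed
  then show "\<exists>no. \<forall>n\<ge>no. norm (integral {a..b} (\<lambda>s. (bump (\<delta> n) (s - p) / (\<delta> n)\<^sup>2) *\<^sub>R \<xi> s) - \<xi> p) < e"
    by blast
qed

lemma test_function_ramp:
  assumes "\<delta> > 0" "a < p - \<delta>" "p \<le> q" "q + \<delta> < b"
  shows "test_function a b (\<lambda>s. (ramp \<delta> (s - p) - ramp \<delta> (s - q)) / \<delta>\<^sup>2)"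
    and "deriv (\<lambda>s. (ramp \<delta> (s - p) - ramp \<delta> (s - q)) / \<delta>\<^sup>2) s = bump \<delta> (s - p) / \<delta>\<^sup>2 - bump \<delta> (s - q) / \<delta>\<^sup>2"
proof -
  let ?\<phi> = "\<lambda>s. (ramp \<delta> (s - p) - ramp \<delta> (s - q)) / \<delta>\<^sup>2"
  have D: "(?\<phi> has_real_derivative bump \<delta> (s - p) / \<delta>\<^sup>2 - bump \<delta> (s - q) / \<delta>\<^sup>2) (at s)" for s
    using DERIV_cdivide[OF DERIV_diff[OF DERIV_ramp DERIV_ramp]] by (simp add: diff_divide_distrib)
  then show "deriv ?\<phi> s = bump \<delta> (s - p) / \<delta>\<^sup>2 - bump \<delta> (s - q) / \<delta>\<^sup>2" by (rule DERIV_imp_deriv)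
  have "continuous_on UNIV (\<lambda>s. bump \<delta> (s - p) / \<delta>\<^sup>2 - bump \<delta> (s - q) / \<delta>\<^sup>2)"
    using assms(1) by (intro continuous_intros continuous_on_bump) auto
  then have "?\<phi> C1_differentiable_on UNIV"
    using D unfolding C1_differentiable_on_def has_real_derivative_iff_has_vector_derivative
    by (intro exI[of _ "\<lambda>s. bump \<delta> (s - p) / \<delta>\<^sup>2 - bump \<delta> (s - q) / \<delta>\<^sup>2"]) auto
  moreover have "{s. ?\<phi> s \<noteq> 0} \<subseteq> {p - \<delta>..q + \<delta>}"
  proof
    fix s assume s: "s \<in> {s. ?\<phi> s \<noteq> 0}"
    show "s \<in> {p - \<delta>..q + \<delta>}"
    proof (rule ccontr)
      assume "s \<notin> {p - \<delta>..q + \<delta>}"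
      then consider "s - p \<le> - \<delta>" "s - q \<le> -\<delta>" | "s - p \<ge> \<delta>" "s - q \<ge> \<delta>"
        using assms(3) by force
      then have "?\<phi> s = 0" using ramp_eq[OF assms(1)] ramp_eq_0[OF assms(1)] by cases auto
      then show False using s by blast
    qed
  qed
  then have "closure {s. ?\<phi> s \<noteq> 0} \<subseteq> {p - \<delta>..q + \<delta>}" by (rule closure_minimal) auto
  ultimately show "test_function a b ?\<phi>" using assms unfolding test_function_def by auto
qed

text \<open>The trapezoids \<open>(ramp (s - p) - ramp (s - q)) / \<delta>\<^sup>2\<close> tend to the indicator of \<open>[p,q]\<close>, and
  their derivatives average a continuous function near \<open>p\<close> and \<open>q\<close>.\<close>

lemma weak_derivative_increment:
  fixes \<xi> g :: "real \<Rightarrow> real ^ 'n"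
  assumes cont: "continuous_on {a..b} \<xi>" and g: "g absolutely_integrable_on {a..b}"
    and weak: "weak_derivative_on a b \<xi> g" and pq: "a < p" "p < q" "q < b"
  shows "\<xi> q - \<xi> p = integral {p..q} g"
proof -
  define \<rho> where "\<rho> = min (p - a) (b - q) / 2"
  have \<rho>: "\<rho> > 0" "\<rho> < p - a" "\<rho> < b - q" using pq by (auto simp: \<rho>_def)
  define \<delta> where "\<delta> n = \<rho> / real (Suc n)" for n
  have \<delta>0: "\<delta> n > 0" "\<delta> n \<le> \<rho>" for n using \<rho>(1) by (auto simp: \<delta>_def field_simps)
  have \<delta>lim: "\<delta> \<longlonglongrightarrow> 0"
    unfolding \<delta>_def by (rule LIMSEQ_Suc[OF lim_const_over_n])
  define \<phi> where "\<phi> n s = (ramp (\<delta> n) (s - p) - ramp (\<delta> n) (s - q)) / (\<delta> n)\<^sup>2" for n s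
  have test: "test_function a b (\<phi> n)" and der: "deriv (\<phi> n) s = bump (\<delta> n) (s - p) / (\<delta> n)\<^sup>2 - bump (\<delta> n) (s - q) / (\<delta> n)\<^sup>2" for n s
    using test_function_ramp[of "\<delta> n" a p q b] \<delta>0[of n] \<rho> pq by (simp_all add: \<phi>_def[abs_def])
  have \<phi>c: "continuous_on {a..b} (\<phi> n)" for n
    unfolding \<phi>_def ramp_def using \<delta>0[of n] by (intro continuous_intros) auto
  have \<phi>b: "\<bar>\<phi> n s\<bar> \<le> 1" for n s
  proof -
    have "\<bar>ramp (\<delta> n) (s - p) - ramp (\<delta> n) (s - q)\<bar> \<le> (\<delta> n)\<^sup>2"
      using ramp_bounds[OF \<delta>0(1), of n "s - p"] ramp_bounds[OF \<delta>0(1), of n "s - q"] by linarith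
    then show ?thesis using \<delta>0(1)[of n] by (simp add: \<phi>_def abs_divide divide_le_eq)
  qed
  have \<phi>g: "(\<lambda>s. \<phi> n s *\<^sub>R g s) absolutely_integrable_on {a..b}" for n
    using \<phi>c \<phi>b g by (intro absolutely_integrable_scaleR_bounded[of _ _ _ 1] continuous_imp_measurable_on_sets_lebesgue) auto
  define B where "B r n s = (bump (\<delta> n) (s - r) / (\<delta> n)\<^sup>2) *\<^sub>R \<xi> s" for r n s
  have Bi: "B r n absolutely_integrable_on {a..b}" for r n
    unfolding B_def using cont \<delta>0[of n]
    by (intro absolutely_integrable_continuous_real continuous_intros continuous_on_bump) auto
  have Blim: "(\<lambda>n. integral {a..b} (B r n)) \<longlonglongrightarrow> \<xi> r" if "a < r" "r < b" for r
    unfolding B_def by (rule bump_average_tendsto[OF cont that \<delta>0(1) \<delta>lim])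
  have eq: "integral {a..b} (B p n) - integral {a..b} (B q n) = - integral {a..b} (\<lambda>s. \<phi> n s *\<^sub>R g s)" for n
  proof -
    have d: "deriv (\<phi> n) s *\<^sub>R \<xi> s = B p n s - B q n s" for s
      by (simp add: der B_def scaleR_diff_left)
    have i: "(\<lambda>s. B p n s - B q n s) absolutely_integrable_on {a..b}"
      using Bi by (intro set_integral_diff) auto
    have "(LINT s:{a..b}|lebesgue. deriv (\<phi> n) s *\<^sub>R \<xi> s) = - (LINT s:{a..b}|lebesgue. \<phi> n s *\<^sub>R g s)"
      using weak test[of n] unfolding weak_derivative_on_def by blast
    then have "integral {a..b} (\<lambda>s. B p n s - B q n s) = - integral {a..b} (\<lambda>s. \<phi> n s *\<^sub>R g s)"
      unfolding d set_lebesgue_integral_eq_integral(2)[OF i] set_lebesgue_integral_eq_integral(2)[OF \<phi>g] .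
    moreover have "integral {a..b} (\<lambda>s. B p n s - B q n s) = integral {a..b} (B p n) - integral {a..b} (B q n)"
      using Bi by (intro Henstock_Kurzweil_Integration.integral_diff) (auto simp: absolutely_integrable_on_def)
    ultimately show ?thesis by simp
  qed
  \<comment> \<open>Pointwise limit of the normalized ramps. The value 1/2 at the jump is forced by
    \<open>ramp_at_0\<close>; in the limit integral it only concerns the null set {p, q}.\<close>
  define \<theta> :: "real \<Rightarrow> real \<Rightarrow> real" where "\<theta> r s = (if s < r then 0 else if s = r then 1/2 else 1)" for r s
  have ramplim: "(\<lambda>n. ramp (\<delta> n) (s - r) / (\<delta> n)\<^sup>2) \<longlonglongrightarrow> \<theta> r s" for r s
  proof (cases "s = r")
    case True
    then show ?thesis using \<delta>0(1) by (simp add: ramp_at_0 \<theta>_def less_imp_neq[symmetric])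
  next
    case False
    have "eventually (\<lambda>n. \<delta> n < \<bar>s - r\<bar>) sequentially"
      using \<delta>lim False by (intro order_tendstoD) auto
    then have "eventually (\<lambda>n. ramp (\<delta> n) (s - r) / (\<delta> n)\<^sup>2 = \<theta> r s) sequentially"
    proof eventually_elim
      case (elim n)
      show ?case
        using elim False \<delta>0(1)[of n] ramp_eq[OF \<delta>0(1), of n "s - r"] ramp_eq_0[OF \<delta>0(1), of "s - r" n]
        by (cases "s < r") (auto simp: \<theta>_def)
    qed
    then show ?thesis by (rule tendsto_eventually)
  qed
  have "(\<lambda>n. integral {a..b} (\<lambda>s. \<phi> n s *\<^sub>R g s)) \<longlonglongrightarrow> integral {a..b} (\<lambda>s. (\<theta> p s - \<theta> q s) *\<^sub>R g s)"
  proof (rule dominated_convergence)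
    show "(\<lambda>s. \<phi> n s *\<^sub>R g s) integrable_on {a..b}" for n
      using \<phi>g unfolding absolutely_integrable_on_def by blast
    show "(\<lambda>s. norm (g s)) integrable_on {a..b}" using g unfolding absolutely_integrable_on_def by blast
    show "norm (\<phi> n s *\<^sub>R g s) \<le> norm (g s)" for n s
      using mult_right_mono[OF \<phi>b, of "norm (g s)"] by simp
    show "(\<lambda>n. \<phi> n s *\<^sub>R g s) \<longlonglongrightarrow> (\<theta> p s - \<theta> q s) *\<^sub>R g s" for s
      unfolding \<phi>_def diff_divide_distrib by (intro tendsto_intros ramplim)
  qed
  moreover have "integral {a..b} (\<lambda>s. (\<theta> p s - \<theta> q s) *\<^sub>R g s) = integral {p..q} g"
  proof -
    have "integral {a..b} (\<lambda>s. (\<theta> p s - \<theta> q s) *\<^sub>R g s) = integral {a..b} (\<lambda>s. if s \<in> {p..q} then g s else 0)"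
      using pq by (intro integral_spike[of "{p,q}"]) (auto simp: \<theta>_def)
    also have "\<dots> = integral {p..q} g"
      using pq by (subst integral_restrict_Int) (auto simp: Int_absorb2)
    finally show ?thesis .
  qed
  ultimately have "(\<lambda>n. - integral {a..b} (\<lambda>s. \<phi> n s *\<^sub>R g s)) \<longlonglongrightarrow> - integral {p..q} g"
    by (intro tendsto_minus) simp
  moreover have "(\<lambda>n. integral {a..b} (B p n) - integral {a..b} (B q n)) \<longlonglongrightarrow> \<xi> p - \<xi> q"
    using pq by (intro tendsto_diff Blim) auto
  ultimately have "\<xi> p - \<xi> q = - integral {p..q} g"
    unfolding eq by (rule LIMSEQ_unique[rotated])
  then show ?thesis by (simp add: algebra_simps)
qed

text \<open>On the open interval \<xi> and the primitive of g have equal increments, so they differ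
  by a constant. Test functions do not see the endpoints; these are reached by continuity.\<close>

lemma W11_imp_primitive_on:
  assumes "\<xi> \<in> W11 a b" "a < b"
  obtains g where "primitive_on a b \<xi> g"
proof -
  obtain g where cont: "continuous_on {a..b} \<xi>" and g: "g absolutely_integrable_on {a..b}"
    and weak: "weak_derivative_on a b \<xi> g"
    using assms(1) unfolding W11_def by blast
  define F where "F t = 0 + integral {a..t} g" for t
  have F: "primitive_on a b F g" unfolding F_def by (rule primitive_on_integral[OF g])
  define z where "z t = \<xi> t - F t" for t
  define m where "m = (a + b) / 2"
  define c where "c = z m"
  have m: "a < m" "m < b" using assms(2) by (auto simp: m_def)
  have "z p = z q" if "a < p" "p < q" "q < b" for p q
    using weak_derivative_increment[OF cont g weak that] primitive_on_diff[OF F, of p q] that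
    by (simp add: z_def algebra_simps)
  then have c: "z p = c" if "p \<in> {a<..<b}" for p
    using that m unfolding c_def by (cases p m rule: linorder_cases) auto
  have zc: "continuous_on (closure {a<..<b}) z"
    using cont primitive_on_continuous[OF F] assms(2) unfolding z_def by (simp add: continuous_on_diff)
  have "z t = c" if "t \<in> {a..b}" for t
    using continuous_constant_on_closure[OF zc c] that assms(2) by simp
  then have z: "\<xi> t = F t + c" if "t \<in> {a..b}" for t using that by (simp add: z_def algebra_simps)
  have "\<xi> t = \<xi> a + integral {a..t} g" if "t \<in> {a..b}" for t
    using z[OF that] z[of a] assms(2) by (simp add: F_def)
  then show ?thesis using that g unfolding primitive_on_def by blast
qed

text \<open>Integration by parts in each coordinate; the boundary terms vanish because \<phi> is
  supported in the open interval.\<close>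

lemma primitive_on_imp_W11:
  fixes \<eta> g :: "real \<Rightarrow> real ^ 'n"
  assumes "a \<le> b" and \<eta>: "primitive_on a b \<eta> g"
  shows "\<eta> \<in> W11 a b"
proof -
  have g: "g absolutely_integrable_on {a..b}" using \<eta> by (simp add: primitive_on_def)
  have cont: "continuous_on {a..b} \<eta>" by (rule primitive_on_continuous[OF \<eta>])
  have "(LINT s:{a..b}|lebesgue. deriv \<phi> s *\<^sub>R \<eta> s) = - (LINT s:{a..b}|lebesgue. \<phi> s *\<^sub>R g s)"
    if \<phi>: "test_function a b \<phi>" for \<phi>
  proof -
    obtain D where D: "\<And>s. (\<phi> has_vector_derivative D s) (at s)" and Dc: "continuous_on UNIV D"
      using \<phi> unfolding test_function_def C1_differentiable_on_def by blast
    have dD: "deriv \<phi> s = D s" for s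
      using D by (simp add: DERIV_imp_deriv has_real_derivative_iff_has_vector_derivative)
    have "closure {s. \<phi> s \<noteq> 0} \<subseteq> {a<..<b}" using \<phi> unfolding test_function_def by blast
    then have "{s. \<phi> s \<noteq> 0} \<subseteq> {a<..<b}" by (rule order_trans[OF closure_subset])
    then have \<phi>0: "\<phi> a = 0" "\<phi> b = 0" by auto
    have \<phi>P: "primitive_on a b \<phi> D"
      unfolding primitive_on_def
    proof (intro conjI ballI)
      show "D absolutely_integrable_on {a..b}"
        using continuous_on_subset[OF Dc] by (intro absolutely_integrable_continuous_real) auto
      fix t assume "t \<in> {a..b}"
      then have "(D has_integral (\<phi> t - \<phi> a)) {a..t}"
        using D by (intro fundamental_theorem_of_calculus) (auto intro: has_vector_derivative_at_within)
      then show "\<phi> t = \<phi> a + integral {a..t} D" by (simp add: integral_unique)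
    qed
    have c\<phi>: "continuous_on {a..b} \<phi>" by (rule primitive_on_continuous[OF \<phi>P])
    obtain B where "\<And>s. s \<in> {a..b} \<Longrightarrow> \<bar>\<phi> s\<bar> \<le> B" using primitive_on_bounded[OF \<phi>P] by blast
    then have i1: "(\<lambda>s. \<phi> s *\<^sub>R g s) absolutely_integrable_on {a..b}"
      using c\<phi> g by (intro absolutely_integrable_scaleR_bounded[of _ _ _ B] continuous_imp_measurable_on_sets_lebesgue) auto
    have i2: "(\<lambda>s. D s *\<^sub>R \<eta> s) absolutely_integrable_on {a..b}"
      using continuous_on_subset[OF Dc] cont by (intro absolutely_integrable_continuous_real continuous_intros) auto
    have i3: "(\<lambda>s. D s *\<^sub>R \<eta> s + \<phi> s *\<^sub>R g s) integrable_on {a..b}"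
      using i1 i2 by (intro integrable_add) (auto simp: absolutely_integrable_on_def)
    have "integral {a..b} (\<lambda>s. D s *\<^sub>R \<eta> s) = - integral {a..b} (\<lambda>s. \<phi> s *\<^sub>R g s)"
    proof (rule euclidean_eqI)
      fix k :: "real ^ 'n" assume k: "k \<in> Basis"
      have "primitive_on a b (\<lambda>t. \<phi> t * (\<eta> t \<bullet> k)) (\<lambda>t. D t * (\<eta> t \<bullet> k) + \<phi> t * (g t \<bullet> k))"
        by (intro primitive_on_mult \<open>a \<le> b\<close> \<phi>P primitive_on_linear[OF \<eta> bounded_linear_inner_left])
      then have "integral {a..b} (\<lambda>t. D t * (\<eta> t \<bullet> k) + \<phi> t * (g t \<bullet> k)) = 0"
        by (drule_tac primitive_on_diff[of a b _ _ a b]) (use \<open>a \<le> b\<close> \<phi>0 in auto)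
      moreover have "integral {a..b} (\<lambda>t. D t * (\<eta> t \<bullet> k) + \<phi> t * (g t \<bullet> k)) =
        integral {a..b} (\<lambda>s. D s *\<^sub>R \<eta> s + \<phi> s *\<^sub>R g s) \<bullet> k"
        using integral_component_eq[OF i3, of k] by (simp add: inner_add_left)
      moreover have "integral {a..b} (\<lambda>s. D s *\<^sub>R \<eta> s + \<phi> s *\<^sub>R g s) =
         integral {a..b} (\<lambda>s. D s *\<^sub>R \<eta> s) + integral {a..b} (\<lambda>s. \<phi> s *\<^sub>R g s)"
        using i1 i2 by (intro Henstock_Kurzweil_Integration.integral_add) (auto simp: absolutely_integrable_on_def)
      ultimately show "integral {a..b} (\<lambda>s. D s *\<^sub>R \<eta> s) \<bullet> k = - integral {a..b} (\<lambda>s. \<phi> s *\<^sub>R g s) \<bullet> k"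
        by (simp add: inner_add_left)
    qed
    then show ?thesis
      using set_lebesgue_integral_eq_integral(2)[OF i1] set_lebesgue_integral_eq_integral(2)[OF i2]
      by (simp add: dD)
  qed
  then show ?thesis using cont g unfolding W11_def weak_derivative_on_def by blast
qed

section \<open>Time changes\<close>

text \<open>The two bounds make \<tau> bi-Lipschitz and increasing, and
  \<open>\<alpha>_total\<close> makes it fix b. As \<alpha> is only measurable, \<tau> need not be
  C1.\<close>

locale time_change =
  fixes a b :: real and \<alpha> :: "real \<Rightarrow> real"
  assumes ab: "a < b"
    and \<alpha>_measurable: "\<alpha> \<in> borel_measurable (lebesgue_on {a..b})"
    and \<alpha>_bounds: "\<And>s. s \<in> {a..b} \<Longrightarrow> 1/2 \<le> \<alpha> s \<and> \<alpha> s \<le> 3/2"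
    and \<alpha>_total: "integral {a..b} \<alpha> = b - a"
begin

definition \<tau> :: "real \<Rightarrow> real" where "\<tau> s = a + integral {a..s} \<alpha>"

definition \<sigma> :: "real \<Rightarrow> real" where "\<sigma> = inv_into {a..b} \<tau>"

lemma \<alpha>_integrable: "\<alpha> absolutely_integrable_on {a..b}"
proof (rule measurable_bounded_by_integrable_imp_absolutely_integrable[where g="\<lambda>_. 3/2"])
  show "norm (\<alpha> s) \<le> 3/2" if "s \<in> {a..b}" for s using \<alpha>_bounds[OF that] by simp
qed (use \<alpha>_measurable in auto)

lemma primitive_\<tau>: "primitive_on a b \<tau> \<alpha>"
  unfolding \<tau>_def by (rule primitive_on_integral[OF \<alpha>_integrable])

lemma \<tau>_a: "\<tau> a = a" and \<tau>_b: "\<tau> b = b"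
  using \<alpha>_total by (auto simp: \<tau>_def)

lemma \<tau>_increment:
  assumes "a \<le> s" "s \<le> t" "t \<le> b"
  shows "(t - s) / 2 \<le> \<tau> t - \<tau> s" "\<tau> t - \<tau> s \<le> 3/2 * (t - s)"
proof -
  have i: "\<alpha> integrable_on {s..t}"
    using \<alpha>_integrable assms by (auto simp: absolutely_integrable_on_def intro: integrable_on_subinterval)
  have "integral {s..t} (\<lambda>_. 1/2) \<le> integral {s..t} \<alpha>"
    using \<alpha>_bounds assms by (intro integral_le i) auto
  moreover have "integral {s..t} \<alpha> \<le> integral {s..t} (\<lambda>_. 3/2)"
    using \<alpha>_bounds assms by (intro integral_le i) auto
  ultimately show "(t - s) / 2 \<le> \<tau> t - \<tau> s" "\<tau> t - \<tau> s \<le> 3/2 * (t - s)"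
    using primitive_on_diff[OF primitive_\<tau> assms] assms by auto
qed

lemma \<tau>_less: "a \<le> s \<Longrightarrow> s < t \<Longrightarrow> t \<le> b \<Longrightarrow> \<tau> s < \<tau> t"
  using \<tau>_increment(1)[of s t] by auto

lemma \<tau>_mem: "s \<in> {a..b} \<Longrightarrow> \<tau> s \<in> {a..b}"
  using \<tau>_increment(1)[of a s] \<tau>_increment(1)[of s b] \<tau>_a \<tau>_b by auto

lemma inj_on_\<tau>: "inj_on \<tau> {a..b}"
  by (rule linorder_inj_onI') (use \<tau>_less in force)

lemma image_\<tau>: "\<tau> ` {a..b} = {a..b}"
proof
  show "{a..b} \<subseteq> \<tau> ` {a..b}"
  proof
    fix t assume "t \<in> {a..b}"
    then obtain s where "a \<le> s" "s \<le> b" "\<tau> s = t"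
      using IVT'[of \<tau> a t b] \<tau>_a \<tau>_b ab primitive_on_continuous[OF primitive_\<tau>] by auto
    then show "t \<in> \<tau> ` {a..b}" by auto
  qed
qed (use \<tau>_mem in blast)

lemma \<sigma>_\<tau>: "s \<in> {a..b} \<Longrightarrow> \<sigma> (\<tau> s) = s"
  unfolding \<sigma>_def by (rule inv_into_f_f[OF inj_on_\<tau>])

lemma \<tau>_\<sigma>: "t \<in> {a..b} \<Longrightarrow> \<tau> (\<sigma> t) = t"
  unfolding \<sigma>_def by (rule f_inv_into_f) (simp add: image_\<tau>)

lemma \<sigma>_mem: "t \<in> {a..b} \<Longrightarrow> \<sigma> t \<in> {a..b}"
  unfolding \<sigma>_def by (rule inv_into_into) (simp add: image_\<tau>)

lemma \<sigma>_a: "\<sigma> a = a" and \<sigma>_b: "\<sigma> b = b"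
  using \<sigma>_\<tau>[of a] \<sigma>_\<tau>[of b] \<tau>_a \<tau>_b ab by auto

lemma \<sigma>_less: "a \<le> s \<Longrightarrow> s < t \<Longrightarrow> t \<le> b \<Longrightarrow> \<sigma> s < \<sigma> t"
  using \<sigma>_mem[of s] \<sigma>_mem[of t] \<tau>_\<sigma>[of s] \<tau>_\<sigma>[of t] \<tau>_less[of "\<sigma> t" "\<sigma> s"]
  by (cases "\<sigma> s" "\<sigma> t" rule: linorder_cases) auto

lemma \<sigma>_le: "a \<le> s \<Longrightarrow> s \<le> t \<Longrightarrow> t \<le> b \<Longrightarrow> \<sigma> s \<le> \<sigma> t"
  using \<sigma>_less[of s t] by (cases "s = t") auto

lemma \<sigma>_increment: "a \<le> s \<Longrightarrow> s \<le> t \<Longrightarrow> t \<le> b \<Longrightarrow> \<sigma> t - \<sigma> s \<le> 2 * (t - s)"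
  using \<tau>_increment(1)[of "\<sigma> s" "\<sigma> t"] \<sigma>_le[of s t] \<sigma>_mem[of s] \<sigma>_mem[of t] \<tau>_\<sigma>[of s] \<tau>_\<sigma>[of t] by auto

lemma continuous_on_\<sigma>: "continuous_on {a..b} \<sigma>"
proof -
  have "continuous_on (\<tau> ` {a..b}) \<sigma>"
    using \<sigma>_\<tau> primitive_on_continuous[OF primitive_\<tau>] by (intro continuous_on_inv) auto
  then show ?thesis by (simp add: image_\<tau>)
qed

lemma \<sigma>_image_Icc:
  assumes "{u..v} \<subseteq> {a..b}" "u \<le> v"
  shows "\<sigma> ` {u..v} = {\<sigma> u..\<sigma> v}"
proof
  show "\<sigma> ` {u..v} \<subseteq> {\<sigma> u..\<sigma> v}" using \<sigma>_le assms by auto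
  show "{\<sigma> u..\<sigma> v} \<subseteq> \<sigma> ` {u..v}"
  proof
    fix x assume x: "x \<in> {\<sigma> u..\<sigma> v}"
    have uv: "u \<in> {a..b}" "v \<in> {a..b}" using assms by auto
    then have xab: "x \<in> {a..b}" using x \<sigma>_mem[of u] \<sigma>_mem[of v] by auto
    have "\<tau> x \<in> {a..b}" using \<tau>_mem[OF xab] .
    then have "u \<le> \<tau> x" "\<tau> x \<le> v"
      using \<sigma>_less[of "\<tau> x" u] \<sigma>_less[of v "\<tau> x"] \<sigma>_\<tau>[OF xab] x uv by force+
    then show "x \<in> \<sigma> ` {u..v}" using \<sigma>_\<tau>[OF xab] by (metis atLeastAtMost_iff imageI)
  qed
qed

text \<open>Absolute continuity quantifies over divisions, so composing with \<sigma> amounts to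
  transporting divisions. Interiors stay disjoint because \<tau>, being strictly increasing, maps
  interior points of an image interval back to interior points of the original one.\<close>

lemma division_of_\<sigma>_image:
  assumes D: "D division_of S" and S: "S \<subseteq> {a..b}"
  shows "((`) \<sigma> ` D) division_of (\<sigma> ` S)"
proof (rule division_ofI)
  note I = division_of_intervals[OF D S]
  show "finite ((`) \<sigma> ` D)" using D by auto
  show "\<Union>((`) \<sigma> ` D) = \<sigma> ` S" using division_ofD(6)[OF D] by auto
  fix K assume "K \<in> (`) \<sigma> ` D"
  then obtain A where A: "A \<in> D" "K = \<sigma> ` A" by auto
  show "K \<subseteq> \<sigma> ` S" using A division_ofD(2)[OF D] by auto
  show "K \<noteq> {}" using A division_ofD(3)[OF D] by auto
  obtain u v where uv: "A = {u..v}" "u \<le> v" "{u..v} \<subseteq> {a..b}" using I[OF A(1)] by metis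
  then show "\<exists>p q. K = cbox p q" using A \<sigma>_image_Icc by auto
  fix K' assume "K' \<in> (`) \<sigma> ` D" "K \<noteq> K'"
  then obtain A' where A': "A' \<in> D" "K' = \<sigma> ` A'" "A \<noteq> A'" using A by auto
  obtain u' v' where uv': "A' = {u'..v'}" "u' \<le> v'" "{u'..v'} \<subseteq> {a..b}" using I[OF A'(1)] by metis
  have disj: "{u<..<v} \<inter> {u'<..<v'} = {}"
    using division_ofD(5)[OF D A(1) A'(1,3)] uv uv' by (simp add: interior_atLeastAtMost_real)
  have "x \<notin> interior K'" if x: "x \<in> interior K" for x
  proof
    assume x': "x \<in> interior K'"
    have *: "\<tau> x \<in> {p<..<q}" if "x \<in> {\<sigma> p<..<\<sigma> q}" "{p..q} \<subseteq> {a..b}" "p \<le> q" for p q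
    proof -
      have "p \<in> {a..b}" "q \<in> {a..b}" using that by auto
      then show ?thesis
        using that \<tau>_less[of "\<sigma> p" x] \<tau>_less[of x "\<sigma> q"] \<sigma>_mem[of p] \<sigma>_mem[of q] \<tau>_\<sigma>[of p] \<tau>_\<sigma>[of q] by auto
    qed
    have "\<tau> x \<in> {u<..<v}" "\<tau> x \<in> {u'<..<v'}"
      using x x' A A' uv uv' \<sigma>_image_Icc by (auto intro!: * simp: interior_atLeastAtMost_real simp del: greaterThanLessThan_iff)
    then show False using disj by blast
  qed
  then show "interior K \<inter> interior K' = {}" by blast
qed

text \<open>Composites of absolutely continuous functions need not be absolutely continuous. Here
  the inner function is monotone, so divisions go to divisions, and 2-Lipschitz, so their total
  length at most doubles; hence the threshold \<open>d / 2\<close>.\<close>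

lemma abs_continuous_on_compose_\<sigma>:
  assumes F: "abs_continuous_on a b F"
  shows "abs_continuous_on a b (\<lambda>t. F (\<sigma> t))"
  unfolding abs_continuous_on_def
proof (intro allI impI)
  fix \<epsilon> :: real assume "\<epsilon> > 0"
  then obtain d where d: "d > 0" "\<And>D S. D division_of S \<Longrightarrow> S \<subseteq> {a..b} \<Longrightarrow> (\<Sum>I\<in>D. Sup I - Inf I) < d
        \<Longrightarrow> (\<Sum>I\<in>D. \<bar>F (Sup I) - F (Inf I)\<bar>) < \<epsilon>"
    using F[unfolded abs_continuous_on_def, rule_format, of \<epsilon>] by blast
  have "(\<Sum>I\<in>D. \<bar>F (\<sigma> (Sup I)) - F (\<sigma> (Inf I))\<bar>) < \<epsilon>"
    if D: "D division_of S" "S \<subseteq> {a..b}" "(\<Sum>I\<in>D. Sup I - Inf I) < d / 2" for D S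
  proof -
    note I = division_of_intervals[OF D(1,2)]
    have \<sigma>I: "Sup (\<sigma> ` I) = \<sigma> (Sup I)" "Inf (\<sigma> ` I) = \<sigma> (Inf I)"
        "\<sigma> (Sup I) - \<sigma> (Inf I) \<le> 2 * (Sup I - Inf I)" if ID: "I \<in> D" for I
    proof -
      obtain u v where uv: "I = {u..v}" "u \<le> v" "{u..v} \<subseteq> {a..b}" using I[OF ID] by metis
      then have "\<sigma> u \<le> \<sigma> v" using \<sigma>_le by auto
      then show "Sup (\<sigma> ` I) = \<sigma> (Sup I)" "Inf (\<sigma> ` I) = \<sigma> (Inf I)"
        "\<sigma> (Sup I) - \<sigma> (Inf I) \<le> 2 * (Sup I - Inf I)"
        using \<sigma>_image_Icc[OF uv(3,2)] uv \<sigma>_increment[of u v] by auto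
    qed
    \<comment> \<open>Reindexing the sum needs distinct intervals to have distinct images; \<tau>
      recovers each interval from its image.\<close>
    have inj: "inj_on ((`) \<sigma>) D"
    proof (rule inj_onI)
      have "\<tau> ` \<sigma> ` A = A" if "A \<in> D" for A
        by (rule I[OF that]) (use \<tau>_\<sigma> in \<open>force simp: image_image\<close>)
      then show "A = B" if "A \<in> D" "B \<in> D" "\<sigma> ` A = \<sigma> ` B" for A B using that by metis
    qed
    have "(\<Sum>I\<in>D. \<bar>F (\<sigma> (Sup I)) - F (\<sigma> (Inf I))\<bar>) = (\<Sum>K\<in>(`) \<sigma> ` D. \<bar>F (Sup K) - F (Inf K)\<bar>)"
      unfolding sum.reindex[OF inj] by (intro sum.cong) (auto simp: \<sigma>I)
    also have "\<dots> < \<epsilon>"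
    proof (rule d(2)[OF division_of_\<sigma>_image[OF D(1,2)]])
      show "\<sigma> ` S \<subseteq> {a..b}" using \<sigma>_mem D(2) by blast
      have "(\<Sum>K\<in>(`) \<sigma> ` D. Sup K - Inf K) = (\<Sum>I\<in>D. \<sigma> (Sup I) - \<sigma> (Inf I))"
        unfolding sum.reindex[OF inj] by (intro sum.cong) (auto simp: \<sigma>I)
      also have "\<dots> \<le> (\<Sum>I\<in>D. 2 * (Sup I - Inf I))" by (intro sum_mono \<sigma>I)
      also have "\<dots> = 2 * (\<Sum>I\<in>D. Sup I - Inf I)" by (simp only: sum_distrib_left)
      also have "\<dots> < d" using D(3) by simp
      finally show "(\<Sum>K\<in>(`) \<sigma> ` D. Sup K - Inf K) < d" .
    qed
    finally show ?thesis .
  qed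
  then show "\<exists>\<delta>>0. \<forall>D S. D division_of S \<and> S \<subseteq> {a..b} \<and> (\<Sum>I\<in>D. Sup I - Inf I) < \<delta>
        \<longrightarrow> (\<Sum>I\<in>D. \<bar>F (\<sigma> (Sup I)) - F (\<sigma> (Inf I))\<bar>) < \<epsilon>"
    using d(1) by (intro exI[of _ "d / 2"]) auto
qed

text \<open>The new exceptional set lies in the image under \<tau> of the old one, and Lipschitz
  maps send null sets to null sets.\<close>

lemma AE_compose_\<sigma>:
  assumes "AE s in lebesgue_on {a..b}. P s"
  shows "AE t in lebesgue_on {a..b}. P (\<sigma> t)"
proof -
  define N where "N = {s \<in> {a..b}. \<not> P s}"
  have "negligible (\<tau> ` N)"
  proof (rule negligible_locally_Lipschitz_image)
    show "negligible N" using assms unfolding AE_lebesgue_on_iff_negligible N_def .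
    fix x assume x: "x \<in> N"
    have "norm (\<tau> y - \<tau> x) \<le> 3/2 * norm (y - x)" if "y \<in> N" for y
      using \<tau>_increment[of x y] \<tau>_increment[of y x] x that
      by (cases "x \<le> y") (auto simp: N_def)
    then show "\<exists>T B. open T \<and> x \<in> T \<and> (\<forall>y\<in>N \<inter> T. norm (\<tau> y - \<tau> x) \<le> B * norm (y - x))"
      by (intro exI[of _ UNIV] exI[of _ "3/2"]) auto
  qed simp
  moreover have "{t \<in> {a..b}. \<not> P (\<sigma> t)} \<subseteq> \<tau> ` N"
  proof
    fix t assume "t \<in> {t \<in> {a..b}. \<not> P (\<sigma> t)}"
    then have "\<sigma> t \<in> N" "\<tau> (\<sigma> t) = t" using \<sigma>_mem \<tau>_\<sigma> by (auto simp: N_def)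
    then show "t \<in> \<tau> ` N" by (metis imageI)
  qed
  ultimately show ?thesis unfolding AE_lebesgue_on_iff_negligible by (rule negligible_subset)
qed

text \<open>Inverse function rule at \<open>\<sigma> t\<close>. By
  \<open>AE_compose_\<sigma>\<close> the points where \<tau> lacks the derivative \<alpha> remain
  exceptional only on a null set, and \<alpha> \<ge> 1/2 excludes a zero derivative.\<close>

lemma AE_\<sigma>_derivative: "AE t in lebesgue_on {a..b}. (\<sigma> has_real_derivative 1 / \<alpha> (\<sigma> t)) (at t)"
proof -
  have "AE s in lebesgue_on {a..b}. (\<tau> has_real_derivative \<alpha> s) (at s)"
    using primitive_on_AE_vector_derivative[OF primitive_\<tau>]
    by (simp add: has_real_derivative_iff_has_vector_derivative)
  then have 1: "AE t in lebesgue_on {a..b}. (\<tau> has_real_derivative \<alpha> (\<sigma> t)) (at (\<sigma> t))"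
    by (rule AE_compose_\<sigma>)
  have "{s \<in> {a..b}. \<not> (a < s \<and> s < b)} \<subseteq> {a, b}" by auto
  then have 2: "AE t in lebesgue_on {a..b}. a < t \<and> t < b"
    unfolding AE_lebesgue_on_iff_negligible by (rule negligible_subset[rotated]) auto
  show ?thesis
    using 1 2
  proof eventually_elim
    case (elim t)
    have "(\<sigma> has_real_derivative inverse (\<alpha> (\<sigma> t))) (at t)"
    proof (rule DERIV_inverse_function[where f=\<tau>])
      show "\<alpha> (\<sigma> t) \<noteq> 0" using \<alpha>_bounds[of "\<sigma> t"] \<sigma>_mem[of t] elim by auto
      show "isCont \<sigma> t"
        using continuous_on_interior[OF continuous_on_\<sigma>, of t] elim by (simp add: interior_atLeastAtMost_real)
    qed (use elim \<tau>_\<sigma> in auto)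
    then show ?case by (simp add: inverse_eq_divide)
  qed
qed

lemma primitive_on_compose_\<sigma>_real:
  fixes F f :: "real \<Rightarrow> real"
  assumes F: "primitive_on a b F f"
  shows "primitive_on a b (\<lambda>t. F (\<sigma> t)) (\<lambda>t. f (\<sigma> t) / \<alpha> (\<sigma> t))"
  unfolding primitive_on_iff_abs_continuous[OF less_imp_le[OF ab]]
proof
  have F': "abs_continuous_on a b F" "AE s in lebesgue_on {a..b}. (F has_real_derivative f s) (at s)"
    using F unfolding primitive_on_iff_abs_continuous[OF less_imp_le[OF ab]] by auto
  show "abs_continuous_on a b (\<lambda>t. F (\<sigma> t))" by (rule abs_continuous_on_compose_\<sigma>[OF F'(1)])
  show "AE t in lebesgue_on {a..b}. ((\<lambda>t. F (\<sigma> t)) has_real_derivative f (\<sigma> t) / \<alpha> (\<sigma> t)) (at t)"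
    using AE_compose_\<sigma>[OF F'(2)] AE_\<sigma>_derivative
  proof eventually_elim
    case (elim t)
    then show ?case using DERIV_chain2[of F "f (\<sigma> t)" \<sigma> t "1 / \<alpha> (\<sigma> t)" UNIV] by simp
  qed
qed

lemma primitive_on_compose_\<sigma>:
  fixes F f :: "real \<Rightarrow> 'a::euclidean_space"
  assumes F: "primitive_on a b F f"
  shows "primitive_on a b (\<lambda>t. F (\<sigma> t)) (\<lambda>t. f (\<sigma> t) /\<^sub>R \<alpha> (\<sigma> t))"
proof (rule primitive_on_componentwise)
  fix k :: 'a
  show "primitive_on a b (\<lambda>t. F (\<sigma> t) \<bullet> k) (\<lambda>t. (f (\<sigma> t) /\<^sub>R \<alpha> (\<sigma> t)) \<bullet> k)"
    using primitive_on_compose_\<sigma>_real[OF primitive_on_linear[OF F bounded_linear_inner_left, of k]]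
    by (simp add: divide_inverse mult.commute)
qed

end

section \<open>Lipschitz equations with measurable time dependence\<close>

text \<open>The weight \<open>exp (- \<lambda> (t - a))\<close> turns the Volterra operator into a contraction on all of
  \<open>[a,b]\<close>.\<close>

lemma caratheodory_lipschitz:
  fixes F :: "real \<Rightarrow> real \<Rightarrow> real"
  assumes "a \<le> b" and M: "M \<ge> 0"
    and lip: "\<And>s p q. s \<in> {a..b} \<Longrightarrow> \<bar>F s p - F s q\<bar> \<le> M * \<bar>p - q\<bar>"
    and int: "\<And>v. continuous_on {a..b} v \<Longrightarrow> (\<lambda>s. F s (v s)) absolutely_integrable_on {a..b}"
  obtains W where "W a = u" "primitive_on a b W (\<lambda>s. F s (W s))"
proof -
  \<comment> \<open>Any weight with M / l \<le> 1/2 would do; the summand 1 keeps l positive when M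
    = 0.\<close>
  define l where "l = 2 * M + 1"
  have l: "l > 0" "M / l \<le> 1/2" using M by (auto simp: l_def field_simps)
  \<comment> \<open>Clamping time to [a,b] lets the operator act on bounded continuous functions on
    the whole line, which form a complete space.\<close>
  define c where "c t = max a (min b t)" for t
  have c: "c t \<in> {a..b}" "continuous_on UNIV c" "t \<in> {a..b} \<Longrightarrow> c t = t" for t
    using \<open>a \<le> b\<close> unfolding c_def by (auto intro!: continuous_intros)
  define E where "E t = exp (l * (t - a))" for t
  have E: "E t > 0" "continuous_on S E" for t S unfolding E_def by (auto intro!: continuous_intros)
  \<comment> \<open>The fixed point is sought for v = W / E, whose sup norm is the weighted norm of
    W.\<close>
  define V where "V v t = u + integral {a..t} (\<lambda>s. F s (E s * v s))" for v t
  define T where "T v t = V v (c t) / E (c t)" for v t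
  have vint: "(\<lambda>s. F s (E s * v s)) absolutely_integrable_on {a..b}" if "continuous_on UNIV v" for v
    using continuous_on_subset[OF that, of "{a..b}"] E(2) by (intro int continuous_intros) auto
  have Vp: "primitive_on a b (V v) (\<lambda>s. F s (E s * v s))" if "continuous_on UNIV v" for v
    unfolding V_def by (rule primitive_on_integral[OF vint[OF that]])
  have Tb: "T v \<in> bcontfun" if v: "continuous_on UNIV v" for v
  proof -
    have co: "continuous_on {a..b} (\<lambda>t. V v t / E t)"
      using primitive_on_continuous[OF Vp[OF v]] E(1,2) by (intro continuous_intros) (auto simp: less_imp_neq[symmetric])
    have "continuous_on UNIV (T v)"
      unfolding T_def using c(1) by (intro continuous_on_compose2[OF co c(2)]) auto
    moreover have "bounded ((\<lambda>t. V v t / E t) ` {a..b})"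
      by (intro compact_imp_bounded compact_continuous_image co) auto
    then have "bounded (range (T v))"
      by (rule bounded_subset) (use c(1) in \<open>auto simp: T_def\<close>)
    ultimately show ?thesis by (auto simp: bcontfun_def)
  qed
  define \<Phi> where "\<Phi> v = Bcontfun (T (apply_bcontfun v))" for v
  have \<Phi>: "apply_bcontfun (\<Phi> v) = T (apply_bcontfun v)" for v
    unfolding \<Phi>_def by (rule Bcontfun_inverse[OF Tb]) simp
  have contr: "dist (\<Phi> v) (\<Phi> w) \<le> 1/2 * dist v w" for v w
  proof (rule dist_bound)
    fix x
    define t where "t = c x"
    have t: "t \<in> {a..b}" using c(1) by (simp add: t_def)
    define D where "D = dist v w"
    have D: "\<bar>v s - w s\<bar> \<le> D" for s using dist_bounded[of v s w] by (simp add: D_def dist_real_def)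
    have i: "(\<lambda>s. F s (E s * v s)) integrable_on {a..t}" for v :: "real \<Rightarrow>\<^sub>C real"
      using vint[of v] t by (auto simp: absolutely_integrable_on_def intro: integrable_on_subinterval)
    have "(E has_real_derivative l * E s) (at s)" for s
      unfolding E_def by (auto intro!: derivative_eq_intros)
    then have "((\<lambda>s. l * E s) has_integral (E t - E a)) {a..t}"
      using t by (intro fundamental_theorem_of_calculus)
        (auto simp: has_real_derivative_iff_has_vector_derivative[symmetric] intro: has_field_derivative_at_within)
    \<comment> \<open>Integrating the weight gains the factor 1 / l; this is the source of the
      contraction constant.\<close>
    from has_integral_mult_right[OF this, of "M * D / l"]
    have Ei: "((\<lambda>s. M * D * E s) has_integral (M * D / l * (E t - E a))) {a..t}"
      using l(1) by (simp add: mult_ac)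
    have "V v t - V w t = integral {a..t} (\<lambda>s. F s (E s * v s) - F s (E s * w s))"
      unfolding V_def using i by (simp add: Henstock_Kurzweil_Integration.integral_diff)
    also have "norm \<dots> \<le> integral {a..t} (\<lambda>s. M * D * E s)"
    proof (rule Henstock_Kurzweil_Integration.integral_norm_bound_integral)
      show "(\<lambda>s. F s (E s * v s) - F s (E s * w s)) integrable_on {a..t}" using i by (intro integrable_diff)
      show "(\<lambda>s. M * D * E s) integrable_on {a..t}" using Ei by blast
      fix s assume "s \<in> {a..t}"
      then have "norm (F s (E s * v s) - F s (E s * w s)) \<le> M * \<bar>E s * v s - E s * w s\<bar>"
        using lip t by auto
      also have "\<bar>E s * v s - E s * w s\<bar> = E s * \<bar>v s - w s\<bar>"
        using E(1)[of s] by (simp add: right_diff_distrib[symmetric] abs_mult)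
      also have "M * (E s * \<bar>v s - w s\<bar>) \<le> M * (E s * D)"
        using M E(1)[of s] D by (intro mult_left_mono) auto
      finally show "norm (F s (E s * v s) - F s (E s * w s)) \<le> M * D * E s" by (simp add: mult_ac)
    qed
    also have "\<dots> = M / l * D * (E t - E a)" unfolding integral_unique[OF Ei] by simp
    also have "\<dots> \<le> 1/2 * D * E t"
    proof (intro mult_mono)
      show "E t - E a \<le> E t" using E(1)[of a] by simp
      show "0 \<le> D" by (simp add: D_def)
      show "0 \<le> E t - E a" using t l by (simp add: E_def)
    qed (use l M in \<open>auto simp: D_def\<close>)
    finally have "\<bar>V v t - V w t\<bar> \<le> 1/2 * D * E t" by simp
    then have "\<bar>V v t / E t - V w t / E t\<bar> \<le> 1/2 * D"
      using E(1)[of t] by (simp add: diff_divide_distrib[symmetric] abs_divide divide_le_eq)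
    then show "dist (\<Phi> v x) (\<Phi> w x) \<le> 1/2 * dist v w"
      by (simp add: \<Phi> T_def t_def D_def dist_real_def)
  qed
  then obtain v where v: "\<Phi> v = v"
    using banach_fix_type[of "1/2" \<Phi>] by auto
  define W where "W t = E t * v t" for t
  have "W t = V v t" if "t \<in> {a..b}" for t
  proof -
    have "v t = T v t" using \<Phi>[of v] v by simp
    then show ?thesis using c(3)[OF that] E(1)[of t] by (simp add: W_def T_def)
  qed
  then have W: "W t = u + integral {a..t} (\<lambda>s. F s (W s))" if "t \<in> {a..b}" for t
    using that by (simp add: V_def W_def)
  have "W a = u" using W[of a] \<open>a \<le> b\<close> by simp
  moreover have "primitive_on a b W (\<lambda>s. F s (W s))"
    unfolding primitive_on_def
  proof (intro conjI ballI)
    show "(\<lambda>s. F s (W s)) absolutely_integrable_on {a..b}" using vint[of v] by (simp add: W_def)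
    show "W t = W a + integral {a..t} (\<lambda>s. F s (W s))" if "t \<in> {a..b}" for t
      using W[OF that] unfolding \<open>W a = u\<close> .
  qed
  ultimately show ?thesis using that by blast
qed

text \<open>The difference of two solutions solves a homogeneous linear equation with bounded
  coefficient; the integrating factor then keeps it at its initial value 0.\<close>

lemma lipschitz_ode_unique:
  fixes F :: "real \<Rightarrow> real \<Rightarrow> real"
  assumes "a \<le> b"
    and lip: "\<And>s p q. s \<in> {a..b} \<Longrightarrow> \<bar>F s p - F s q\<bar> \<le> M * \<bar>p - q\<bar>"
    and v: "primitive_on a b v (\<lambda>s. F s (v s))" and w: "primitive_on a b w (\<lambda>s. F s (w s))"
    and "v a = w a" "t \<in> {a..b}"
  shows "v t = w t"
proof -
  \<comment> \<open>Where v and w coincide, division by zero gives q = 0, consistent with the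
    vanishing numerator.\<close>
  define q where "q s = (F s (v s) - F s (w s)) / (v s - w s)" for s
  have m: "v \<in> borel_measurable (lebesgue_on {a..b})" "w \<in> borel_measurable (lebesgue_on {a..b})"
    using primitive_on_continuous v w by (auto intro!: continuous_imp_measurable_on_sets_lebesgue)
  have m': "(\<lambda>s. F s (v s)) \<in> borel_measurable (lebesgue_on {a..b})" "(\<lambda>s. F s (w s)) \<in> borel_measurable (lebesgue_on {a..b})"
    using v w unfolding primitive_on_def by (auto intro!: absolutely_integrable_imp_borel_measurable)
  have q: "q absolutely_integrable_on {a..b}"
  proof (rule measurable_bounded_by_integrable_imp_absolutely_integrable[where g="\<lambda>_. \<bar>M\<bar>"])
    show "q \<in> borel_measurable (lebesgue_on {a..b})" unfolding q_def using m m' by measurable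
    fix s assume s: "s \<in> {a..b}"
    show "norm (q s) \<le> \<bar>M\<bar>"
    proof (cases "v s = w s")
      case False
      have "\<bar>F s (v s) - F s (w s)\<bar> \<le> \<bar>M\<bar> * \<bar>v s - w s\<bar>"
        using lip[OF s, of "v s" "w s"] mult_right_mono[OF abs_ge_self[of M], of "\<bar>v s - w s\<bar>"] by simp
      then show ?thesis using False by (simp add: q_def abs_divide divide_le_eq)
    qed (simp add: q_def)
  qed auto
  have "primitive_on a b (\<lambda>s. v s - w s) (\<lambda>s. q s * (v s - w s) + 0)"
    by (rule primitive_on_cong[OF primitive_on_diff_fun[OF v w]]) (auto simp: q_def)
  from primitive_on_linear_ode[OF \<open>a \<le> b\<close> this q]
  have "primitive_on a b (\<lambda>t. (v t - w t) * exp (- integral {a..t} q)) (\<lambda>s. 0)" by simp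
  from primitive_on_diff[OF this, of a t] have "(v t - w t) * exp (- integral {a..t} q) = 0"
    using \<open>v a = w a\<close> \<open>t \<in> {a..b}\<close> by simp
  then show ?thesis by simp
qed

text \<open>The passage to the limit, stripped of the calculus of variations. The integrating factor
  expresses the endpoint difference by the residuals r = F(w) - f. The formula is used twice: first
  it shows that the differences are O(\<epsilon>), so the coefficients converge to D; then, divided
  by \<epsilon>, it gives the limit by dominated convergence.\<close>

lemma perturbation_inequality:
  fixes F Fp :: "nat \<Rightarrow> real \<Rightarrow> real \<Rightarrow> real" and w f :: "real \<Rightarrow> real"
  assumes ab: "a \<le> b" and w: "primitive_on a b w f"
    and W: "\<And>n. primitive_on a b (W n) (\<lambda>s. F n s (W n s))"
    and Wa: "\<And>n. W n a = w a" and Wb: "\<And>n. w b \<le> W n b"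
    and der: "\<And>n s p. s \<in> {a..b} \<Longrightarrow> (F n s has_real_derivative Fp n s p) (at p)"
    and bnd: "\<And>n s p. s \<in> {a..b} \<Longrightarrow> \<bar>Fp n s p\<bar> \<le> M"
    and Fw: "\<And>n. (\<lambda>s. F n s (w s)) absolutely_integrable_on {a..b}"
    and \<epsilon>: "\<And>n. \<epsilon> n > 0" "\<epsilon> \<longlonglongrightarrow> 0"
    and G: "G integrable_on {a..b}"
    and est: "\<And>n s. s \<in> {a..b} \<Longrightarrow> \<bar>F n s (w s) - f s\<bar> \<le> \<epsilon> n * G s"
    and lim_r: "\<And>s. s \<in> {a..b} \<Longrightarrow> (\<lambda>n. (F n s (w s) - f s) / \<epsilon> n) \<longlonglongrightarrow> \<rho> s"
    and lim_D: "\<And>s p. s \<in> {a..b} \<Longrightarrow> p \<longlonglongrightarrow> w s \<Longrightarrow> (\<lambda>n. Fp n s (p n)) \<longlonglongrightarrow> D s"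
    and D: "D \<in> borel_measurable (lebesgue_on {a..b})"
  shows "0 \<le> integral {a..b} (\<lambda>s. exp (- integral {a..s} D) * \<rho> s)"
proof -
  define d where "d n s = W n s - w s" for n s
  define r where "r n s = F n s (w s) - f s" for n s
  \<comment> \<open>Where the difference vanishes the value is D rather than 0, so that
    \<open>q n s\<close> tends to \<open>D s\<close> even if \<open>W n s\<close> equals
    \<open>w s\<close> for infinitely many n.\<close>
  define q where "q n s = (if d n s = 0 then D s else (F n s (W n s) - F n s (w s)) / d n s)" for n s
  have Db: "\<bar>D s\<bar> \<le> M" if s: "s \<in> {a..b}" for s
  proof -
    have "(\<lambda>n. \<bar>Fp n s (w s)\<bar>) \<longlonglongrightarrow> \<bar>D s\<bar>" using lim_D[OF s, of "\<lambda>_. w s"] by (intro tendsto_rabs) auto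
    then show ?thesis by (rule LIMSEQ_le_const2) (use bnd[OF s] in auto)
  qed
  have M: "M \<ge> 0" using Db[of a] ab by (auto intro: order_trans[OF abs_ge_zero])
  \<comment> \<open>The mean value point depends on s in an uncontrolled way; it serves only for
    bounds and pointwise limits. Measurability of q comes from the quotient.\<close>
  have mvt: "\<exists>p. \<bar>p - w s\<bar> \<le> \<bar>d n s\<bar> \<and> q n s = Fp n s p" if s: "s \<in> {a..b}" "d n s \<noteq> 0" for n s
  proof -
    have "\<exists>z. z > min (W n s) (w s) \<and> z < max (W n s) (w s) \<and> F n s (W n s) - F n s (w s) = (W n s - w s) * Fp n s z"
    proof (cases "w s < W n s")
      case True
      then show ?thesis using MVT2[of "w s" "W n s" "F n s" "Fp n s"] der[OF s(1)] by auto
    next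
      case False
      then have "W n s < w s" using s(2) by (simp add: d_def)
      then obtain z where "z > W n s" "z < w s" "F n s (w s) - F n s (W n s) = (w s - W n s) * Fp n s z"
        using MVT2[of "W n s" "w s" "F n s" "Fp n s"] der[OF s(1)] by auto
      then show ?thesis by (intro exI[of _ z]) (auto simp: algebra_simps)
    qed
    then obtain z where "z > min (W n s) (w s)" "z < max (W n s) (w s)"
      "F n s (W n s) - F n s (w s) = (W n s - w s) * Fp n s z" by blast
    then show ?thesis using s(2) by (intro exI[of _ z]) (auto simp: q_def d_def abs_if min_def max_def split: if_splits)
  qed
  have qb: "\<bar>q n s\<bar> \<le> M" if s: "s \<in> {a..b}" for n s
  proof (cases "d n s = 0")
    case True
    then show ?thesis using Db[OF s] by (simp add: q_def)
  next
    case False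
    then obtain p where "q n s = Fp n s p" using mvt[OF s] by blast
    then show ?thesis using bnd[OF s] by simp
  qed
  have dm: "d n \<in> borel_measurable (lebesgue_on {a..b})" for n
    unfolding d_def using primitive_on_continuous[OF W[of n]] primitive_on_continuous[OF w]
    by (intro continuous_imp_measurable_on_sets_lebesgue continuous_intros) auto
  have qi: "q n absolutely_integrable_on {a..b}" for n
  proof (rule measurable_bounded_by_integrable_imp_absolutely_integrable[where g="\<lambda>_. M"])
    have [measurable]: "(\<lambda>s. F n s (W n s)) \<in> borel_measurable (lebesgue_on {a..b})"
      "(\<lambda>s. F n s (w s)) \<in> borel_measurable (lebesgue_on {a..b})"
      using W[of n] Fw[of n] unfolding primitive_on_def by (auto intro!: absolutely_integrable_imp_borel_measurable)
    note [measurable] = dm[of n] D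
    show "q n \<in> borel_measurable (lebesgue_on {a..b})" unfolding q_def by measurable
  qed (use qb in auto)
  define Q where "Q n t = integral {a..t} (q n)" for n t
  define K where "K = M * (b - a)"
  have Qb: "\<bar>Q n t\<bar> \<le> K" if t: "t \<in> {a..b}" for n t
  proof -
    have "norm (Q n t) \<le> integral {a..t} (\<lambda>_. M)"
      unfolding Q_def
      by (rule Henstock_Kurzweil_Integration.integral_norm_bound_integral)
        (use qi[of n] qb t in \<open>auto simp: absolutely_integrable_on_def intro: integrable_on_subinterval\<close>)
    also have "\<dots> \<le> K" using t M by (auto simp: K_def mult.commute intro: mult_left_mono)
    finally show ?thesis by simp
  qed
  have dP: "primitive_on a b (\<lambda>t. d n t * exp (- Q n t)) (\<lambda>s. exp (- Q n s) * r n s)" for n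
  proof -
    have "primitive_on a b (d n) (\<lambda>s. q n s * d n s + r n s)"
      unfolding d_def by (rule primitive_on_cong[OF primitive_on_diff_fun[OF W w]])
        (auto simp: q_def d_def r_def)
    from primitive_on_linear_ode[OF ab this qi] show ?thesis unfolding Q_def .
  qed
  have da: "d n a = 0" for n using Wa by (simp add: d_def)
  have dt: "d n t * exp (- Q n t) = integral {a..t} (\<lambda>s. exp (- Q n s) * r n s)" if "t \<in> {a..b}" for n t
    using primitive_on_diff[OF dP[of n], of a t] da that by simp
  have eri: "(\<lambda>s. exp (- Q n s) * r n s) integrable_on {a..b}" for n
    using dP[of n] by (simp add: primitive_on_def absolutely_integrable_on_def)
  have G0: "0 \<le> G s" if "s \<in> {a..b}" for s
  proof -
    have "0 \<le> \<epsilon> 0 * G s" using est[OF that, of 0] abs_ge_zero order_trans by blast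
    then show ?thesis using \<epsilon>(1)[of 0] by (simp add: zero_le_mult_iff)
  qed
  have erb: "\<bar>exp (- Q n s) * r n s\<bar> \<le> exp K * (\<epsilon> n * G s)" if s: "s \<in> {a..b}" for n s
  proof -
    have "exp (- Q n s) \<le> exp K" using Qb[OF s, of n] by auto
    then show ?thesis
      using est[OF s, of n] by (auto simp: abs_mult r_def intro!: mult_mono)
  qed
  \<comment> \<open>One factor exp K bounds the integrand, the other undoes the integrating factor
    on the left.\<close>
  have db: "\<bar>d n t\<bar> \<le> exp K * (exp K * (\<epsilon> n * integral {a..b} G))" if t: "t \<in> {a..b}" for n t
  proof -
    have "norm (integral {a..t} (\<lambda>s. exp (- Q n s) * r n s)) \<le> integral {a..t} (\<lambda>s. exp K * (\<epsilon> n * G s))"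
    proof (rule Henstock_Kurzweil_Integration.integral_norm_bound_integral)
      show "(\<lambda>s. exp (- Q n s) * r n s) integrable_on {a..t}"
        by (rule integrable_on_subinterval[OF eri]) (use t in auto)
      show "(\<lambda>s. exp K * (\<epsilon> n * G s)) integrable_on {a..t}"
        by (intro integrable_on_mult_right integrable_on_subinterval[OF G]) (use t in auto)
    qed (use erb t in auto)
    also have "\<dots> \<le> integral {a..b} (\<lambda>s. exp K * (\<epsilon> n * G s))"
    proof (rule integral_subset_le)
      show "(\<lambda>s. exp K * (\<epsilon> n * G s)) integrable_on {a..t}"
        by (intro integrable_on_mult_right integrable_on_subinterval[OF G]) (use t in auto)
      show "(\<lambda>s. exp K * (\<epsilon> n * G s)) integrable_on {a..b}" by (intro integrable_on_mult_right G)
    qed (use t G0 \<epsilon>(1)[of n] in auto)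
    also have "\<dots> = exp K * (\<epsilon> n * integral {a..b} G)" by simp
    finally have *: "\<bar>d n t * exp (- Q n t)\<bar> \<le> exp K * (\<epsilon> n * integral {a..b} G)"
      using dt[OF t] by simp
    have "\<bar>d n t\<bar> = exp (Q n t) * \<bar>d n t * exp (- Q n t)\<bar>"
      by (simp add: abs_mult exp_minus)
    also have "\<dots> \<le> exp K * (exp K * (\<epsilon> n * integral {a..b} G))"
      using Qb[OF t, of n] * by (intro mult_mono) auto
    finally show ?thesis .
  qed
  have "(\<lambda>n. exp K * (exp K * (\<epsilon> n * integral {a..b} G))) \<longlonglongrightarrow> exp K * (exp K * (0 * integral {a..b} G))"
    by (intro tendsto_intros \<epsilon>(2))
  then have elim: "(\<lambda>n. exp K * (exp K * (\<epsilon> n * integral {a..b} G))) \<longlonglongrightarrow> 0" by simp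
  have dlim: "(\<lambda>n. d n t) \<longlonglongrightarrow> 0" if "t \<in> {a..b}" for t
    by (rule Lim_null_comparison[OF always_eventually elim]) (use db[OF that] in simp)
  have qlim: "(\<lambda>n. q n s) \<longlonglongrightarrow> D s" if s: "s \<in> {a..b}" for s
  proof -
    \<comment> \<open>A choice of mean value points for all n, falling back to \<open>w s\<close>
      where the difference vanishes, so that the sequence tends to \<open>w s\<close> as
      \<open>lim_D\<close> requires.\<close>
    define P where "P n p \<longleftrightarrow> \<bar>p - w s\<bar> \<le> \<bar>d n s\<bar> \<and> (d n s \<noteq> 0 \<longrightarrow> q n s = Fp n s p)" for n p
    have "\<exists>p. P n p" for n
    proof (cases "d n s = 0")
      case True
      then show ?thesis by (intro exI[of _ "w s"]) (auto simp: P_def)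
    next
      case False
      then show ?thesis using mvt[OF s, of n] by (auto simp: P_def)
    qed
    then obtain p where p: "\<And>n. P n (p n)" by metis
    have "(\<lambda>n. p n - w s) \<longlonglongrightarrow> 0"
      by (rule Lim_null_comparison[OF always_eventually tendsto_rabs_zero[OF dlim[OF s]]])
        (use p in \<open>simp add: P_def\<close>)
    then have "(\<lambda>n. Fp n s (p n)) \<longlonglongrightarrow> D s" by (intro lim_D s) (simp add: LIM_zero_iff)
    then have *: "(\<lambda>n. norm (Fp n s (p n) - D s)) \<longlonglongrightarrow> 0" by (intro tendsto_norm_zero LIM_zero)
    have "\<forall>n. norm (q n s - D s) \<le> norm (Fp n s (p n) - D s)"
    proof
      show "norm (q n s - D s) \<le> norm (Fp n s (p n) - D s)" for n
        using p[of n] by (cases "d n s = 0") (auto simp: P_def q_def)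
    qed
    from Lim_null_comparison[OF always_eventually[OF this] *]
    have "(\<lambda>n. q n s - D s) \<longlonglongrightarrow> 0" .
    then show ?thesis by (rule LIM_zero_cancel)
  qed
  have Qlim: "(\<lambda>n. Q n t) \<longlonglongrightarrow> integral {a..t} D" if t: "t \<in> {a..b}" for t
    unfolding Q_def
  proof (rule dominated_convergence)
    show "q n integrable_on {a..t}" for n
      using qi[of n] t by (auto simp: absolutely_integrable_on_def intro: integrable_on_subinterval)
    show "(\<lambda>_. M) integrable_on {a..t}" by auto
  qed (use qb qlim t in auto)
  have "(\<lambda>n. integral {a..b} (\<lambda>s. exp (- Q n s) * (r n s / \<epsilon> n))) \<longlonglongrightarrow>
      integral {a..b} (\<lambda>s. exp (- integral {a..s} D) * \<rho> s)"
  proof (rule dominated_convergence)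
    show "(\<lambda>s. exp (- Q n s) * (r n s / \<epsilon> n)) integrable_on {a..b}" for n
      using integrable_on_divide[OF eri[of n], of "\<epsilon> n"] by simp
    show "(\<lambda>s. exp K * G s) integrable_on {a..b}" using G by (intro integrable_on_mult_right)
    show "norm (exp (- Q n s) * (r n s / \<epsilon> n)) \<le> exp K * G s" if "s \<in> {a..b}" for n s
      using erb[OF that, of n] \<epsilon>(1)[of n] by (simp add: abs_mult abs_divide divide_le_eq mult_ac)
    show "(\<lambda>n. exp (- Q n s) * (r n s / \<epsilon> n)) \<longlonglongrightarrow> exp (- integral {a..s} D) * \<rho> s" if "s \<in> {a..b}" for s
      using Qlim[OF that] lim_r[OF that] unfolding r_def by (intro tendsto_intros)
  qed
  moreover have "0 \<le> integral {a..b} (\<lambda>s. exp (- Q n s) * (r n s / \<epsilon> n))" for n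
  proof -
    have "0 \<le> d n b * exp (- Q n b)" using Wb[of n] by (simp add: d_def)
    then have "0 \<le> integral {a..b} (\<lambda>s. exp (- Q n s) * r n s) / \<epsilon> n" using dt[of b n] ab \<epsilon>(1)[of n] by simp
    then show ?thesis by simp
  qed
  ultimately show ?thesis by (intro LIMSEQ_le_const) auto
qed

section \<open>Lagrangians\<close>

text \<open>Expresses the partial derivatives, defined by \<open>deriv\<close> and
  \<open>THE\<close>, through the Frechet derivative. The sum over the basis gives continuity of
  \<open>L_v\<close>, the inner product form gives the chain rule.\<close>

lemma C1_lagrangian_derivative:
  fixes L :: "'n::finite lagrangian"
  assumes "C1_function L"
  obtains L' where "\<And>p. (L has_derivative blinfun_apply (L' p)) (at p)" "continuous_on UNIV L'"
    "\<And>p. L_t L p = L' p (1, 0, 0, 0)" "\<And>p. L_r L p = L' p (0, 0, 0, 1)"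
    "\<And>p. L_v L p = (\<Sum>k\<in>Basis. L' p (0, 0, k, 0) *\<^sub>R k)"
    "\<And>p z. L_v L p \<bullet> z = L' p (0, 0, z, 0)"
proof -
  obtain L' where D: "\<And>p. (L has_derivative blinfun_apply (L' p)) (at p)" and c: "continuous_on UNIV L'"
    using assms unfolding C1_function_def by blast
  have bl: "bounded_linear (blinfun_apply (L' p))" for p by (rule blinfun.bounded_linear_right)
  have t: "L_t L p = L' p (1, 0, 0, 0)" for p
  proof -
    obtain t x v r where p: "p = (t, x, v, r)" by (metis surj_pair)
    have "((\<lambda>\<tau>. (\<tau>, x, v, r)) has_derivative (\<lambda>h. (h, 0, 0, 0))) (at t)"
      by (intro has_derivative_Pair has_derivative_ident has_derivative_const)
    from has_derivative_compose[OF this D]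
    have "((\<lambda>\<tau>. L (\<tau>, x, v, r)) has_derivative (\<lambda>h. L' p (h, 0, 0, 0))) (at t)" by (simp add: p)
    moreover have "(\<lambda>h. L' p (h, 0, 0, 0)) = (*) (L' p (1, 0, 0, 0))"
    proof
      show "L' p (h, 0, 0, 0) = L' p (1, 0, 0, 0) * h" for h
        using blinfun.scaleR_right[of "L' p" h "(1,0,0,0)"] by (simp add: mult.commute)
    qed
    ultimately have "((\<lambda>\<tau>. L (\<tau>, x, v, r)) has_real_derivative L' p (1, 0, 0, 0)) (at t)"
      unfolding has_field_derivative_def by metis
    then show ?thesis by (simp add: L_t_def p DERIV_imp_deriv)
  qed
  have r: "L_r L p = L' p (0, 0, 0, 1)" for p
  proof -
    obtain t x v r where p: "p = (t, x, v, r)" by (metis surj_pair)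
    have "((\<lambda>\<rho>. (t, x, v, \<rho>)) has_derivative (\<lambda>h. (0, 0, 0, h))) (at r)"
      by (intro has_derivative_Pair has_derivative_ident has_derivative_const)
    from has_derivative_compose[OF this D]
    have "((\<lambda>\<rho>. L (t, x, v, \<rho>)) has_derivative (\<lambda>h. L' p (0, 0, 0, h))) (at r)" by (simp add: p)
    moreover have "(\<lambda>h. L' p (0, 0, 0, h)) = (*) (L' p (0, 0, 0, 1))"
    proof
      show "L' p (0, 0, 0, h) = L' p (0, 0, 0, 1) * h" for h
        using blinfun.scaleR_right[of "L' p" h "(0,0,0,1)"] by (simp add: mult.commute)
    qed
    ultimately have "((\<lambda>\<rho>. L (t, x, v, \<rho>)) has_real_derivative L' p (0, 0, 0, 1)) (at r)"
      unfolding has_field_derivative_def by metis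
    then show ?thesis by (simp add: L_r_def p DERIV_imp_deriv)
  qed
  define V where "V p = (\<Sum>k\<in>Basis. L' p (0, 0, k, 0) *\<^sub>R k)" for p
  have V: "V p \<bullet> z = L' p (0, 0, z, 0)" for p z
  proof -
    have lin: "linear (\<lambda>z. L' p (0, 0, z, 0))"
      by (intro linear_compose[of "\<lambda>z. (0, 0, z, 0)" "blinfun_apply (L' p)", unfolded o_def] bounded_linear.linear[OF bl])
        (auto intro!: linearI)
    have "L' p (0, 0, z, 0) = L' p (0, 0, \<Sum>k\<in>Basis. (z \<bullet> k) *\<^sub>R k, 0)" by (simp add: euclidean_representation)
    also have "\<dots> = (\<Sum>k\<in>Basis. (z \<bullet> k) * L' p (0, 0, k, 0))"
      using linear_sum[OF lin, of "\<lambda>k. (z \<bullet> k) *\<^sub>R k" Basis] linear_scale[OF lin] by simp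
    also have "\<dots> = V p \<bullet> z"
      unfolding V_def inner_sum_left by (intro sum.cong) (auto simp: inner_commute)
    finally show ?thesis by simp
  qed
  have v: "L_v L p = V p" for p
  proof -
    obtain t x v r where p: "p = (t, x, v, r)" by (metis surj_pair)
    have "((\<lambda>w. (t, x, w, r)) has_derivative (\<lambda>h. (0, 0, h, 0))) (at v)"
      by (intro has_derivative_Pair has_derivative_ident has_derivative_const)
    from has_derivative_compose[OF this D]
    have "((\<lambda>w. L (t, x, w, r)) has_derivative (\<lambda>h. L' p (0, 0, h, 0))) (at v)" by (simp add: p)
    then have g: "GDERIV (\<lambda>w. L (t, x, w, r)) v :> V p"
      by (simp add: gderiv_def V[symmetric] inner_commute)
    \<comment> \<open>Uniqueness of the gradient, which the description operator in
      \<open>L_v\<close> relies on.\<close>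
    have u: "D = V p" if "GDERIV (\<lambda>w. L (t, x, w, r)) v :> D" for D
    proof -
      have "(\<lambda>h. h \<bullet> D) = (\<lambda>h. h \<bullet> V p)"
        using that g unfolding gderiv_def by (rule has_derivative_unique)
      then show ?thesis by (meson vector_eq_ldot)
    qed
    have "L_v L p = (THE D. GDERIV (\<lambda>w. L (t, x, w, r)) v :> D)" by (simp add: L_v_def p)
    also have "\<dots> = V p" using g u by (rule the_equality)
    finally show ?thesis .
  qed
  show ?thesis using that[OF D c t r] v V by (simp add: V_def)
qed

context
  fixes L :: "'n::finite lagrangian"
  assumes C1: "C1_function L"
begin

lemma continuous_on_lagrangian: "continuous_on S L"
  by (rule C1_lagrangian_derivative[OF C1])
    (meson continuous_on_eq_continuous_at continuous_on_subset has_derivative_continuous open_UNIV subset_UNIV)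

lemma continuous_on_L_t: "continuous_on S (L_t L)"
  and continuous_on_L_r: "continuous_on S (L_r L)"
  and continuous_on_L_v: "continuous_on S (L_v L)"
proof -
  obtain L' :: "real \<times> (real ^ 'n) \<times> (real ^ 'n) \<times> real \<Rightarrow> (real \<times> (real ^ 'n) \<times> (real ^ 'n) \<times> real) \<Rightarrow>\<^sub>L real"
    where c: "continuous_on UNIV L'"
    and eq: "\<And>p. L_t L p = L' p (1, 0, 0, 0)" "\<And>p. L_r L p = L' p (0, 0, 0, 1)"
    "\<And>p. L_v L p = (\<Sum>k\<in>Basis. L' p (0, 0, k, 0) *\<^sub>R k)"
    by (rule C1_lagrangian_derivative[OF C1]) blast
  have "continuous_on S L'" using c continuous_on_subset by blast
  then show "continuous_on S (L_t L)" "continuous_on S (L_r L)" "continuous_on S (L_v L)"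
    unfolding eq[abs_def] by (auto intro!: continuous_intros)
qed

lemma DERIV_L_r: "((\<lambda>\<rho>. L (t, x, v, \<rho>)) has_real_derivative L_r L (t, x, v, r)) (at r)"
proof -
  obtain L' where D: "\<And>p. (L has_derivative blinfun_apply (L' p)) (at p)"
    and eq: "\<And>p. L_r L p = L' p (0, 0, 0, 1)"
    by (rule C1_lagrangian_derivative[OF C1]) blast
  have "((\<lambda>\<rho>. (t, x, v, \<rho>)) has_derivative (\<lambda>h. (0, 0, 0, h))) (at r)"
    by (intro has_derivative_Pair has_derivative_ident has_derivative_const)
  from has_derivative_compose[OF this D]
  have "((\<lambda>\<rho>. L (t, x, v, \<rho>)) has_derivative (\<lambda>h. L' (t, x, v, r) (0, 0, 0, h))) (at r)" by simp
  moreover have "(\<lambda>h. L' p (0, 0, 0, h)) = (*) (L' p (0, 0, 0, 1))" for p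
  proof
    show "L' p (0, 0, 0, h) = L' p (0, 0, 0, 1) * h" for h
      using blinfun.scaleR_right[of "L' p" h "(0,0,0,1)"] by (simp add: mult.commute)
  qed
  ultimately show ?thesis unfolding has_field_derivative_def eq by metis
qed

text \<open>Position and last variable are frozen because a reparametrization, seen in the old
  parameter, changes only the time and the velocity.\<close>

lemma DERIV_lagrangian_path:
  assumes \<gamma>: "(\<gamma> has_real_derivative c) (at e)" and \<zeta>: "(\<zeta> has_vector_derivative z) (at e)"
  shows "((\<lambda>e. L (\<gamma> e, x, \<zeta> e, r)) has_real_derivative
    c * L_t L (\<gamma> e, x, \<zeta> e, r) + L_v L (\<gamma> e, x, \<zeta> e, r) \<bullet> z) (at e)"
proof -
  obtain L' where D: "\<And>p. (L has_derivative blinfun_apply (L' p)) (at p)"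
    and eq: "\<And>p. L_t L p = L' p (1, 0, 0, 0)" "\<And>p z. L_v L p \<bullet> z = L' p (0, 0, z, 0)"
    by (rule C1_lagrangian_derivative[OF C1]) blast
  let ?p = "(\<gamma> e, x, \<zeta> e, r)"
  have "((\<lambda>e. (\<gamma> e, x, \<zeta> e, r)) has_derivative (\<lambda>h. (c * h, 0, h *\<^sub>R z, 0))) (at e)"
    using assms unfolding has_field_derivative_def has_vector_derivative_def
    by (intro has_derivative_Pair has_derivative_const)
  from has_derivative_compose[OF this D]
  have "((\<lambda>e. L (\<gamma> e, x, \<zeta> e, r)) has_derivative (\<lambda>h. L' ?p (c * h, 0, h *\<^sub>R z, 0))) (at e)" by simp
  moreover have "(\<lambda>h. L' ?p (c * h, 0, h *\<^sub>R z, 0)) = (*) (c * L_t L ?p + L_v L ?p \<bullet> z)"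
  proof
    fix h
    have "(c * h, 0::real^'n, h *\<^sub>R z, 0::real) = h *\<^sub>R (c *\<^sub>R (1, 0, 0, 0) + (0, 0, z, 0))" by simp
    then have "L' ?p (c * h, 0, h *\<^sub>R z, 0) = h *\<^sub>R (c *\<^sub>R L' ?p (1, 0, 0, 0) + L' ?p (0, 0, z, 0))"
      by (simp only: blinfun.scaleR_right blinfun.add_right)
    then show "L' ?p (c * h, 0, h *\<^sub>R z, 0) = (c * L_t L ?p + L_v L ?p \<bullet> z) * h" by (simp add: eq mult.commute)
  qed
  ultimately show ?thesis unfolding has_field_derivative_def by metis
qed

lemma DERIV_L_t: "((\<lambda>\<tau>. L (\<tau>, x, v, r)) has_real_derivative L_t L (t, x, v, r)) (at t)"
  using DERIV_lagrangian_path[OF DERIV_ident has_vector_derivative_const] by simp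

end

section \<open>Pointwise bounds from the growth conditions\<close>

lemma AE_continuous_le:
  fixes f g :: "real \<Rightarrow> real"
  assumes "a < b" and f: "continuous_on UNIV f" and ae: "AE t in lebesgue_on {a..b}. f t \<le> 0"
    and t: "t \<in> {a..b}"
  shows "f t \<le> 0"
proof -
  let ?U = "{t. f t > 0} \<inter> {a<..<b}"
  have "open ?U" using f by (intro open_Int open_Collect_less) auto
  moreover have "negligible ?U"
    using ae unfolding AE_lebesgue_on_iff_negligible by (rule negligible_subset) auto
  \<comment> \<open>A nonempty open set has positive measure, so only a and b remain; they are
    limits of interior points.\<close>
  ultimately have "?U = {}" using open_not_negligible by blast
  then have "f s \<in> {..0}" if "s \<in> {a<..<b}" for s using that by force
  then have "f ` closure {a<..<b} \<subseteq> {..0}"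
    by (intro image_closure_subset continuous_on_subset[OF f]) auto
  then have "f ` {a..b} \<subseteq> {..0}" using \<open>a < b\<close> by simp
  then show ?thesis using t by blast
qed

lemma nonneg_Linf_loc_bound:
  assumes "nonneg_Linf_loc c"
  obtains M where "M \<ge> 0" "AE t in lebesgue_on {a..b::real}. c t \<le> M"
proof -
  obtain M where "AE t in lebesgue_on {a..b}. c t \<le> M"
    using assms compact_Icc[of a b] unfolding nonneg_Linf_loc_def by blast
  then have "AE t in lebesgue_on {a..b}. c t \<le> max M 0" by (rule eventually_mono) simp
  then show ?thesis using that[of "max M 0"] by simp
qed

text \<open>The coefficients in \<open>cond_L3\<close> and \<open>cond_L4\<close> are only
  essentially bounded. For fixed (x, v, r) continuity in t upgrades the almost everywhere bound to
  every t, with M independent of (x, v, r). This makes it usable at the shifted times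
  \<tau>(s).\<close>

lemma lagrangian_uniform_bounds:
  assumes C1: "C1_function L" and "cond_L3 L" "cond_L4 L" "a < b"
  obtains M where "M \<ge> 0" "\<And>t x v r. t \<in> {a..b} \<Longrightarrow> \<bar>L_r L (t, x, v, r)\<bar> \<le> M"
    "\<And>t x v r. t \<in> {a..b} \<Longrightarrow> \<bar>L_t L (t, x, v, r)\<bar> \<le> M * (1 + \<bar>L (t, x, v, r)\<bar>)"
proof -
  obtain K where "nonneg_Linf_loc K" and K: "\<And>t x v r. \<bar>L_r L (t, x, v, r)\<bar> \<le> K t"
    using \<open>cond_L3 L\<close> unfolding cond_L3_def by blast
  then obtain M0 where M0: "M0 \<ge> 0" "AE t in lebesgue_on {a..b}. K t \<le> M0" using nonneg_Linf_loc_bound by blast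
  obtain C\<^sub>1 C\<^sub>2 where "nonneg_Linf_loc C\<^sub>1" and C2: "nonneg_Linf_loc C\<^sub>2"
    and C: "\<And>t x v r. \<bar>L_t L (t, x, v, r)\<bar> \<le> C\<^sub>1 t + C\<^sub>2 t * L (t, x, v, r)"
    using \<open>cond_L4 L\<close> unfolding cond_L4_def by blast
  then obtain M1 M2 where M1: "M1 \<ge> 0" "AE t in lebesgue_on {a..b}. C\<^sub>1 t \<le> M1"
    and M2: "M2 \<ge> 0" "AE t in lebesgue_on {a..b}. C\<^sub>2 t \<le> M2" using nonneg_Linf_loc_bound by metis
  define M where "M = max M0 (max M1 M2)"
  have M: "M \<ge> 0" "M0 \<le> M" "M1 \<le> M" "M2 \<le> M" using M0(1) by (auto simp: M_def)
  have c: "continuous_on UNIV (\<lambda>t. \<Phi> (t, x, v, r))" if "continuous_on UNIV \<Phi>"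
    for \<Phi> :: "'a lagrangian" and x v r
    by (rule continuous_on_compose2[OF that]) (auto intro!: continuous_intros)
  have "\<bar>L_r L (t, x, v, r)\<bar> \<le> M" if t: "t \<in> {a..b}" for t x v r
  proof -
    have "\<bar>L_r L (t, x, v, r)\<bar> - M \<le> 0"
    proof (rule AE_continuous_le[OF \<open>a < b\<close> _ _ t])
      show "continuous_on UNIV (\<lambda>t. \<bar>L_r L (t, x, v, r)\<bar> - M)"
        by (intro continuous_intros c continuous_on_L_r[OF C1])
      show "AE t in lebesgue_on {a..b}. \<bar>L_r L (t, x, v, r)\<bar> - M \<le> 0"
        using M0(2)
      proof eventually_elim
        case (elim t)
        then show ?case using K[of t x v r] M by linarith
      qed
    qed
    then show ?thesis by simp
  qed
  moreover have "\<bar>L_t L (t, x, v, r)\<bar> \<le> M * (1 + \<bar>L (t, x, v, r)\<bar>)" if t: "t \<in> {a..b}" for t x v r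
  proof -
    have "\<bar>L_t L (t, x, v, r)\<bar> - M * (1 + \<bar>L (t, x, v, r)\<bar>) \<le> 0"
    proof (rule AE_continuous_le[OF \<open>a < b\<close> _ _ t])
      show "continuous_on UNIV (\<lambda>t. \<bar>L_t L (t, x, v, r)\<bar> - M * (1 + \<bar>L (t, x, v, r)\<bar>))"
        by (intro continuous_intros c continuous_on_L_t[OF C1] continuous_on_lagrangian[OF C1])
      show "AE t in lebesgue_on {a..b}. \<bar>L_t L (t, x, v, r)\<bar> - M * (1 + \<bar>L (t, x, v, r)\<bar>) \<le> 0"
        using M1(2) M2(2)
      proof eventually_elim
        case (elim t)
        have "0 \<le> C\<^sub>2 t" using C2 unfolding nonneg_Linf_loc_def by blast
        then have "C\<^sub>2 t * L (t, x, v, r) \<le> C\<^sub>2 t * \<bar>L (t, x, v, r)\<bar>" by (intro mult_left_mono) auto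
        also have "\<dots> \<le> M * \<bar>L (t, x, v, r)\<bar>" using elim M by (intro mult_right_mono) auto
        finally show ?case using C[of t x v r] elim M by (simp add: distrib_left)
      qed
    qed
    then show ?thesis by simp
  qed
  ultimately show ?thesis using that M(1) by blast
qed

text \<open>Gronwall's inequality in the time variable, for the smooth majorant \<open>ln (1 + f\<^sup>2)\<close> of
  \<open>2 ln \<bar>f\<bar>\<close>.\<close>

lemma gronwall_growth:
  fixes f f' :: "real \<Rightarrow> real"
  assumes M: "M \<ge> 0" and der: "\<And>t. t \<in> {a..b} \<Longrightarrow> (f has_real_derivative f' t) (at t)"
    and bnd: "\<And>t. t \<in> {a..b} \<Longrightarrow> \<bar>f' t\<bar> \<le> M * (1 + \<bar>f t\<bar>)"
    and t: "s \<in> {a..b}" "t \<in> {a..b}"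
  shows "\<bar>f t\<bar> \<le> exp (3 * M * (b - a)) * (1 + \<bar>f s\<bar>)"
proof -
  have pos: "1 + (f t)\<^sup>2 > 0" for t using zero_le_power2[of "f t"] by linarith
  have "norm (ln (1 + (f t)\<^sup>2) - ln (1 + (f s)\<^sup>2)) \<le> (3 * M) * norm (t - s)"
  proof (rule field_differentiable_bound[of "{a..b}"])
    fix z assume z: "z \<in> {a..b}"
    have "((\<lambda>t. ln (1 + (f t)\<^sup>2)) has_real_derivative (2 * f z * f' z) / (1 + (f z)\<^sup>2)) (at z)"
      by (auto intro!: derivative_eq_intros der[OF z] simp: pos field_simps)
    then show "((\<lambda>t. ln (1 + (f t)\<^sup>2)) has_field_derivative (2 * f z * f' z) / (1 + (f z)\<^sup>2)) (at z within {a..b})"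
      by (rule has_field_derivative_at_within)
    \<comment> \<open>Origin of the constant 3: by this inequality 2 |f| (1 + |f|) is at most 3 (1 +
      f^2).\<close>
    have q: "2 * \<bar>f z\<bar> \<le> 1 + (f z)\<^sup>2"
      using zero_le_power2[of "\<bar>f z\<bar> - 1"] by (simp add: power2_eq_square algebra_simps)
    have "\<bar>2 * f z * f' z\<bar> \<le> 2 * \<bar>f z\<bar> * (M * (1 + \<bar>f z\<bar>))"
      unfolding abs_mult using bnd[OF z] by (intro mult_mono) auto
    also have "\<dots> = M * (2 * \<bar>f z\<bar> + 2 * (f z)\<^sup>2)" by (simp add: algebra_simps power2_eq_square)
    also have "\<dots> \<le> M * (3 * (1 + (f z)\<^sup>2))" using q M by (intro mult_left_mono) auto
    finally show "norm (2 * f z * f' z / (1 + (f z)\<^sup>2)) \<le> 3 * M"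
      using pos[of z] by (simp add: abs_divide divide_le_eq mult_ac)
  qed (use t in auto)
  also have "\<dots> \<le> 3 * M * (b - a)" using t M by (intro mult_left_mono) auto
  finally have "ln (1 + (f t)\<^sup>2) \<le> 3 * M * (b - a) + ln (1 + (f s)\<^sup>2)" by (simp add: abs_le_iff)
  then have "exp (ln (1 + (f t)\<^sup>2)) \<le> exp (3 * M * (b - a) + ln (1 + (f s)\<^sup>2))" by simp
  then have le: "1 + (f t)\<^sup>2 \<le> exp (3 * M * (b - a)) * (1 + (f s)\<^sup>2)" using pos by (simp add: exp_add)
  define C where "C = exp (3 * M * (b - a))"
  have "1 \<le> C" using M t by (simp add: C_def)
  have "(f t)\<^sup>2 \<le> C * (1 + (f s)\<^sup>2)" using le by (simp add: C_def)
  also have "\<dots> \<le> C * (1 + \<bar>f s\<bar>)\<^sup>2" using \<open>1 \<le> C\<close> by (intro mult_left_mono) (auto simp: power2_eq_square algebra_simps)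
  \<comment> \<open>Since C \<ge> 1, squaring it only weakens the bound and makes the right-hand
    side a perfect square.\<close>
  also have "\<dots> \<le> C\<^sup>2 * (1 + \<bar>f s\<bar>)\<^sup>2"
    using \<open>1 \<le> C\<close> by (intro mult_right_mono) (auto simp: power2_eq_square)
  finally have "\<bar>f t\<bar>\<^sup>2 \<le> (C * (1 + \<bar>f s\<bar>))\<^sup>2" by (simp add: power_mult_distrib)
  then show ?thesis unfolding C_def by (rule power2_le_imp_le) simp
qed

section \<open>The first variation\<close>

text \<open>Minimality is stated through endpoint values, in accordance with \<open>J_eq\<close>.
  The curve v is any density of \<xi>, not necessarily its pointwise derivative.\<close>

locale herglotz_curve =
  fixes L :: "'n::finite lagrangian" and a b M :: real
    and \<xi> v :: "real \<Rightarrow> real ^ 'n" and w :: "real \<Rightarrow> real"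
  assumes C1: "C1_function L" and ab: "a < b" and M0: "M \<ge> 0"
    and L_r_bound: "\<And>t x v r. t \<in> {a..b} \<Longrightarrow> \<bar>L_r L (t, x, v, r)\<bar> \<le> M"
    and L_t_bound: "\<And>t x v r. t \<in> {a..b} \<Longrightarrow> \<bar>L_t L (t, x, v, r)\<bar> \<le> M * (1 + \<bar>L (t, x, v, r)\<bar>)"
    and \<xi>: "primitive_on a b \<xi> v"
    and w: "primitive_on a b w (\<lambda>s. L (s, \<xi> s, v s, w s))"
    and minimal: "\<And>\<eta> W. \<eta> \<in> Gamma a b (\<xi> a) (\<xi> b) \<Longrightarrow> herglotz_solution L a b (w a) \<eta> W \<Longrightarrow> w b \<le> W b"
begin

lemma v_integrable: "v absolutely_integrable_on {a..b}"
  using \<xi> by (simp add: primitive_on_def)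

lemma L_integrable: "(\<lambda>s. L (s, \<xi> s, v s, w s)) absolutely_integrable_on {a..b}"
  using w by (simp add: primitive_on_def)

lemma v_measurable: "v \<in> borel_measurable (lebesgue_on {a..b})"
  using v_integrable by (rule absolutely_integrable_imp_borel_measurable) simp

lemma \<xi>_measurable: "\<xi> \<in> borel_measurable (lebesgue_on {a..b})"
  by (rule continuous_imp_measurable_on_sets_lebesgue[OF primitive_on_continuous[OF \<xi>]]) simp

lemma w_measurable: "w \<in> borel_measurable (lebesgue_on {a..b})"
  by (rule continuous_imp_measurable_on_sets_lebesgue[OF primitive_on_continuous[OF w]]) simp

lemma measurable_lagrangian_comp:
  fixes \<Phi> :: "real \<times> (real ^ 'n) \<times> (real ^ 'n) \<times> real \<Rightarrow> 'b::euclidean_space"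
  assumes "continuous_on UNIV \<Phi>"
    and "f1 \<in> borel_measurable (lebesgue_on {a..b})" "f2 \<in> borel_measurable (lebesgue_on {a..b})"
    and "f3 \<in> borel_measurable (lebesgue_on {a..b})" "f4 \<in> borel_measurable (lebesgue_on {a..b})"
  shows "(\<lambda>s. \<Phi> (f1 s, f2 s, f3 s, f4 s)) \<in> borel_measurable (lebesgue_on {a..b})"
  by (rule borel_measurable_continuous_on[OF assms(1)]) (intro borel_measurable_Pair assms)

lemma id_measurable: "(\<lambda>s::real. s) \<in> borel_measurable (lebesgue_on {a..b})"
  by (rule continuous_imp_measurable_on_sets_lebesgue) (auto intro: continuous_on_id)

lemma time_change_minimal:
  assumes tc: "time_change a b \<alpha>"
    and W: "primitive_on a b W (\<lambda>s. \<alpha> s * L (time_change.\<tau> a \<alpha> s, \<xi> s, v s /\<^sub>R \<alpha> s, W s))"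
    and Wa: "W a = w a"
  shows "w b \<le> W b"
proof -
  interpret tc: time_change a b \<alpha> by (rule tc)
  define \<eta> where "\<eta> t = \<xi> (tc.\<sigma> t)" for t
  define \<omega> where "\<omega> t = W (tc.\<sigma> t)" for t
  have \<eta>: "primitive_on a b \<eta> (\<lambda>t. v (tc.\<sigma> t) /\<^sub>R \<alpha> (tc.\<sigma> t))"
    unfolding \<eta>_def by (rule tc.primitive_on_compose_\<sigma>[OF \<xi>])
  have ab': "a \<le> b" using ab by simp
  have "\<eta> \<in> Gamma a b (\<xi> a) (\<xi> b)"
    using primitive_on_imp_W11[OF ab' \<eta>] by (simp add: Gamma_def \<eta>_def tc.\<sigma>_a tc.\<sigma>_b)
  moreover have "herglotz_solution L a b (w a) \<eta> \<omega>"
    unfolding herglotz_solution_def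
  proof (intro conjI)
    have "primitive_on a b \<omega> (\<lambda>t. L (t, \<eta> t, v (tc.\<sigma> t) /\<^sub>R \<alpha> (tc.\<sigma> t), \<omega> t))"
      unfolding \<omega>_def
    proof (rule primitive_on_cong[OF tc.primitive_on_compose_\<sigma>_real[OF W]])
      fix t assume t: "t \<in> {a..b}"
      then have "\<alpha> (tc.\<sigma> t) \<noteq> 0" using tc.\<alpha>_bounds[OF tc.\<sigma>_mem[OF t]] by auto
      then show "\<alpha> (tc.\<sigma> t) * L (tc.\<tau> (tc.\<sigma> t), \<xi> (tc.\<sigma> t), v (tc.\<sigma> t) /\<^sub>R \<alpha> (tc.\<sigma> t), W (tc.\<sigma> t)) / \<alpha> (tc.\<sigma> t)
        = L (t, \<eta> t, v (tc.\<sigma> t) /\<^sub>R \<alpha> (tc.\<sigma> t), W (tc.\<sigma> t))"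
        by (simp add: tc.\<tau>_\<sigma>[OF t] \<eta>_def)
    qed
    then have \<omega>: "abs_continuous_on a b \<omega>"
      "AE t in lebesgue_on {a..b}. (\<omega> has_real_derivative L (t, \<eta> t, v (tc.\<sigma> t) /\<^sub>R \<alpha> (tc.\<sigma> t), \<omega> t)) (at t)"
      unfolding primitive_on_iff_abs_continuous[OF ab'] by auto
    show "abs_continuous_on a b \<omega>" by (rule \<omega>(1))
    show "\<omega> a = w a" by (simp add: \<omega>_def tc.\<sigma>_a Wa)
    \<comment> \<open>\<open>lift\<close> uses the pointwise derivative of \<eta>, which agrees with
      the density \<open>v (\<sigma> t) / \<alpha> (\<sigma> t)\<close> almost everywhere.\<close>
    show "AE s in lebesgue_on {a..b}. (\<omega> has_real_derivative L (lift \<eta> \<omega> s)) (at s)"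
      using \<omega>(2) primitive_on_AE_vector_derivative[OF \<eta>]
      by eventually_elim (simp add: lift_def vector_derivative_at)
  qed
  ultimately have "w b \<le> \<omega> b" by (rule minimal)
  then show ?thesis by (simp add: \<omega>_def tc.\<sigma>_b)
qed

text \<open>Compares L at two times with all other arguments equal. It provides the integrable
  majorant at points where h vanishes and only the time is shifted, however large the velocity is
  there.\<close>

lemma L_growth:
  assumes "s \<in> {a..b}" "t \<in> {a..b}"
  shows "\<bar>L (t, x, z, r)\<bar> \<le> exp (3 * M * (b - a)) * (1 + \<bar>L (s, x, z, r)\<bar>)"
  by (rule gronwall_growth[where f'="\<lambda>t. L_t L (t, x, z, r)"])
    (use M0 L_t_bound assms in \<open>auto intro: DERIV_L_t[OF C1]\<close>)

text \<open>First variation along the time changes \<open>\<tau>(s) = s + \<epsilon> \<integral>\<^sub>a\<^sup>s h\<close>. Since \<open>h\<close> lives on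
  \<open>{\<bar>v\<bar> \<le> R}\<close>, the velocity \<open>v / (1 + \<epsilon> h)\<close> differs from \<open>v\<close> only where \<open>v\<close> is bounded, so
  no growth comparison of \<open>L\<close> between different large velocities is needed.\<close>

lemma first_variation:
  assumes hm: "h \<in> borel_measurable (lebesgue_on {a..b})"
    and hB: "\<And>s. s \<in> {a..b} \<Longrightarrow> \<bar>h s\<bar> \<le> B"
    and hR: "\<And>s. s \<in> {a..b} \<Longrightarrow> h s \<noteq> 0 \<Longrightarrow> norm (v s) \<le> R"
    and h0: "integral {a..b} h = 0"
  shows "0 \<le> integral {a..b} (\<lambda>s. exp (- integral {a..s} (\<lambda>r. L_r L (r, \<xi> r, v r, w r))) *
      (h s * (L (s, \<xi> s, v s, w s) - L_v L (s, \<xi> s, v s, w s) \<bullet> v s)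
        + integral {a..s} h * L_t L (s, \<xi> s, v s, w s)))"
proof -
  have B0: "B \<ge> 0" using hB[of a] ab by (auto intro: order_trans[OF abs_ge_zero])
  define H where "H s = integral {a..s} h" for s
  have hi: "h absolutely_integrable_on {a..b}"
    by (rule measurable_bounded_by_integrable_imp_absolutely_integrable[where g="\<lambda>_. B"]) (use hm hB in auto)
  have hsub: "h integrable_on {a..s}" if "s \<in> {a..b}" for s
    using hi that by (auto simp: absolutely_integrable_on_def intro: integrable_on_subinterval)
  have Hb: "\<bar>H s\<bar> \<le> B * (b - a)" if s: "s \<in> {a..b}" for s
  proof -
    have "norm (H s) \<le> integral {a..s} (\<lambda>_. B)"
      unfolding H_def by (rule Henstock_Kurzweil_Integration.integral_norm_bound_integral) (use hsub[OF s] hB s in auto)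
    also have "\<dots> \<le> B * (b - a)" using s B0 by (auto simp: mult.commute intro: mult_left_mono)
    finally show ?thesis by simp
  qed
  \<comment> \<open>For e up to e0 the product e h stays within 1/2 in modulus, hence the bounds 1/2
    and 3/2 in \<open>time_change\<close>; B + 1 guards against B = 0.\<close>
  define e0 where "e0 = 1 / (2 * (B + 1))"
  have e0: "e0 > 0" "e0 * B \<le> 1/2" using B0 by (auto simp: e0_def field_simps)
  have eh: "\<bar>e * h s\<bar> \<le> 1/2" if "0 \<le> e" "e \<le> e0" "s \<in> {a..b}" for e s
  proof -
    have "\<bar>e * h s\<bar> \<le> e0 * B" using that hB e0 by (simp add: abs_mult mult_mono)
    then show ?thesis using e0 by simp
  qed
  define \<alpha> where "\<alpha> e s = 1 + e * h s" for e s
  have \<alpha>b: "1/2 \<le> \<alpha> e s" "\<alpha> e s \<le> 3/2" if "0 \<le> e" "e \<le> e0" "s \<in> {a..b}" for e s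
    using eh[OF that] unfolding \<alpha>_def by (simp_all add: abs_le_iff)
  have \<alpha>i: "integral {a..s} (\<alpha> e) = (s - a) + e * H s" if "s \<in> {a..b}" for e s
  proof -
    have "integral {a..s} (\<alpha> e) = integral {a..s} (\<lambda>_. 1) + integral {a..s} (\<lambda>r. e * h r)"
      unfolding \<alpha>_def using hsub[OF that]
      by (intro Henstock_Kurzweil_Integration.integral_add integrable_on_mult_right) auto
    then show ?thesis using that by (simp add: H_def)
  qed
  have tc: "time_change a b (\<alpha> e)" if "0 \<le> e" "e \<le> e0" for e
  proof
    show "\<alpha> e \<in> borel_measurable (lebesgue_on {a..b})" unfolding \<alpha>_def using hm by measurable
    show "integral {a..b} (\<alpha> e) = b - a" using \<alpha>i[of b e] h0 ab by (simp add: H_def)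
  qed (use ab \<alpha>b[OF that] in auto)
  have \<tau>: "time_change.\<tau> a (\<alpha> e) s = s + e * H s" if "0 \<le> e" "e \<le> e0" "s \<in> {a..b}" for e s
    using \<alpha>i[OF that(3)] by (simp add: time_change.\<tau>_def[OF tc[OF that(1,2)]])
  have \<tau>m: "s + e * H s \<in> {a..b}" if "0 \<le> e" "e \<le> e0" "s \<in> {a..b}" for e s
    using time_change.\<tau>_mem[OF tc[OF that(1,2)] that(3)] \<tau>[OF that] by simp
  \<comment> \<open>The last slot is frozen at w; the response of the solution to the perturbation
    is left to \<open>perturbation_inequality\<close>.\<close>
  define P where "P e s = (s + e * H s, \<xi> s, v s /\<^sub>R \<alpha> e s, w s)" for e s
  define k where "k s e = \<alpha> e s * L (P e s)" for s e
  \<comment> \<open>Derivative of k in e. The velocity v / \<alpha> contributes - h v / \<alpha>^2,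
    and the outer factor \<alpha> cancels one power.\<close>
  define k' where "k' s e = h s * L (P e s) + \<alpha> e s * (H s * L_t L (P e s)) - h s / \<alpha> e s * (L_v L (P e s) \<bullet> v s)" for s e
  have kder: "(k s has_real_derivative k' s e) (at e)" if "\<alpha> e s \<noteq> 0" for s e
  proof -
    have 1: "((\<lambda>e. s + e * H s) has_real_derivative H s) (at e)" by (auto intro!: derivative_eq_intros)
    have "((\<lambda>e. inverse (\<alpha> e s)) has_real_derivative - (h s / (\<alpha> e s)\<^sup>2)) (at e)"
      using that unfolding \<alpha>_def by (auto intro!: derivative_eq_intros simp: power2_eq_square divide_inverse)
    then have 2: "((\<lambda>e. v s /\<^sub>R \<alpha> e s) has_vector_derivative - (h s / (\<alpha> e s)\<^sup>2) *\<^sub>R v s) (at e)"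
      by (intro has_vector_derivative_scaleR[OF _ has_vector_derivative_const, THEN has_vector_derivative_eq_rhs]) auto
    have "((\<lambda>e. \<alpha> e s) has_real_derivative h s) (at e)" unfolding \<alpha>_def by (auto intro!: derivative_eq_intros)
    from DERIV_mult[OF this DERIV_lagrangian_path[OF C1 1 2, of "\<xi> s" "w s"]]
    show ?thesis
      unfolding k_def[abs_def] P_def[symmetric]
      by (rule DERIV_cong) (use that in \<open>simp add: k'_def P_def power2_eq_square field_simps\<close>)
  qed
  have k0: "k s 0 = L (s, \<xi> s, v s, w s)" for s by (simp add: k_def P_def \<alpha>_def)
  obtain N where N: "N \<ge> 0" "\<And>e s. 0 \<le> e \<Longrightarrow> e \<le> e0 \<Longrightarrow> s \<in> {a..b} \<Longrightarrow> norm (v s) \<le> R \<Longrightarrow>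
      \<bar>L (P e s)\<bar> \<le> N \<and> norm (L_v L (P e s)) \<le> N"
  proof -
    \<comment> \<open>Radius 2 R because 1 / \<alpha> \<le> 2; the shifted times stay in [a,b] by
      \<open>\<tau>m\<close>.\<close>
    let ?K = "{a..b} \<times> \<xi> ` {a..b} \<times> (cball 0 (2 * R) :: (real ^ 'n) set) \<times> w ` {a..b}"
    have K: "compact ?K"
      using primitive_on_continuous[OF \<xi>] primitive_on_continuous[OF w]
      by (intro compact_Times compact_continuous_image) auto
    have "bounded (L ` ?K)" "bounded (L_v L ` ?K)"
      by (intro compact_imp_bounded compact_continuous_image K continuous_on_lagrangian[OF C1] continuous_on_L_v[OF C1])+
    then obtain N1 N2 where N12: "\<forall>x\<in>L ` ?K. norm x \<le> N1" "\<forall>x\<in>L_v L ` ?K. norm x \<le> N2"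
      unfolding bounded_iff by blast
    have PK: "P e s \<in> ?K" if "0 \<le> e" "e \<le> e0" "s \<in> {a..b}" "norm (v s) \<le> R" for e s
    proof -
      have "inverse (\<alpha> e s) \<le> 2" "0 \<le> inverse (\<alpha> e s)"
        using \<alpha>b(1)[OF that(1-3)] le_imp_inverse_le[of "1/2" "\<alpha> e s"] by simp_all
      then have "norm (v s /\<^sub>R \<alpha> e s) \<le> 2 * norm (v s)" by (simp add: mult_right_mono)
      also have "\<dots> \<le> 2 * R" using that(4) by simp
      finally have "v s /\<^sub>R \<alpha> e s \<in> cball 0 (2 * R)" by simp
      then show ?thesis using \<tau>m[OF that(1-3)] that(3) unfolding P_def by blast
    qed
    show ?thesis
    proof (rule that[of "max 0 (max N1 N2)"])
      fix e s assume "0 \<le> e" "e \<le> e0" "s \<in> {a..b}" "norm (v s) \<le> R"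
      then have PK': "P e s \<in> ?K" by (rule PK)
      have "norm (L (P e s)) \<le> N1" "norm (L_v L (P e s)) \<le> N2"
        using bspec[OF N12(1) imageI[OF PK']] bspec[OF N12(2) imageI[OF PK']] .
      then show "\<bar>L (P e s)\<bar> \<le> max 0 (max N1 N2) \<and> norm (L_v L (P e s)) \<le> max 0 (max N1 N2)" by auto
    qed simp
  qed
  define C where "C = exp (3 * M * (b - a))"
  \<comment> \<open>\<open>G1\<close> bounds the three terms of k' where h is nonzero, so that |v|
    \<le> R. The extra term in G covers h = 0: there only H L_t survives, bounded by
    \<open>L_growth\<close> through the value of L on the original curve.\<close>
  define G1 where "G1 = B * N + 3/2 * (B * (b - a) * (M * (1 + N))) + 2 * B * (N * \<bar>R\<bar>)"
  define G where "G s = G1 + B * (b - a) * (M * (1 + C * (1 + \<bar>L (s, \<xi> s, v s, w s)\<bar>)))" for s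
  have Bba: "0 \<le> B * (b - a)" using B0 ab by simp
  have G1: "0 \<le> G1" using B0 N(1) M0 ab unfolding G1_def by (intro add_nonneg_nonneg mult_nonneg_nonneg) auto
  have k'b: "\<bar>k' s e\<bar> \<le> G s" if e: "0 \<le> e" "e \<le> e0" and s: "s \<in> {a..b}" for e s
  proof -
    have tb: "\<bar>H s * L_t L (P e s)\<bar> \<le> B * (b - a) * (M * (1 + \<bar>L (P e s)\<bar>))"
      unfolding abs_mult using Hb[OF s] L_t_bound[OF \<tau>m[OF e s]] Bba by (intro mult_mono) (auto simp: P_def)
    have G2: "0 \<le> B * (b - a) * (M * (1 + C * (1 + \<bar>L (s, \<xi> s, v s, w s)\<bar>)))"
      using B0 ab M0 by (intro mult_nonneg_nonneg add_nonneg_nonneg) (auto simp: C_def)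
    show ?thesis
    proof (cases "h s = 0")
      case True
      have "P e s = (s + e * H s, \<xi> s, v s, w s)" using True by (simp add: P_def \<alpha>_def)
      then have "\<bar>L (P e s)\<bar> \<le> C * (1 + \<bar>L (s, \<xi> s, v s, w s)\<bar>)"
        using L_growth[OF s \<tau>m[OF e s]] by (simp add: C_def)
      then have "B * (b - a) * (M * (1 + \<bar>L (P e s)\<bar>)) \<le> B * (b - a) * (M * (1 + C * (1 + \<bar>L (s, \<xi> s, v s, w s)\<bar>)))"
        using Bba M0 by (intro mult_left_mono) auto
      moreover have "k' s e = H s * L_t L (P e s)" using True by (simp add: k'_def \<alpha>_def)
      ultimately show ?thesis using tb G1 by (simp add: G_def)
    next
      case False
      have n: "norm (v s) \<le> R" using hR[OF s False] .
      have LN: "\<bar>L (P e s)\<bar> \<le> N" "norm (L_v L (P e s)) \<le> N" using N(2)[OF e s n] by auto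
      have \<alpha>: "1/2 \<le> \<alpha> e s" "\<alpha> e s \<le> 3/2" using \<alpha>b[OF e s] by auto
      have 1: "\<bar>h s * L (P e s)\<bar> \<le> B * N"
        unfolding abs_mult using hB[OF s] LN B0 by (intro mult_mono) auto
      have "B * (b - a) * (M * (1 + \<bar>L (P e s)\<bar>)) \<le> B * (b - a) * (M * (1 + N))"
        using Bba M0 LN by (intro mult_left_mono) auto
      then have 2: "\<bar>\<alpha> e s * (H s * L_t L (P e s))\<bar> \<le> 3/2 * (B * (b - a) * (M * (1 + N)))"
        unfolding abs_mult[of "\<alpha> e s"] using tb \<alpha> by (intro mult_mono) auto
      have "\<bar>L_v L (P e s) \<bullet> v s\<bar> \<le> N * \<bar>R\<bar>"
        by (rule order_trans[OF Cauchy_Schwarz_ineq2]) (use LN n N(1) in \<open>auto intro!: mult_mono\<close>)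
      moreover have "\<bar>h s / \<alpha> e s\<bar> \<le> 2 * B"
      proof -
        have "\<bar>h s / \<alpha> e s\<bar> = \<bar>h s\<bar> / \<alpha> e s" using \<alpha> by (simp add: abs_divide)
        also have "\<dots> \<le> \<bar>h s\<bar> / (1/2)" using \<alpha> by (intro divide_left_mono) auto
        finally show ?thesis using hB[OF s] by simp
      qed
      ultimately have 3: "\<bar>h s / \<alpha> e s * (L_v L (P e s) \<bullet> v s)\<bar> \<le> 2 * B * (N * \<bar>R\<bar>)"
        unfolding abs_mult[of "h s / \<alpha> e s"] using B0 by (intro mult_mono) auto
      have "\<bar>k' s e\<bar> \<le> G1" using 1 2 3 unfolding k'_def G1_def by linarith
      then show ?thesis using G2 by (simp add: G_def)
    qed
  qed
  define \<epsilon> where "\<epsilon> n = e0 / real (Suc n)" for n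
  have \<epsilon>: "\<epsilon> n > 0" "0 \<le> \<epsilon> n" "\<epsilon> n \<le> e0" for n using e0(1) by (auto simp: \<epsilon>_def field_simps)
  have \<epsilon>lim: "\<epsilon> \<longlonglongrightarrow> 0" unfolding \<epsilon>_def by (rule LIMSEQ_Suc[OF lim_const_over_n])
  define F where "F n s p = \<alpha> (\<epsilon> n) s * L (s + \<epsilon> n * H s, \<xi> s, v s /\<^sub>R \<alpha> (\<epsilon> n) s, p)" for n s p
  define Fp where "Fp n s p = \<alpha> (\<epsilon> n) s * L_r L (s + \<epsilon> n * H s, \<xi> s, v s /\<^sub>R \<alpha> (\<epsilon> n) s, p)" for n s p
  have Fk: "F n s (w s) = k s (\<epsilon> n)" for n s by (simp add: F_def k_def P_def)
  have est: "\<bar>F n s (w s) - L (s, \<xi> s, v s, w s)\<bar> \<le> \<epsilon> n * G s" if s: "s \<in> {a..b}" for n s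
  proof -
    have "norm (k s (\<epsilon> n) - k s 0) \<le> G s * norm (\<epsilon> n - 0)"
    proof (rule field_differentiable_bound[of "{0..\<epsilon> n}"])
      fix z assume z: "z \<in> {0..\<epsilon> n}"
      then have z': "0 \<le> z" "z \<le> e0" using \<epsilon>(3)[of n] by auto
      show "(k s has_field_derivative k' s z) (at z within {0..\<epsilon> n})"
        by (rule has_field_derivative_at_within[OF kder]) (use \<alpha>b[OF z' s] in auto)
      show "norm (k' s z) \<le> G s" using k'b[OF z' s] by simp
    qed (use \<epsilon>(1)[of n] in auto)
    then show ?thesis using \<epsilon>(1)[of n] by (simp add: Fk k0 mult.commute)
  qed
  have Fder: "(F n s has_real_derivative Fp n s p) (at p)" for n s p
    unfolding F_def[abs_def] Fp_def by (intro DERIV_cmult DERIV_L_r[OF C1])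
  have Fpb: "\<bar>Fp n s p\<bar> \<le> 3/2 * M" if s: "s \<in> {a..b}" for n s p
    unfolding Fp_def abs_mult
    using \<alpha>b[OF \<epsilon>(2,3) s, of n] L_r_bound[OF \<tau>m[OF \<epsilon>(2,3) s], of n] by (intro mult_mono) auto
  have Flip: "\<bar>F n s p - F n s q\<bar> \<le> 3/2 * M * \<bar>p - q\<bar>" if s: "s \<in> {a..b}" for n s p q
  proof -
    have "norm (F n s p - F n s q) \<le> 3/2 * M * norm (p - q)"
      by (rule field_differentiable_bound[where f'="Fp n s" and S=UNIV]) (use Fder Fpb[OF s] in auto)
    then show ?thesis by simp
  qed
  have Gi: "G integrable_on {a..b}"
    unfolding G_def using L_integrable
    by (intro integrable_add integrable_on_mult_right) (auto simp: absolutely_integrable_on_def)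
  have Hm: "H \<in> borel_measurable (lebesgue_on {a..b})"
    unfolding H_def using hi
    by (intro continuous_imp_measurable_on_sets_lebesgue indefinite_integral_continuous_1)
      (auto simp: absolutely_integrable_on_def)
  \<comment> \<open>The majorant passes from p to w by the Lipschitz bound \<open>Flip\<close>, and
    from the perturbed to the original integrand along w by \<open>est\<close>.\<close>
  have Fi: "(\<lambda>s. F n s (p s)) absolutely_integrable_on {a..b}" if p: "continuous_on {a..b} p" for n p
  proof (rule measurable_bounded_by_integrable_imp_absolutely_integrable
      [where g="\<lambda>s. \<bar>L (s, \<xi> s, v s, w s)\<bar> + \<epsilon> n * G s + 3/2 * M * \<bar>p s - w s\<bar>"])
    have pm: "p \<in> borel_measurable (lebesgue_on {a..b})"
      by (rule continuous_imp_measurable_on_sets_lebesgue[OF p]) simp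
    have \<alpha>m: "\<alpha> (\<epsilon> n) \<in> borel_measurable (lebesgue_on {a..b})" unfolding \<alpha>_def using hm by measurable
    have "(\<lambda>s. L (s + \<epsilon> n * H s, \<xi> s, v s /\<^sub>R \<alpha> (\<epsilon> n) s, p s)) \<in> borel_measurable (lebesgue_on {a..b})"
      by (rule measurable_lagrangian_comp[OF continuous_on_lagrangian[OF C1] _ \<xi>_measurable _ pm])
        (use Hm \<alpha>m v_measurable id_measurable in measurable)
    then show "(\<lambda>s. F n s (p s)) \<in> borel_measurable (lebesgue_on {a..b})" unfolding F_def using \<alpha>m by measurable
    have "continuous_on {a..b} (\<lambda>s. 3/2 * M * \<bar>p s - w s\<bar>)"
      using p primitive_on_continuous[OF w] by (intro continuous_intros)
    then have "(\<lambda>s. 3/2 * M * \<bar>p s - w s\<bar>) integrable_on {a..b}" by (rule integrable_continuous_real)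
    moreover have "(\<lambda>s. \<bar>L (s, \<xi> s, v s, w s)\<bar>) integrable_on {a..b}"
      using L_integrable by (simp add: absolutely_integrable_on_def)
    ultimately show "(\<lambda>s. \<bar>L (s, \<xi> s, v s, w s)\<bar> + \<epsilon> n * G s + 3/2 * M * \<bar>p s - w s\<bar>) integrable_on {a..b}"
      by (intro integrable_add integrable_on_mult_right[OF Gi])
    show "norm (F n s (p s)) \<le> \<bar>L (s, \<xi> s, v s, w s)\<bar> + \<epsilon> n * G s + 3/2 * M * \<bar>p s - w s\<bar>" if s: "s \<in> {a..b}" for s
      using est[OF s, of n] Flip[OF s, of n "p s" "w s"] unfolding real_norm_def by linarith
  qed simp
  have "\<exists>W. W a = w a \<and> primitive_on a b W (\<lambda>s. F n s (W s))" for n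
  proof -
    have "a \<le> b" "0 \<le> 3/2 * M" using ab M0 by auto
    from caratheodory_lipschitz[OF this, of "F n" "w a", OF Flip Fi] show ?thesis by blast
  qed
  then obtain W where W: "\<And>n. W n a = w a" "\<And>n. primitive_on a b (W n) (\<lambda>s. F n s (W n s))" by metis
  have Wb: "w b \<le> W n b" for n
  proof (rule time_change_minimal[OF tc[OF \<epsilon>(2,3)[of n]]])
    show "W n a = w a" by (rule W(1))
    show "primitive_on a b (W n) (\<lambda>s. \<alpha> (\<epsilon> n) s * L (time_change.\<tau> a (\<alpha> (\<epsilon> n)) s, \<xi> s, v s /\<^sub>R \<alpha> (\<epsilon> n) s, W n s))"
      by (rule primitive_on_cong[OF W(2)]) (simp add: F_def \<tau>[OF \<epsilon>(2,3)[of n]])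
  qed
  show ?thesis
    unfolding H_def[symmetric]
  proof (rule perturbation_inequality[where W=W and F=F and Fp=Fp and \<epsilon>=\<epsilon> and G=G and M="3/2 * M"])
    show "(\<lambda>s. F n s (w s)) absolutely_integrable_on {a..b}" for n by (rule Fi[OF primitive_on_continuous[OF w]])
    show "(\<lambda>n. (F n s (w s) - L (s, \<xi> s, v s, w s)) / \<epsilon> n) \<longlonglongrightarrow>
       h s * (L (s, \<xi> s, v s, w s) - L_v L (s, \<xi> s, v s, w s) \<bullet> v s) + H s * L_t L (s, \<xi> s, v s, w s)"
      if "s \<in> {a..b}" for s
    proof -
      \<comment> \<open>The limit of the residual quotients is the derivative of k at e = 0, where
        \<alpha> = 1.\<close>
      have "(k s has_real_derivative k' s 0) (at 0)" by (rule kder) (simp add: \<alpha>_def)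
      then have "((\<lambda>e. (k s e - k s 0) / e) \<longlongrightarrow> k' s 0) (at 0)" by (simp add: has_field_derivative_iff)
      moreover have "filterlim \<epsilon> (at 0) sequentially"
        using \<epsilon>lim \<epsilon>(1) by (auto simp: filterlim_at less_imp_neq[symmetric])
      ultimately have "(\<lambda>n. (k s (\<epsilon> n) - k s 0) / \<epsilon> n) \<longlonglongrightarrow> k' s 0" by (rule filterlim_compose)
      then show ?thesis by (simp add: Fk k0 k'_def P_def \<alpha>_def algebra_simps)
    qed
    show "(\<lambda>n. Fp n s (p n)) \<longlonglongrightarrow> L_r L (s, \<xi> s, v s, w s)" if "s \<in> {a..b}" "p \<longlonglongrightarrow> w s" for s p
    proof -
      have \<alpha>l: "(\<lambda>n. \<alpha> (\<epsilon> n) s) \<longlonglongrightarrow> 1 + 0 * h s" unfolding \<alpha>_def by (intro tendsto_intros \<epsilon>lim)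
      have "isCont (L_r L) (s + 0 * H s, \<xi> s, v s /\<^sub>R (1 + 0 * h s), w s)"
        using continuous_on_L_r[OF C1, of UNIV] by (simp add: continuous_on_eq_continuous_at)
      moreover have "(\<lambda>n. (s + \<epsilon> n * H s, \<xi> s, v s /\<^sub>R \<alpha> (\<epsilon> n) s, p n)) \<longlonglongrightarrow> (s + 0 * H s, \<xi> s, v s /\<^sub>R (1 + 0 * h s), w s)"
        by (intro tendsto_intros \<epsilon>lim \<alpha>l that) auto
      ultimately have "(\<lambda>n. L_r L (s + \<epsilon> n * H s, \<xi> s, v s /\<^sub>R \<alpha> (\<epsilon> n) s, p n)) \<longlonglongrightarrow> L_r L (s + 0 * H s, \<xi> s, v s /\<^sub>R (1 + 0 * h s), w s)"
        by (rule isCont_tendsto_compose)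
      from tendsto_mult[OF \<alpha>l this] show ?thesis by (simp add: Fp_def)
    qed
    show "(\<lambda>r. L_r L (r, \<xi> r, v r, w r)) \<in> borel_measurable (lebesgue_on {a..b})"
      by (rule measurable_lagrangian_comp[OF continuous_on_L_r[OF C1] id_measurable \<xi>_measurable v_measurable w_measurable])
  qed (use ab w W Wb Fder Fpb \<epsilon>(1) \<epsilon>lim Gi est in auto)
qed

end

section \<open>From the first variation to the energy identity\<close>

context herglotz_curve
begin

definition disc :: "real \<Rightarrow> real" where
  "disc s = exp (- integral {a..s} (\<lambda>r. L_r L (r, \<xi> r, v r, w r)))"

text \<open>The Hamiltonian along the curve, expressed in velocities; multiplied by
  \<open>disc\<close> it is the energy.\<close>

definition ham :: "real \<Rightarrow> real" where
  "ham s = L_v L (s, \<xi> s, v s, w s) \<bullet> v s - L (s, \<xi> s, v s, w s)"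

definition drift :: "real \<Rightarrow> real" where
  "drift s = integral {a..s} (\<lambda>r. disc r * L_t L (r, \<xi> r, v r, w r))"

lemma L_r_integrable: "(\<lambda>r. L_r L (r, \<xi> r, v r, w r)) absolutely_integrable_on {a..b}"
proof (rule measurable_bounded_by_integrable_imp_absolutely_integrable[where g="\<lambda>_. M"])
  show "(\<lambda>r. L_r L (r, \<xi> r, v r, w r)) \<in> borel_measurable (lebesgue_on {a..b})"
    by (rule measurable_lagrangian_comp[OF continuous_on_L_r[OF C1] id_measurable \<xi>_measurable v_measurable w_measurable])
qed (use L_r_bound in auto)

lemma continuous_on_disc: "continuous_on {a..b} disc"
  unfolding disc_def using L_r_integrable
  by (intro continuous_intros indefinite_integral_continuous_1) (auto simp: absolutely_integrable_on_def)

lemma disc_measurable: "disc \<in> borel_measurable (lebesgue_on {a..b})"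
  by (rule continuous_imp_measurable_on_sets_lebesgue[OF continuous_on_disc]) simp

lemma disc_bounded: obtains K where "\<And>s. s \<in> {a..b} \<Longrightarrow> \<bar>disc s\<bar> \<le> K"
proof -
  have "bounded (disc ` {a..b})" by (intro compact_imp_bounded compact_continuous_image continuous_on_disc) simp
  then obtain K where "\<forall>s\<in>{a..b}. \<bar>disc s\<bar> \<le> K" unfolding bounded_iff by auto
  then show ?thesis using that[of K] by blast
qed

lemma disc_L_t_integrable: "(\<lambda>r. disc r * L_t L (r, \<xi> r, v r, w r)) absolutely_integrable_on {a..b}"
proof -
  have "(\<lambda>r. L_t L (r, \<xi> r, v r, w r)) absolutely_integrable_on {a..b}"
  proof (rule measurable_bounded_by_integrable_imp_absolutely_integrable
      [where g="\<lambda>s. M * (1 + \<bar>L (s, \<xi> s, v s, w s)\<bar>)"])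
    show "(\<lambda>r. L_t L (r, \<xi> r, v r, w r)) \<in> borel_measurable (lebesgue_on {a..b})"
      by (rule measurable_lagrangian_comp[OF continuous_on_L_t[OF C1] id_measurable \<xi>_measurable v_measurable w_measurable])
    show "(\<lambda>s. M * (1 + \<bar>L (s, \<xi> s, v s, w s)\<bar>)) integrable_on {a..b}"
      using L_integrable by (intro integrable_on_mult_right integrable_add) (auto simp: absolutely_integrable_on_def)
  qed (use L_t_bound in auto)
  moreover obtain K where "\<And>s. s \<in> {a..b} \<Longrightarrow> \<bar>disc s\<bar> \<le> K" using disc_bounded by blast
  ultimately have "(\<lambda>r. disc r *\<^sub>R L_t L (r, \<xi> r, v r, w r)) absolutely_integrable_on {a..b}"
    by (intro absolutely_integrable_scaleR_bounded[OF disc_measurable, of K])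
  then show ?thesis by simp
qed

lemma primitive_drift: "primitive_on a b drift (\<lambda>r. disc r * L_t L (r, \<xi> r, v r, w r))"
  using primitive_on_integral[OF disc_L_t_integrable, of 0] by (simp add: drift_def[abs_def])

lemma ham_measurable: "ham \<in> borel_measurable (lebesgue_on {a..b})"
proof -
  have "(\<lambda>r. L_v L (r, \<xi> r, v r, w r)) \<in> borel_measurable (lebesgue_on {a..b})"
    by (rule measurable_lagrangian_comp[OF continuous_on_L_v[OF C1] id_measurable \<xi>_measurable v_measurable w_measurable])
  moreover have "(\<lambda>r. L (r, \<xi> r, v r, w r)) \<in> borel_measurable (lebesgue_on {a..b})"
    by (rule measurable_lagrangian_comp[OF continuous_on_lagrangian[OF C1] id_measurable \<xi>_measurable v_measurable w_measurable])
  ultimately show ?thesis unfolding ham_def using v_measurable by (intro borel_measurable_diff borel_measurable_inner)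
qed

text \<open>At velocities bounded by R the lifted curve stays in a compact set. On all of [a,b] the
  velocity may be unbounded, and this argument fails.\<close>

lemma ham_bounded:
  obtains K where "K \<ge> 0" "\<And>s. s \<in> {a..b} \<Longrightarrow> norm (v s) \<le> R \<Longrightarrow> \<bar>ham s\<bar> \<le> K"
proof -
  let ?K = "{a..b} \<times> \<xi> ` {a..b} \<times> (cball 0 R :: (real ^ 'n) set) \<times> w ` {a..b}"
  let ?f = "\<lambda>p. L_v L p \<bullet> fst (snd (snd p)) - L p"
  have "compact ?K"
    using primitive_on_continuous[OF \<xi>] primitive_on_continuous[OF w]
    by (intro compact_Times compact_continuous_image) auto
  then have "bounded (?f ` ?K)"
    by (intro compact_imp_bounded compact_continuous_image continuous_intros
        continuous_on_lagrangian[OF C1] continuous_on_L_v[OF C1])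
  then obtain K where K: "\<forall>x\<in>?f ` ?K. norm x \<le> K" unfolding bounded_iff by blast
  show ?thesis
  proof (rule that[of "max K 0"])
    fix s assume "s \<in> {a..b}" "norm (v s) \<le> R"
    then have "(s, \<xi> s, v s, w s) \<in> ?K" by simp
    then have "norm (?f (s, \<xi> s, v s, w s)) \<le> K" using K by blast
    then show "\<bar>ham s\<bar> \<le> max K 0" by (simp add: ham_def)
  qed simp
qed

lemma first_variation_eq_0:
  assumes hm: "h \<in> borel_measurable (lebesgue_on {a..b})"
    and hB: "\<And>s. s \<in> {a..b} \<Longrightarrow> \<bar>h s\<bar> \<le> B"
    and hR: "\<And>s. s \<in> {a..b} \<Longrightarrow> h s \<noteq> 0 \<Longrightarrow> norm (v s) \<le> R"
    and h0: "integral {a..b} h = 0"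
  shows "integral {a..b} (\<lambda>s. h s * (disc s * ham s + drift s)) = 0"
proof -
  have ab': "a \<le> b" using ab by simp
  have B0: "B \<ge> 0" using hB[of a] ab by (auto intro: order_trans[OF abs_ge_zero])
  define H where "H s = integral {a..s} h" for s
  have hi: "h absolutely_integrable_on {a..b}"
    by (rule measurable_bounded_by_integrable_imp_absolutely_integrable[where g="\<lambda>_. B"]) (use hm hB in auto)
  have H: "primitive_on a b H h" using primitive_on_integral[OF hi, of 0] by (simp add: H_def[abs_def])
  have H0: "H a = 0" "H b = 0" using h0 by (auto simp: H_def)
  define T where "T s = disc s * L_t L (s, \<xi> s, v s, w s)" for s
  have PT: "primitive_on a b drift T" using primitive_drift by (simp add: T_def[abs_def])
  obtain K1 where K1: "\<And>s. s \<in> {a..b} \<Longrightarrow> \<bar>H s\<bar> \<le> K1" using primitive_on_bounded[OF H] by blast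
  have i1: "(\<lambda>s. H s * T s) integrable_on {a..b}"
  proof -
    have "(\<lambda>s. H s *\<^sub>R T s) absolutely_integrable_on {a..b}"
      using PT primitive_on_continuous[OF H] K1
      by (intro absolutely_integrable_scaleR_bounded[of _ _ _ K1] continuous_imp_measurable_on_sets_lebesgue)
        (auto simp: primitive_on_def)
    then show ?thesis by (simp add: absolutely_integrable_on_def)
  qed
  have i2: "(\<lambda>s. h s * drift s) integrable_on {a..b}"
  proof -
    have "(\<lambda>s. h s *\<^sub>R drift s) absolutely_integrable_on {a..b}"
      using hm hB primitive_on_continuous[OF PT]
      by (intro absolutely_integrable_scaleR_bounded[of _ _ _ B] absolutely_integrable_continuous_real)
    then show ?thesis by (simp add: absolutely_integrable_on_def)
  qed
  \<comment> \<open>Integrable because h vanishes wherever \<open>ham\<close> is not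
    controlled.\<close>
  have i3: "(\<lambda>s. h s * (disc s * ham s)) integrable_on {a..b}"
  proof -
    obtain K2 where K2: "\<And>s. s \<in> {a..b} \<Longrightarrow> \<bar>disc s\<bar> \<le> K2" using disc_bounded by blast
    obtain K3 where K3: "K3 \<ge> 0" "\<And>s. s \<in> {a..b} \<Longrightarrow> norm (v s) \<le> R \<Longrightarrow> \<bar>ham s\<bar> \<le> K3" using ham_bounded by blast
    have "(\<lambda>s. h s * (disc s * ham s)) absolutely_integrable_on {a..b}"
    proof (rule measurable_bounded_by_integrable_imp_absolutely_integrable[where g="\<lambda>_. B * (K2 * K3)"])
      show "(\<lambda>s. h s * (disc s * ham s)) \<in> borel_measurable (lebesgue_on {a..b})"
        using hm disc_measurable ham_measurable by measurable
      fix s assume s: "s \<in> {a..b}"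
      have K20: "K2 \<ge> 0" using K2[OF s] by (auto intro: order_trans[OF abs_ge_zero])
      show "norm (h s * (disc s * ham s)) \<le> B * (K2 * K3)"
      proof (cases "h s = 0")
        case True
        then show ?thesis using B0 K20 K3(1) by simp
      next
        case False
        then show ?thesis
          unfolding real_norm_def abs_mult
          using hB[OF s] K2[OF s] K3(2)[OF s hR[OF s False]] B0 K20 by (intro mult_mono) auto
      qed
    qed auto
    then show ?thesis by (simp add: absolutely_integrable_on_def)
  qed
  \<comment> \<open>H vanishes at both ends, so the product H drift leaves no boundary term.\<close>
  have parts: "integral {a..b} (\<lambda>s. H s * T s) = - integral {a..b} (\<lambda>s. h s * drift s)"
  proof -
    have "integral {a..b} (\<lambda>s. h s * drift s + H s * T s) = 0"
      using primitive_on_diff[OF primitive_on_mult[OF ab' H PT], of a b] ab' H0 by simp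
    then show ?thesis using Henstock_Kurzweil_Integration.integral_add[OF i2 i1] by simp
  qed
  have "0 \<le> integral {a..b} (\<lambda>s. disc s * (h s * (- ham s) + H s * L_t L (s, \<xi> s, v s, w s)))"
    using first_variation[OF hm hB hR h0] unfolding disc_def ham_def H_def by simp
  also have "(\<lambda>s. disc s * (h s * (- ham s) + H s * L_t L (s, \<xi> s, v s, w s))) = (\<lambda>s. H s * T s - h s * (disc s * ham s))"
    by (auto simp: T_def algebra_simps)
  also have "integral {a..b} \<dots> = - integral {a..b} (\<lambda>s. h s * drift s) - integral {a..b} (\<lambda>s. h s * (disc s * ham s))"
    using Henstock_Kurzweil_Integration.integral_diff[OF i1 i3] parts by simp
  finally have le: "integral {a..b} (\<lambda>s. h s * drift s) + integral {a..b} (\<lambda>s. h s * (disc s * ham s)) \<le> 0" by simp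
  have neg: "integral {a..s} (\<lambda>s. - h s) = - H s" for s by (simp add: H_def)
  have "0 \<le> integral {a..b} (\<lambda>s. disc s * (- h s * (- ham s) + - H s * L_t L (s, \<xi> s, v s, w s)))"
  proof -
    have "(\<lambda>s. - h s) \<in> borel_measurable (lebesgue_on {a..b})" using hm by measurable
    from first_variation[OF this, of B R] show ?thesis
      using hB hR H0 unfolding neg disc_def[symmetric] ham_def by simp
  qed
  also have "(\<lambda>s. disc s * (- h s * (- ham s) + - H s * L_t L (s, \<xi> s, v s, w s))) = (\<lambda>s. h s * (disc s * ham s) - H s * T s)"
    by (auto simp: T_def algebra_simps)
  also have "integral {a..b} \<dots> = integral {a..b} (\<lambda>s. h s * (disc s * ham s)) + integral {a..b} (\<lambda>s. h s * drift s)"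
    using Henstock_Kurzweil_Integration.integral_diff[OF i3 i1] parts by simp
  finally have "integral {a..b} (\<lambda>s. h s * (disc s * ham s)) + integral {a..b} (\<lambda>s. h s * drift s) = 0" using le by simp
  then show ?thesis
    using Henstock_Kurzweil_Integration.integral_add[OF i3 i2] by (simp add: distrib_left)
qed

text \<open>The test function \<open>h\<close> is \<open>f - c\<close> on \<open>{\<bar>v\<bar> \<le> R}\<close> and \<open>0\<close> elsewhere, where \<open>f = E + \<integral>\<^sub>a m L\<^sub>t\<close>
  and \<open>c\<close> is the mean of \<open>f\<close> over \<open>{\<bar>v\<bar> \<le> R}\<close>.\<close>

lemma energy_constant_on_sublevel:
  "\<exists>c. AE s in lebesgue_on {a..b}. norm (v s) \<le> R \<longrightarrow> disc s * ham s + drift s = c"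
proof -
  define f where "f s = disc s * ham s + drift s" for s
  define \<kappa> :: "real \<Rightarrow> real" where "\<kappa> s = (if norm (v s) \<le> R then 1 else 0)" for s
  have Pm: "drift \<in> borel_measurable (lebesgue_on {a..b})"
    by (rule continuous_imp_measurable_on_sets_lebesgue[OF primitive_on_continuous[OF primitive_drift]]) simp
  have fm: "f \<in> borel_measurable (lebesgue_on {a..b})"
    unfolding f_def using disc_measurable ham_measurable Pm by measurable
  have \<kappa>disc: "\<kappa> \<in> borel_measurable (lebesgue_on {a..b})"
    unfolding \<kappa>_def using v_measurable by measurable
  obtain K where K: "K \<ge> 0" "\<And>s. s \<in> {a..b} \<Longrightarrow> norm (v s) \<le> R \<Longrightarrow> \<bar>f s\<bar> \<le> K"
  proof -
    obtain K2 where K2: "\<And>s. s \<in> {a..b} \<Longrightarrow> \<bar>disc s\<bar> \<le> K2" using disc_bounded by blast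
    obtain K3 where K3: "K3 \<ge> 0" "\<And>s. s \<in> {a..b} \<Longrightarrow> norm (v s) \<le> R \<Longrightarrow> \<bar>ham s\<bar> \<le> K3" using ham_bounded by blast
    obtain K4 where K4: "\<And>s. s \<in> {a..b} \<Longrightarrow> \<bar>drift s\<bar> \<le> K4" using primitive_on_bounded[OF primitive_drift] by blast
    have K20: "K2 \<ge> 0" using K2[of a] ab by (auto intro: order_trans[OF abs_ge_zero])
    have K40: "K4 \<ge> 0" using K4[of a] ab by (auto intro: order_trans[OF abs_ge_zero])
    show ?thesis
    proof (rule that[of "K2 * K3 + K4"])
      fix s assume s: "s \<in> {a..b}" "norm (v s) \<le> R"
      have "\<bar>disc s * ham s\<bar> \<le> K2 * K3"
        unfolding abs_mult using K2[OF s(1)] K3(2)[OF s] K20 by (intro mult_mono) auto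
      then show "\<bar>f s\<bar> \<le> K2 * K3 + K4" using K4[OF s(1)] unfolding f_def by linarith
    qed (use K20 K3(1) K40 in simp)
  qed
  have i\<kappa>: "\<kappa> absolutely_integrable_on {a..b}"
    by (rule measurable_bounded_by_integrable_imp_absolutely_integrable[where g="\<lambda>_. 1"]) (use \<kappa>disc in \<open>auto simp: \<kappa>_def\<close>)
  have i\<kappa>f: "(\<lambda>s. \<kappa> s * f s) absolutely_integrable_on {a..b}"
  proof (rule measurable_bounded_by_integrable_imp_absolutely_integrable[where g="\<lambda>_. K"])
    show "(\<lambda>s. \<kappa> s * f s) \<in> borel_measurable (lebesgue_on {a..b})" using \<kappa>disc fm by measurable
  qed (use K in \<open>auto simp: \<kappa>_def\<close>)
  have zero: "AE s in lebesgue_on {a..b}. g s = 0"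
    if "g absolutely_integrable_on {a..b}" "\<And>s. 0 \<le> g s" "integral {a..b} g = 0" for g :: "real \<Rightarrow> real"
  proof -
    have g: "integrable (lebesgue_on {a..b}) g" using that(1) by (intro absolutely_integrable_imp_integrable) auto
    then have "integral\<^sup>L (lebesgue_on {a..b}) g = 0" using that(3) by (simp add: lebesgue_integral_eq_integral)
    then show ?thesis using integral_nonneg_eq_0_iff_AE[OF g] that(2) by simp
  qed
  define \<mu> where "\<mu> = integral {a..b} \<kappa>"
  define c where "c = integral {a..b} (\<lambda>s. \<kappa> s * f s) / \<mu>"
  \<comment> \<open>If the sublevel set is null, division by zero makes c = 0, and the left side
    vanishes because its integrand is zero almost everywhere.\<close>
  have mean: "integral {a..b} (\<lambda>s. \<kappa> s * f s) = c * \<mu>"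
  proof (cases "\<mu> = 0")
    case True
    then have "AE s in lebesgue_on {a..b}. \<kappa> s = 0"
      using zero[OF i\<kappa>] by (auto simp: \<mu>_def \<kappa>_def)
    then have "negligible {s \<in> {a..b}. \<not> \<kappa> s = 0}" unfolding AE_lebesgue_on_iff_negligible .
    then have "integral {a..b} (\<lambda>s. \<kappa> s * f s) = integral {a..b} (\<lambda>_. 0::real)"
      by (rule integral_spike) auto
    then show ?thesis using True by simp
  qed (simp add: c_def)
  define h where "h s = \<kappa> s * (f s - c)" for s
  have hm: "h \<in> borel_measurable (lebesgue_on {a..b})" unfolding h_def using \<kappa>disc fm by measurable
  have hB: "\<bar>h s\<bar> \<le> K + \<bar>c\<bar>" if "s \<in> {a..b}" for s
    using K(2)[OF that] K(1) by (auto simp: h_def \<kappa>_def)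
  have hR: "norm (v s) \<le> R" if "h s \<noteq> 0" for s using that by (auto simp: h_def \<kappa>_def split: if_splits)
  have i1: "\<kappa> integrable_on {a..b}" "(\<lambda>s. \<kappa> s * f s) integrable_on {a..b}"
    using i\<kappa> i\<kappa>f by (auto simp: absolutely_integrable_on_def)
  have "integral {a..b} h = integral {a..b} (\<lambda>s. \<kappa> s * f s - c * \<kappa> s)"
    by (simp add: h_def[abs_def] algebra_simps)
  also have "\<dots> = 0"
    using i1 mean by (subst Henstock_Kurzweil_Integration.integral_diff) (auto simp: \<mu>_def intro: integrable_on_mult_right)
  finally have h0: "integral {a..b} h = 0" .
  have hi: "h absolutely_integrable_on {a..b}"
    by (rule measurable_bounded_by_integrable_imp_absolutely_integrable[where g="\<lambda>_. K + \<bar>c\<bar>"]) (use hm hB in auto)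
  have hfi: "(\<lambda>s. h s * (f s - c)) absolutely_integrable_on {a..b}"
  proof (rule measurable_bounded_by_integrable_imp_absolutely_integrable[where g="\<lambda>_. (K + \<bar>c\<bar>) * (K + \<bar>c\<bar>)"])
    show "(\<lambda>s. h s * (f s - c)) \<in> borel_measurable (lebesgue_on {a..b})" using hm fm by measurable
    fix s assume s: "s \<in> {a..b}"
    \<comment> \<open>\<kappa> takes only the values 0 and 1, hence equals its square; the tested
      quantity is nonnegative.\<close>
    have "h s * (f s - c) = h s * h s" by (auto simp: h_def \<kappa>_def)
    then have "norm (h s * (f s - c)) = \<bar>h s\<bar> * \<bar>h s\<bar>" by (simp only: real_norm_def abs_mult)
    also have "\<dots> \<le> (K + \<bar>c\<bar>) * (K + \<bar>c\<bar>)" using hB[OF s] K(1) by (intro mult_mono) auto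
    finally show "norm (h s * (f s - c)) \<le> (K + \<bar>c\<bar>) * (K + \<bar>c\<bar>)" .
  qed auto
  have "integral {a..b} (\<lambda>s. h s * f s) = 0"
    unfolding f_def by (rule first_variation_eq_0[OF hm hB hR h0])
  \<comment> \<open>Since h has mean zero, f may be replaced by f - c, which turns the variational
    identity into a vanishing integral of h^2.\<close>
  moreover have "integral {a..b} (\<lambda>s. h s * (f s - c) + c * h s) = integral {a..b} (\<lambda>s. h s * (f s - c)) + c * integral {a..b} h"
    using hfi hi by (subst Henstock_Kurzweil_Integration.integral_add)
      (auto simp: absolutely_integrable_on_def intro: integrable_on_mult_right)
  ultimately have "integral {a..b} (\<lambda>s. h s * (f s - c)) = 0" using h0 by (simp add: algebra_simps)
  then have "AE s in lebesgue_on {a..b}. h s * (f s - c) = 0"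
    by (intro zero[OF hfi]) (auto simp: h_def \<kappa>_def)
  then have "AE s in lebesgue_on {a..b}. norm (v s) \<le> R \<longrightarrow> f s = c"
    by eventually_elim (auto simp: h_def \<kappa>_def)
  then show ?thesis unfolding f_def by blast
qed

text \<open>The constants of different levels are tied together by one point t outside a common null
  set: a level above both |v s| and |v t| gives the same constant at s and at t. The value at t thus
  serves for almost every s.\<close>

lemma energy_representation: "\<exists>c. AE s in lebesgue_on {a..b}. disc s * ham s = c - drift s"
proof -
  have "\<forall>n::nat. \<exists>c. AE s in lebesgue_on {a..b}. norm (v s) \<le> real n \<longrightarrow> disc s * ham s + drift s = c"
    by (intro allI energy_constant_on_sublevel)
  from choice[OF this] obtain c
    where "\<forall>n::nat. AE s in lebesgue_on {a..b}. norm (v s) \<le> real n \<longrightarrow> disc s * ham s + drift s = c n" ..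
  then have ae: "AE s in lebesgue_on {a..b}. \<forall>n::nat. norm (v s) \<le> real n \<longrightarrow> disc s * ham s + drift s = c n"
    by (simp add: AE_all_countable)
  have "\<exists>t\<in>{a..b}. \<forall>n::nat. norm (v t) \<le> real n \<longrightarrow> disc t * ham t + drift t = c n"
  proof (rule ccontr)
    assume "\<not> ?thesis"
    then have "{a..b} = {s \<in> {a..b}. \<not> (\<forall>n::nat. norm (v s) \<le> real n \<longrightarrow> disc s * ham s + drift s = c n)}" by blast
    then have "negligible {a..b}" using ae unfolding AE_lebesgue_on_iff_negligible by simp
    then show False using ab negligible_interval(1)[of a b] by auto
  qed
  then obtain t where t: "\<And>n::nat. norm (v t) \<le> real n \<Longrightarrow> disc t * ham t + drift t = c n" by blast
  have "AE s in lebesgue_on {a..b}. disc s * ham s = disc t * ham t + drift t - drift s"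
    using ae
  proof eventually_elim
    case (elim s)
    obtain n :: nat where "max (norm (v s)) (norm (v t)) \<le> real n" using real_arch_simple by blast
    then have "disc s * ham s + drift s = c n" "disc t * ham t + drift t = c n" using elim t by auto
    then show ?case by simp
  qed
  then show ?thesis by blast
qed

end

section \<open>Reduction of the theorem to the comparison of endpoint values\<close>

lemma herglotz_solution_primitive_on:
  assumes "a < b" "herglotz_solution L a b u \<eta> W"
  shows "primitive_on a b W (\<lambda>s. L (lift \<eta> W s))"
  using assms unfolding herglotz_solution_def by (intro abs_continuous_imp_primitive) auto

text \<open>\<open>J\<close> refers to a solution picked by \<open>SOME\<close>. The bound on
  \<open>L_r\<close> makes solutions unique, so its endpoint value is that of the given W, and the
  integral of the right-hand side is the increment.\<close>

lemma J_eq: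
  fixes L :: "'n::finite lagrangian"
  assumes C1: "C1_function L" and "a < b" and bnd: "\<And>t x v r. t \<in> {a..b} \<Longrightarrow> \<bar>L_r L (t, x, v, r)\<bar> \<le> M"
    and W: "herglotz_solution L a b u \<eta> W"
  shows "J L a b u \<eta> = W b - u"
proof -
  define U where "U = u_sol L a b u \<eta>"
  have U: "herglotz_solution L a b u \<eta> U" unfolding U_def u_sol_def using W by (rule someI[where P="herglotz_solution L a b u \<eta>"])
  have UP: "primitive_on a b U (\<lambda>s. L (lift \<eta> U s))" and WP: "primitive_on a b W (\<lambda>s. L (lift \<eta> W s))"
    using herglotz_solution_primitive_on[OF \<open>a < b\<close>] U W by auto
  have Ua: "U a = u" "W a = u" using U W unfolding herglotz_solution_def by auto
  have "U b = W b"
  proof (rule lipschitz_ode_unique[where v=U and w=W and t=b and a=a and b=b and F="\<lambda>s p. L (s, \<eta> s, vector_derivative \<eta> (at s), p)" and M=M])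
    show "\<bar>L (s, \<eta> s, vector_derivative \<eta> (at s), p) - L (s, \<eta> s, vector_derivative \<eta> (at s), q)\<bar> \<le> M * \<bar>p - q\<bar>"
      if "s \<in> {a..b}" for s p q
    proof -
      have "norm (L (s, \<eta> s, vector_derivative \<eta> (at s), p) - L (s, \<eta> s, vector_derivative \<eta> (at s), q)) \<le> M * norm (p - q)"
        by (rule field_differentiable_bound[where f'="\<lambda>r. L_r L (s, \<eta> s, vector_derivative \<eta> (at s), r)" and S=UNIV])
          (use bnd[OF that] DERIV_L_r[OF C1] in auto)
      then show ?thesis by simp
    qed
  qed (use \<open>a < b\<close> UP WP Ua in \<open>auto simp: lift_def\<close>)
  have "J L a b u \<eta> = integral {a..b} (\<lambda>s. L (lift \<eta> U s))"
    unfolding J_def U_def[symmetric] using UP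
    by (intro set_lebesgue_integral_eq_integral(2)) (simp add: primitive_on_def)
  also have "\<dots> = U b - U a" using primitive_on_diff[OF UP, of a b] \<open>a < b\<close> by simp
  finally show ?thesis using Ua \<open>U b = W b\<close> by simp
qed

theorem theorem2p2:
  fixes L :: "real \<times> (real ^ 'n) \<times> (real ^ 'n) \<times> real \<Rightarrow> real"
    and a b u :: real and x y :: "real ^ 'n"
    and \<xi> :: "real \<Rightarrow> real ^ 'n" and u\<^sub>\<xi> :: "real \<Rightarrow> real"
  assumes "C1_function L"
    and "cond_L1 L" and "cond_L2 L" and "cond_L3 L" and "cond_L4 L"
    and "a < b"
    and "is_arg_min (J L a b u) (\<lambda>\<eta>. \<eta> \<in> admissible L a b u x y) \<xi>"
    and "herglotz_solution L a b u \<xi> u\<^sub>\<xi>"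
  shows "\<exists>Ebar. (AE s in lebesgue_on {a..b}. Ebar s = energy L a \<xi> u\<^sub>\<xi> s) \<and>
           continuous_on {a..b} Ebar \<and>
           abs_continuous_on a b Ebar \<and>
           (AE s in lebesgue_on {a..b}.
              (Ebar has_real_derivative - discount L a \<xi> u\<^sub>\<xi> s * L_t L (lift \<xi> u\<^sub>\<xi> s)) (at s))"
proof -
  have ab': "a \<le> b" using \<open>a < b\<close> by simp
  obtain M where M: "M \<ge> 0" "\<And>t x v r. t \<in> {a..b} \<Longrightarrow> \<bar>L_r L (t, x, v, r)\<bar> \<le> M"
    "\<And>t x v r. t \<in> {a..b} \<Longrightarrow> \<bar>L_t L (t, x, v, r)\<bar> \<le> M * (1 + \<bar>L (t, x, v, r)\<bar>)"
    using lagrangian_uniform_bounds[OF \<open>C1_function L\<close> \<open>cond_L3 L\<close> \<open>cond_L4 L\<close> \<open>a < b\<close>] by blast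
  have \<xi>G: "\<xi> \<in> Gamma a b x y" and min: "\<And>\<eta>. \<eta> \<in> admissible L a b u x y \<Longrightarrow> J L a b u \<xi> \<le> J L a b u \<eta>"
    using assms(7) unfolding is_arg_min_def admissible_def by (auto simp: not_less)
  have J: "J L a b u \<eta> = W b - u" if "herglotz_solution L a b u \<eta> W" for \<eta> W
    by (rule J_eq[OF \<open>C1_function L\<close> \<open>a < b\<close> M(2) that])
  obtain g where g: "primitive_on a b \<xi> g"
    using W11_imp_primitive_on[of \<xi> a b] \<xi>G \<open>a < b\<close> by (auto simp: Gamma_def)
  \<comment> \<open>The pointwise derivative equals the density g almost everywhere, hence is a
    density too; with this choice \<open>lift\<close> unfolds to v at every s.\<close>
  define v where "v s = vector_derivative \<xi> (at s)" for s
  have "AE s in lebesgue_on {a..b}. v s = g s"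
    using primitive_on_AE_vector_derivative[OF g] by eventually_elim (simp add: v_def vector_derivative_at)
  then have v: "primitive_on a b \<xi> v" by (rule primitive_on_AE_cong[OF g])
  have lift: "lift \<xi> u\<^sub>\<xi> s = (s, \<xi> s, v s, u\<^sub>\<xi> s)" for s by (simp add: lift_def v_def)
  interpret herglotz_curve L a b M \<xi> v u\<^sub>\<xi>
  proof
    show "primitive_on a b u\<^sub>\<xi> (\<lambda>s. L (s, \<xi> s, v s, u\<^sub>\<xi> s))"
      using herglotz_solution_primitive_on[OF \<open>a < b\<close> assms(8)] by (simp add: lift)
    fix \<eta> W assume \<eta>: "\<eta> \<in> Gamma a b (\<xi> a) (\<xi> b)" and W: "herglotz_solution L a b (u\<^sub>\<xi> a) \<eta> W"
    have e: "\<xi> a = x" "\<xi> b = y" "u\<^sub>\<xi> a = u"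
      using \<xi>G assms(8) by (auto simp: Gamma_def herglotz_solution_def)
    then have "\<eta> \<in> admissible L a b u x y" using \<eta> W unfolding admissible_def by auto
    from min[OF this] show "u\<^sub>\<xi> b \<le> W b" using J[OF assms(8)] J[of \<eta> W] W e by simp
  qed (use assms(1,6) M v in auto)
  have discount: "discount L a \<xi> u\<^sub>\<xi> s = disc s" if "s \<in> {a..b}" for s
  proof -
    \<comment> \<open>\<open>discount\<close> uses the Lebesgue integral and \<open>disc\<close> the
      gauge integral; absolute integrability makes them agree.\<close>
    have "(\<lambda>r. L_r L (r, \<xi> r, v r, u\<^sub>\<xi> r)) absolutely_integrable_on {a..s}"
      by (rule absolutely_integrable_on_subinterval[OF L_r_integrable]) (use that in auto)
    from set_lebesgue_integral_eq_integral(2)[OF this]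
    show ?thesis by (simp add: discount_def disc_def lift)
  qed
  have en: "energy L a \<xi> u\<^sub>\<xi> s = disc s * ham s" if "s \<in> {a..b}" for s
    using discount[OF that] by (simp add: energy_def ham_def lift v_def)
  obtain c where c: "AE s in lebesgue_on {a..b}. disc s * ham s = c - drift s" using energy_representation by blast
  \<comment> \<open>The right-hand side of the almost everywhere identity is already a primitive, so
    it serves as the continuous representative.\<close>
  define Ebar where "Ebar s = c - drift s" for s
  have "primitive_on a b (\<lambda>t. c + integral {a..t} (\<lambda>_. 0)) (\<lambda>_. 0)" by (rule primitive_on_integral) simp
  from primitive_on_diff_fun[OF this primitive_drift]
  have "primitive_on a b Ebar (\<lambda>s. - (disc s * L_t L (s, \<xi> s, v s, u\<^sub>\<xi> s)))" by (simp add: Ebar_def[abs_def])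
  then have E: "primitive_on a b Ebar (\<lambda>s. - discount L a \<xi> u\<^sub>\<xi> s * L_t L (lift \<xi> u\<^sub>\<xi> s))"
    by (rule primitive_on_cong) (simp add: discount lift)
  have "AE s in lebesgue_on {a..b}. s \<in> {a..b}" by (rule AE_I2) simp
  with c have "AE s in lebesgue_on {a..b}. Ebar s = energy L a \<xi> u\<^sub>\<xi> s"
    by eventually_elim (simp add: en Ebar_def)
  then show ?thesis
    using primitive_on_continuous[OF E] E unfolding primitive_on_iff_abs_continuous[OF ab'] by blast
qed

end
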